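(* Let $n\in\mathbb{N}\cup\{\infty\}$ and let $f=f_1\colon (L,\ell)\to(L',\ell')$ be a strict morphism of Lie $n$-algebras. Then $f$ can be factored in the category $\mathsf{Lie}_n\mathsf{Alg}$ as $$(L,\ell)\xrightarrow{\ \jmath\ }(\tilde L,\tilde\ell)\xrightarrow{\ \phi\ }(L',\ell'),$$ where $\jmath$ is a weak equivalence and $\phi$ is a fibration in $\mathsf{Lie}_n\mathsf{Alg}$.
   Context: Conventions: $\Bbbk$ is a field of characteristic zero and gradings are homological. For a $\mathbb{Z}$-graded vector space $V$, $\mathbf{s}V$ denotes the suspension, $(\mathbf{s}V)_i = V_{i-1}$, and $\bar S(V)=\bigoplus_{k\ge 1}S^k(V)$ is the reduced symmetric coalgebra, with $\bar\Delta(v_1\vee\cdots\vee v_m)=\sum_{p=1}^{m-1}\sum_{\sigma}\epsilon(\sigma)(v_{\sigma(1)}\vee\cdots\vee v_{\sigma(p)})\otimes(v_{\sigma(p+1)}\vee\cdots\vee v_{\sigma(m)})$, the inner sum over $(p,m-p)$-shuffles and $\epsilon(\sigma)$ the Koszul sign. Coderivations of, and coalgebra morphisms between, such coalgebras are uniquely determined by their components $\bar S(V)\to V$, resp. $\bar S(V)\to V'$. An $L_\infty$-algebra $(L,\ell)$ is a $\mathbb{Z}$-graded vector space $L$ with graded skew-symmetric maps $\ell_k\colon \Lambda^kL\to L$ of degree $k-2$ ($k\ge 1$) such that the degree $-1$ coderivation $\delta$ of $\bar S(\mathbf{s}L)$ with components $\delta^1_k=(-1)^{k(k-1)/2}\,\mathbf{s}\circ\ell_k\circ(\mathbf{s}^{-1})^{\otimes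 k}\colon S^k(\mathbf{s}L)\to \mathbf{s}L$ satisfies $\delta^2=0$. In particular $(L,\ell_1)$ is a chain complex. A (weak) $L_\infty$-morphism $f\colon(L,\ell)\to(L',\ell')$ is a collection of graded skew-symmetric maps $f_k\colon\Lambda^kL\to L'$ of degree $k-1$ ($k\ge1$) such that the coalgebra morphism $F\colon\bar S(\mathbf{s}L)\to\bar S(\mathbf{s}L')$ with components $F^1_k=(-1)^{k(k-1)/2}\,\mathbf{s}\circ f_k\circ(\mathbf{s}^{-1})^{\otimes k}$ satisfies $F\delta=\delta'F$. Composition is composition of the corresponding coalgebra morphisms; $f_1$ is always a chain map. The morphism $f$ is strict if $f_k=0$ for all $k\ge2$. A Lie $n$-algebra is an $L_\infty$-algebra whose underlying graded vector space is concentrated in degrees $0,1,\dots,n-1$ (in all degrees $\geq 0$ if $n=\infty$). $\mathsf{Lie}_n\mathsf{Alg}$ is the category of Lie $n$-algebras and weak $L_\infty$-morphisms. A morphism $f$ in it is a weak equivalence if $f_1\colon(L,\ell_1)\to(L',\ell'_1)$ is a quasi-isomorphism, and a fibration if $f_1$ is surjective in all positive degrees. *)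

theory Defs
  imports
    "HOL-Library.Poly_Mapping"
    "HOL-Library.Product_Plus"
    "HOL-Library.Extended_Nat"
    "HOL-Combinatorics.Permutations"
    "HOL-Computational_Algebra.Polynomial"
begin

section \<open>Graded vector spaces\<close>

text \<open>
  A graded vector space is a family of subspaces (one for each integer degree) of an ambient
  vector space. The ambient space only supplies the operations: the total space is the external
  direct sum of the components, so components of different degrees may overlap as sets. A
  homogeneous element is a pair of a degree and an element of that component.
\<close>

record ('k, 'a) gvs =
  scl :: "'k \<Rightarrow> 'a \<Rightarrow> 'a"
  cmp :: "int \<Rightarrow> 'a set"

definition graded_space :: "('k::field, 'a::ab_group_add) gvs \<Rightarrow> bool" where
  "graded_space V \<longleftrightarrow> vector_space (scl V) \<and> (\<forall>i. module.subspace (scl V) (cmp V i))"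

definition susp :: "('k, 'a) gvs \<Rightarrow> ('k, 'a) gvs" where
  "susp V = V\<lparr>cmp := (\<lambda>i. cmp V (i - 1))\<rparr>"

type_synonym 'a word = "(int \<times> 'a) list"

definition deg :: "'a word \<Rightarrow> int" where
  "deg w = sum_list (map fst w)"

definition sgn_pow :: "int \<Rightarrow> 'k::ring_1" where
  "sgn_pow d = (if even d then 1 else - 1)"

definition words :: "('k, 'a) gvs \<Rightarrow> 'a word set" where
  "words V = {w. w \<noteq> [] \<and> (\<forall>(i, v) \<in> set w. v \<in> cmp V i)}"


section \<open>Formal linear combinations\<close>

definition psc :: "'k::field \<Rightarrow> ('x \<Rightarrow>\<^sub>0 'k) \<Rightarrow> ('x \<Rightarrow>\<^sub>0 'k)" where
  "psc c x = Poly_Mapping.map ((*) c) x"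

lemma lookup_psc [simp]: "Poly_Mapping.lookup (psc c x) w = c * Poly_Mapping.lookup x w"
  by (simp add: psc_def Poly_Mapping.map.rep_eq when_def)

global_interpretation comb: vector_space "psc :: 'k::field \<Rightarrow> ('x \<Rightarrow>\<^sub>0 'k) \<Rightarrow> ('x \<Rightarrow>\<^sub>0 'k)"
  by unfold_locales (auto intro!: poly_mapping_eqI simp: lookup_add algebra_simps)

definition mon :: "'x \<Rightarrow> ('x \<Rightarrow>\<^sub>0 'k::field)" where
  "mon w = Poly_Mapping.single w 1"

definition lin :: "('x \<Rightarrow> ('y \<Rightarrow>\<^sub>0 'k::field)) \<Rightarrow> ('x \<Rightarrow>\<^sub>0 'k) \<Rightarrow> ('y \<Rightarrow>\<^sub>0 'k)" where
  "lin g x = (\<Sum>w \<in> Poly_Mapping.keys x. psc (Poly_Mapping.lookup x w) (g w))"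

definition tens :: "('x \<Rightarrow>\<^sub>0 'k::field) \<Rightarrow> ('y \<Rightarrow>\<^sub>0 'k) \<Rightarrow> ('x \<times> 'y \<Rightarrow>\<^sub>0 'k)" where
  "tens x y = lin (\<lambda>u. lin (\<lambda>w. mon (u, w)) y) x"


section \<open>The reduced symmetric coalgebra\<close>

text \<open>
  The reduced symmetric coalgebra of \<open>V\<close> is the quotient of the free vector space on the
  nonempty words of homogeneous elements of \<open>V\<close> (the word \<open>[v\<^sub>1, \<dots>, v\<^sub>m]\<close> stands for
  \<open>v\<^sub>1 \<or> \<dots> \<or> v\<^sub>m\<close>) by the subspace \<open>sym_rel V\<close> of relations: multilinearity and graded
  commutativity. The quotient is not formed as a separate type; its elements are represented by
  formal linear combinations, and equality in it is congruence modulo \<open>sym_rel V\<close>.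
\<close>

definition free_space :: "('k::field, 'a) gvs \<Rightarrow> ('a word \<Rightarrow>\<^sub>0 'k) set" where
  "free_space V = {x. Poly_Mapping.keys x \<subseteq> words V}"

definition sym_rel :: "('k::field, 'a::ab_group_add) gvs \<Rightarrow> ('a word \<Rightarrow>\<^sub>0 'k) set" where
  "sym_rel V = comb.span
     ({mon (a @ [(i, v + v')] @ b) - mon (a @ [(i, v)] @ b) - mon (a @ [(i, v')] @ b) | a b i v v'.
         a @ [(i, v)] @ b \<in> words V \<and> v' \<in> cmp V i} \<union>
      {mon (a @ [(i, scl V c v)] @ b) - psc c (mon (a @ [(i, v)] @ b)) | a b i c v.
         a @ [(i, v)] @ b \<in> words V} \<union>
      {mon (a @ [x, y] @ b) - psc (sgn_pow (fst x * fst y)) (mon (a @ [y, x] @ b)) | a b x y.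
         a @ [x, y] @ b \<in> words V})"

definition sym_eq :: "('k::field, 'a::ab_group_add) gvs \<Rightarrow> ('a word \<Rightarrow>\<^sub>0 'k) \<Rightarrow> ('a word \<Rightarrow>\<^sub>0 'k) \<Rightarrow> bool" where
  "sym_eq V x y \<longleftrightarrow> x - y \<in> sym_rel V"

text \<open>
  The same for the tensor square of the symmetric coalgebra: the quotient of the free space on
  pairs of words by the relations holding in either factor.
\<close>

definition tens_rel :: "('k::field, 'a::ab_group_add) gvs \<Rightarrow> ('a word \<times> 'a word \<Rightarrow>\<^sub>0 'k) set" where
  "tens_rel V = comb.span
     ({tens r (mon w) | r w. r \<in> sym_rel V \<and> w \<in> words V} \<union>
      {tens (mon w) r | r w. r \<in> sym_rel V \<and> w \<in> words V})"

definition tens_eq ::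
  "('k::field, 'a::ab_group_add) gvs \<Rightarrow> ('a word \<times> 'a word \<Rightarrow>\<^sub>0 'k) \<Rightarrow> ('a word \<times> 'a word \<Rightarrow>\<^sub>0 'k) \<Rightarrow> bool" where
  "tens_eq V x y \<longleftrightarrow> x - y \<in> tens_rel V"

text \<open>\<open>(p, m - p)\<close>-shuffles; positions in words are numbered from 0.\<close>

definition shuffle_perms :: "nat \<Rightarrow> nat \<Rightarrow> (nat \<Rightarrow> nat) set" where
  "shuffle_perms p m =
     {\<sigma>. \<sigma> permutes {..<m} \<and> strict_mono_on {..<p} \<sigma> \<and> strict_mono_on {p..<m} \<sigma>}"

definition koszul_sign :: "(nat \<Rightarrow> nat) \<Rightarrow> 'a word \<Rightarrow> 'k::field" where
  "koszul_sign \<sigma> w =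
     (\<Prod>(i, j) \<in> {(i, j). i < j \<and> j < length w \<and> \<sigma> j < \<sigma> i}.
        sgn_pow (fst (w ! \<sigma> i) * fst (w ! \<sigma> j)))"

definition comult :: "'a word \<Rightarrow> ('a word \<times> 'a word \<Rightarrow>\<^sub>0 'k::field)" where
  "comult w =
     (\<Sum>p = 1..<length w. \<Sum>\<sigma> \<in> shuffle_perms p (length w).
        psc (koszul_sign \<sigma> w)
          (mon (map (\<lambda>i. w ! \<sigma> i) [0..<p], map (\<lambda>i. w ! \<sigma> i) [p..<length w])))"

text \<open>
  A linear map between symmetric coalgebras, homogeneous of degree \<open>d\<close>, is given by its values
  on words; its linear extension \<open>lin g\<close> has to respect the relations.
\<close>

definition sym_map ::
  "int \<Rightarrow> ('k::field, 'a::ab_group_add) gvs \<Rightarrow> ('k, 'b::ab_group_add) gvs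
     \<Rightarrow> ('a word \<Rightarrow> ('b word \<Rightarrow>\<^sub>0 'k)) \<Rightarrow> bool" where
  "sym_map d V W g \<longleftrightarrow>
     (\<forall>w \<in> words V. g w \<in> free_space W) \<and>
     (\<forall>r \<in> sym_rel V. lin g r \<in> sym_rel W) \<and>
     (\<forall>w \<in> words V. \<exists>y. Poly_Mapping.keys y \<subseteq> {u \<in> words W. deg u = deg w + d} \<and> sym_eq W (g w) y)"

text \<open>
  The sign in the second summand is the Koszul sign of moving the degree \<open>-1\<close> map past \<open>a\<close>.
\<close>

definition coderivation ::
  "('k::field, 'a::ab_group_add) gvs \<Rightarrow> ('a word \<Rightarrow> ('a word \<Rightarrow>\<^sub>0 'k)) \<Rightarrow> bool" where
  "coderivation V \<delta> \<longleftrightarrow> sym_map (-1) V V \<delta> \<and>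
     (\<forall>w \<in> words V.
        tens_eq V (lin comult (\<delta> w))
          (lin (\<lambda>(a, b). tens (\<delta> a) (mon b) + psc (sgn_pow (deg a)) (tens (mon a) (\<delta> b)))
             (comult w)))"

definition coalgebra_morphism ::
  "('k::field, 'a::ab_group_add) gvs \<Rightarrow> ('k, 'b::ab_group_add) gvs
     \<Rightarrow> ('a word \<Rightarrow> ('b word \<Rightarrow>\<^sub>0 'k)) \<Rightarrow> bool" where
  "coalgebra_morphism V W F \<longleftrightarrow> sym_map 0 V W F \<and>
     (\<forall>w \<in> words V.
        tens_eq W (lin comult (F w)) (lin (\<lambda>(a, b). tens (F a) (F b)) (comult w)))"

text \<open>
  The projection of the symmetric coalgebra of \<open>V\<close> onto \<open>V\<close>; an element of the latter is
  written as the family of its homogeneous components.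
\<close>

definition proj1 :: "('k::field, 'a::ab_group_add) gvs \<Rightarrow> ('a word \<Rightarrow>\<^sub>0 'k) \<Rightarrow> int \<Rightarrow> 'a" where
  "proj1 V x i =
     (\<Sum>u \<in> {u \<in> Poly_Mapping.keys x. length u = 1 \<and> fst (hd u) = i}. scl V (Poly_Mapping.lookup x u) (snd (hd u)))"

text \<open>\<open>q w\<close>, for a word \<open>w\<close> of length \<open>k\<close>, is the \<open>k\<close>-th component applied to \<open>w\<close>.\<close>

definition has_components ::
  "int \<Rightarrow> ('k::field, 'a) gvs \<Rightarrow> ('k, 'b::ab_group_add) gvs
     \<Rightarrow> ('a word \<Rightarrow> ('b word \<Rightarrow>\<^sub>0 'k)) \<Rightarrow> ('a word \<Rightarrow> 'b) \<Rightarrow> bool" where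
  "has_components d V W g q \<longleftrightarrow>
     (\<forall>w \<in> words V. proj1 W (g w) = (\<lambda>i. if i = deg w + d then q w else 0))"


section \<open>L-infinity algebras and morphisms\<close>

text \<open>
  A graded skew-symmetric \<open>k\<close>-linear map of degree \<open>d\<close>. The value on arguments that do not form
  a word of length \<open>k\<close> in \<open>L\<close> is irrelevant.
\<close>

definition skew_map ::
  "nat \<Rightarrow> int \<Rightarrow> ('k::field, 'a::ab_group_add) gvs \<Rightarrow> ('k, 'b::ab_group_add) gvs
     \<Rightarrow> ('a word \<Rightarrow> 'b) \<Rightarrow> bool" where
  "skew_map k d L L' m \<longleftrightarrow>
     (\<forall>w \<in> words L. length w = k \<longrightarrow> m w \<in> cmp L' (deg w + d)) \<and>
     (\<forall>a b i v v'. a @ [(i, v)] @ b \<in> words L \<and> v' \<in> cmp L i \<and> length a + 1 + length b = k \<longrightarrow>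
        m (a @ [(i, v + v')] @ b) = m (a @ [(i, v)] @ b) + m (a @ [(i, v')] @ b)) \<and>
     (\<forall>a b i c v. a @ [(i, v)] @ b \<in> words L \<and> length a + 1 + length b = k \<longrightarrow>
        m (a @ [(i, scl L c v)] @ b) = scl L' c (m (a @ [(i, v)] @ b))) \<and>
     (\<forall>a b x y. a @ [x, y] @ b \<in> words L \<and> length a + 2 + length b = k \<longrightarrow>
        m (a @ [x, y] @ b) = scl L' (- sgn_pow (fst x * fst y)) (m (a @ [y, x] @ b)))"

text \<open>
  \<open>(-1)\<^bsup>k(k-1)/2\<^esup> s \<circ> m\<^sub>k \<circ> (s\<^sup>-\<^sup>1)\<^bsup>\<otimes>k\<^esup>\<close> on words of length \<open>k\<close> in the suspension. By the Koszul rule,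
  \<open>(s\<^sup>-\<^sup>1)\<^bsup>\<otimes>k\<^esup>(v\<^sub>1 \<otimes> \<dots> \<otimes> v\<^sub>k)\<close> is \<open>s\<^sup>-\<^sup>1v\<^sub>1 \<otimes> \<dots> \<otimes> s\<^sup>-\<^sup>1v\<^sub>k\<close> with the sign whose exponent is the sum of
  \<open>(k - j) |v\<^sub>j|\<close> over \<open>j = 1, \<dots>, k\<close>, because the \<open>j\<close>-th vector is passed by \<open>k - j\<close> copies of the
  degree \<open>-1\<close> map \<open>s\<^sup>-\<^sup>1\<close>.
\<close>

definition suspended :: "('k::field, 'b) gvs \<Rightarrow> (nat \<Rightarrow> 'a word \<Rightarrow> 'b) \<Rightarrow> 'a word \<Rightarrow> 'b" where
  "suspended L' m w =
     (let k = length w in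
      scl L' (sgn_pow (int (k * (k - 1) div 2)) *
              sgn_pow (\<Sum>j<k. int (k - 1 - j) * fst (w ! j)))
        (m k (map (\<lambda>(i, v). (i - 1, v)) w)))"

text \<open>
  \<open>codiff L l \<delta>\<close>: \<open>\<delta>\<close> is the coderivation with components determined by \<open>l\<close>. Such a \<open>\<delta>\<close> is unique
  modulo the relations, so the existential quantification over it below merely names it; likewise
  for \<open>comorph\<close>.
\<close>

definition codiff ::
  "('k::field, 'a::ab_group_add) gvs \<Rightarrow> (nat \<Rightarrow> 'a word \<Rightarrow> 'a) \<Rightarrow> ('a word \<Rightarrow> ('a word \<Rightarrow>\<^sub>0 'k)) \<Rightarrow> bool"
  where
  "codiff L l \<delta> \<longleftrightarrow> coderivation (susp L) \<delta> \<and>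
     has_components (-1) (susp L) (susp L) \<delta> (suspended L l)"

definition comorph ::
  "('k::field, 'a::ab_group_add) gvs \<Rightarrow> ('k, 'b::ab_group_add) gvs \<Rightarrow> (nat \<Rightarrow> 'a word \<Rightarrow> 'b)
     \<Rightarrow> ('a word \<Rightarrow> ('b word \<Rightarrow>\<^sub>0 'k)) \<Rightarrow> bool" where
  "comorph L L' f F \<longleftrightarrow> coalgebra_morphism (susp L) (susp L') F \<and>
     has_components 0 (susp L) (susp L') F (suspended L' f)"

definition Linf_algebra ::
  "('k::field_char_0, 'a::ab_group_add) gvs \<Rightarrow> (nat \<Rightarrow> 'a word \<Rightarrow> 'a) \<Rightarrow> bool" where
  "Linf_algebra L l \<longleftrightarrow> graded_space L \<and>
     (\<forall>k\<ge>1. skew_map k (int k - 2) L L (l k)) \<and>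
     (\<exists>\<delta>. codiff L l \<delta> \<and> (\<forall>w \<in> words (susp L). sym_eq (susp L) (lin \<delta> (\<delta> w)) 0))"

definition Linf_morphism ::
  "('k::field_char_0, 'a::ab_group_add) gvs \<Rightarrow> (nat \<Rightarrow> 'a word \<Rightarrow> 'a)
     \<Rightarrow> ('k, 'b::ab_group_add) gvs \<Rightarrow> (nat \<Rightarrow> 'b word \<Rightarrow> 'b) \<Rightarrow> (nat \<Rightarrow> 'a word \<Rightarrow> 'b) \<Rightarrow> bool" where
  "Linf_morphism L l L' l' f \<longleftrightarrow>
     (\<forall>k\<ge>1. skew_map k (int k - 1) L L' (f k)) \<and>
     (\<exists>\<delta> \<delta>' F. codiff L l \<delta> \<and> codiff L' l' \<delta>' \<and> comorph L L' f F \<and>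
        (\<forall>w \<in> words (susp L). sym_eq (susp L') (lin F (\<delta> w)) (lin \<delta>' (F w))))"

text \<open>\<open>h = g \<circ> f\<close>\<close>

definition Linf_composite ::
  "('k::field_char_0, 'a::ab_group_add) gvs \<Rightarrow> ('k, 'b::ab_group_add) gvs \<Rightarrow> ('k, 'c::ab_group_add) gvs
     \<Rightarrow> (nat \<Rightarrow> 'b word \<Rightarrow> 'c) \<Rightarrow> (nat \<Rightarrow> 'a word \<Rightarrow> 'b) \<Rightarrow> (nat \<Rightarrow> 'a word \<Rightarrow> 'c) \<Rightarrow> bool" where
  "Linf_composite L L' L'' g f h \<longleftrightarrow>
     (\<exists>F G H. comorph L L' f F \<and> comorph L' L'' g G \<and> comorph L L'' h H \<and>
        (\<forall>w \<in> words (susp L). sym_eq (susp L'') (H w) (lin G (F w))))"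

definition strict_on ::
  "('k, 'a) gvs \<Rightarrow> (nat \<Rightarrow> 'a word \<Rightarrow> 'b::zero) \<Rightarrow> bool" where
  "strict_on L f \<longleftrightarrow> (\<forall>k\<ge>2. \<forall>w \<in> words L. length w = k \<longrightarrow> f k w = 0)"


section \<open>Lie n-algebras, weak equivalences and fibrations\<close>

definition Lie_algebra ::
  "enat \<Rightarrow> ('k::field_char_0, 'a::ab_group_add) gvs \<Rightarrow> (nat \<Rightarrow> 'a word \<Rightarrow> 'a) \<Rightarrow> bool" where
  "Lie_algebra n L l \<longleftrightarrow> Linf_algebra L l \<and>
     (\<forall>i. \<not> (0 \<le> i \<and> enat (nat i) < n) \<longrightarrow> cmp L i = {0})"

definition homologous ::
  "('k, 'a::ab_group_add) gvs \<Rightarrow> (nat \<Rightarrow> 'a word \<Rightarrow> 'a) \<Rightarrow> int \<Rightarrow> ('a \<times> 'a) set" where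
  "homologous L l i =
     {(x, y). x \<in> cmp L i \<and> l 1 [(i, x)] = 0 \<and> y \<in> cmp L i \<and> l 1 [(i, y)] = 0 \<and>
        (\<exists>z \<in> cmp L (i + 1). x - y = l 1 [(i + 1, z)])}"

definition homology ::
  "('k, 'a::ab_group_add) gvs \<Rightarrow> (nat \<Rightarrow> 'a word \<Rightarrow> 'a) \<Rightarrow> int \<Rightarrow> 'a set set" where
  "homology L l i = {x \<in> cmp L i. l 1 [(i, x)] = 0} // homologous L l i"

definition homology_map ::
  "('k, 'b::ab_group_add) gvs \<Rightarrow> (nat \<Rightarrow> 'b word \<Rightarrow> 'b) \<Rightarrow> (nat \<Rightarrow> 'a word \<Rightarrow> 'b) \<Rightarrow> int
     \<Rightarrow> 'a set \<Rightarrow> 'b set" where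
  "homology_map L' l' f i X = (\<Union>x\<in>X. homologous L' l' i `` {f 1 [(i, x)]})"

definition weak_equivalence ::
  "('k, 'a::ab_group_add) gvs \<Rightarrow> (nat \<Rightarrow> 'a word \<Rightarrow> 'a)
     \<Rightarrow> ('k, 'b::ab_group_add) gvs \<Rightarrow> (nat \<Rightarrow> 'b word \<Rightarrow> 'b) \<Rightarrow> (nat \<Rightarrow> 'a word \<Rightarrow> 'b) \<Rightarrow> bool" where
  "weak_equivalence L l L' l' f \<longleftrightarrow>
     (\<forall>i. bij_betw (homology_map L' l' f i) (homology L l i) (homology L' l' i))"

definition fibration ::
  "('k, 'a) gvs \<Rightarrow> ('k, 'b) gvs \<Rightarrow> (nat \<Rightarrow> 'a word \<Rightarrow> 'b) \<Rightarrow> bool" where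
  "fibration L L' f \<longleftrightarrow> (\<forall>i>0. (\<lambda>x. f 1 [(i, x)]) ` cmp L i = cmp L' i)"

end

theory Submission
  imports Defs
begin

text \<open>
  The factorisation is the classical one through the path object, which is available because the
  polynomial forms \<open>\<Omega> = k[t, dt]\<close> are a commutative differential graded algebra: \<open>M\<close> is the
  pullback of \<open>L' \<otimes> \<Omega>\<close> along \<open>f\<close> and evaluation at \<open>t = 0\<close>, truncated to nonnegative degrees. The
  morphism \<open>j\<close> sends \<open>x\<close> to \<open>(x, f x)\<close> with a constant second component, and \<open>\<phi>\<close> is evaluation at \<open>t = 1\<close>;
  both are strict. Integration \<open>\<integral>\<^sub>0\<^sup>t\<close> contracts \<open>M\<close> onto \<open>L\<close>.

  All signs are handled on the suspension. A family of graded symmetric brackets extends to a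
  coderivation, whose square is zero modulo the relations exactly if the generalised Jacobi
  identities hold. Conversely the identities for \<open>L\<close>, \<open>L'\<close> and \<open>f\<close> are extracted from the given
  coderivations and coalgebra morphisms, which are determined by their components because in
  characteristic zero an element of the symmetric coalgebra with zero reduced comultiplication is
  linear. Identities between brackets on \<open>L' \<otimes> \<Omega>\<close> are checked after evaluation at every scalar \<open>t\<close>.
\<close>

text \<open>The form \<open>dt\<close> has degree -1, so \<open>L' \<otimes> \<Omega>\<close>
  reaches one degree below \<open>L'\<close>; this is the obstacle behind the truncation. In degree
  0 only elements killed by the unary bracket are kept. Closure of the result under all brackets
  needs just the Jacobi identities for one and two arguments: any other word of nonzero letters
  gives zero by definition or has its output in positive degree. At the upper end nothing has to be
  cut, since the coefficient of \<open>dt\<close> in an element of degree \<open>i\<close> lies in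
  degree \<open>i + 1\<close> of \<open>L'\<close>, which is beyond the bound as soon as
  \<open>i\<close> is. Truncation also explains why surjectivity at \<open>t = 1\<close> is obtained
  in positive degrees only: the natural preimage \<open>x t\<close> of \<open>x\<close> need not be
  closed. Strictness of \<open>f\<close> makes the pullback condition \<open>p(0) = f x\<close>
  linear and lets it pass through brackets letter by letter.\<close>

section \<open>Signs and additive subgroups\<close>

definition sg :: "int \<Rightarrow> 'c::ab_group_add \<Rightarrow> 'c" where
  "sg d x = (if even d then x else - x)"

lemma sg_simps [simp]: "sg 0 x = x" "sg d 0 = 0" "sg a (sg b x) = sg (a + b) x"
  by (auto simp: sg_def)

lemma sg_add: "sg d (x + y) = sg d x + sg d y"
  and sg_uminus: "sg d (- x) = - sg d x"
  and sg_diff: "sg d (x - y) = sg d x - sg d y"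
  by (auto simp: sg_def)

text \<open>Koszul sign identities are reduced to this: exponents stay integers and are compared
  only modulo 2, so that signs act on any abelian group and no scalars enter.\<close>

lemma sg_parity: "even (a - b) \<Longrightarrow> sg a x = sg b x"
  by (auto simp: sg_def)

lemma sg_hom:
  assumes "\<And>x y. h (x + y) = h x + h y"
  shows "h (sg d x) = sg d (h x)"
proof -
  interpret additive h by (unfold_locales) (rule assms)
  show ?thesis by (simp add: sg_def minus)
qed

lemma (in vector_space) scale_sgn_pow [simp]: "scale (sgn_pow d) x = sg d x"
  by (simp add: sg_def sgn_pow_def)

lemma (in vector_space) scale_sg: "scale c (sg d x) = sg d (scale c x)"
  by (simp add: sg_def)

lemma sgn_pow_add: "sgn_pow (a + b) = sgn_pow a * sgn_pow b"
  by (simp add: sgn_pow_def)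

text \<open>One notion covers exact identities (\<open>{0}\<close>), congruences modulo the relation
  spaces, and homogeneous components; signed sums over splittings need nothing beyond closure under
  differences.\<close>

definition subgroup_of :: "'c::ab_group_add set \<Rightarrow> bool" where
  "subgroup_of K \<longleftrightarrow> 0 \<in> K \<and> (\<forall>x\<in>K. \<forall>y\<in>K. x - y \<in> K)"

lemma
  assumes "subgroup_of K"
  shows subgroup_of_0: "0 \<in> K"
    and subgroup_of_diff: "x \<in> K \<Longrightarrow> y \<in> K \<Longrightarrow> x - y \<in> K"
    and subgroup_of_uminus: "x \<in> K \<Longrightarrow> - x \<in> K"
    and subgroup_of_add: "x \<in> K \<Longrightarrow> y \<in> K \<Longrightarrow> x + y \<in> K"
    and subgroup_of_sg: "x \<in> K \<Longrightarrow> sg d x \<in> K"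
proof -
  show 0: "0 \<in> K" and d: "x \<in> K \<Longrightarrow> y \<in> K \<Longrightarrow> x - y \<in> K" for x y
    using assms by (auto simp: subgroup_of_def)
  show m: "x \<in> K \<Longrightarrow> - x \<in> K" for x
    using d[OF 0, of x] by simp
  show "x \<in> K \<Longrightarrow> y \<in> K \<Longrightarrow> x + y \<in> K"
    using d[of x "- y"] m[of y] by simp
  show "x \<in> K \<Longrightarrow> sg d x \<in> K"
    using m by (simp add: sg_def)
qed

lemmas subgroup_of_intros = subgroup_of_0 subgroup_of_diff subgroup_of_uminus subgroup_of_add subgroup_of_sg

lemma subgroup_of_sum:
  assumes "subgroup_of K" "\<And>i. i \<in> I \<Longrightarrow> f i \<in> K"
  shows "sum f I \<in> K"
  using assms(2) by (induction I rule: infinite_finite_induct) (auto intro: subgroup_of_intros[OF assms(1)])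

lemma subgroup_of_zero [simp]: "subgroup_of {0}"
  by (simp add: subgroup_of_def)

lemma (in vector_space) subspace_subgroup_of: "subspace S \<Longrightarrow> subgroup_of S"
  by (auto simp: subgroup_of_def subspace_0 subspace_diff)


section \<open>Linear extension\<close>

text \<open>Generalises \<open>lin\<close> to targets that are not spaces of formal combinations;
  the projection \<open>proj1\<close> takes values in \<open>V\<close> itself.\<close>

definition lext :: "('k \<Rightarrow> 'b \<Rightarrow> 'b) \<Rightarrow> ('x \<Rightarrow> 'b) \<Rightarrow> ('x \<Rightarrow>\<^sub>0 'k::zero) \<Rightarrow> 'b::comm_monoid_add" where
  "lext s h x = (\<Sum>w \<in> Poly_Mapping.keys x. s (Poly_Mapping.lookup x w) (h w))"

context vector_space
begin

lemma lext_superset: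
  fixes x :: "'x \<Rightarrow>\<^sub>0 'a"
  assumes "finite A" "Poly_Mapping.keys x \<subseteq> A"
  shows "lext scale h x = (\<Sum>w \<in> A. scale (Poly_Mapping.lookup x w) (h w))"
  unfolding lext_def using assms
  by (intro sum.mono_neutral_left) (auto simp: in_keys_iff)

lemma lext_add: "lext scale h (x + y) = lext scale h x + lext scale h y"
proof -
  let ?A = "Poly_Mapping.keys x \<union> Poly_Mapping.keys y"
  have "Poly_Mapping.keys (x + y) \<subseteq> ?A" by (rule keys_add)
  then show ?thesis
    by (simp add: lext_superset[of ?A] lookup_add scale_left_distrib sum.distrib)
qed

lemma lext_psc: "lext scale h (psc c x) = scale c (lext scale h x)"
proof -
  have "Poly_Mapping.keys (psc c x) \<subseteq> Poly_Mapping.keys x" by (auto simp: in_keys_iff)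
  then show ?thesis
    by (simp add: lext_superset[of "Poly_Mapping.keys x"] scale_sum_right)
qed

lemma lext_mon [simp]: "lext scale h (mon w) = h w"
  by (simp add: lext_def mon_def)

lemma lext_0 [simp]: "lext scale h 0 = 0"
  by (simp add: lext_def)

lemma lext_uminus: "lext scale h (- x) = - lext scale h x"
  using lext_add[of h x "- x"] by (simp add: add_eq_0_iff2)

lemma lext_diff: "lext scale h (x - y) = lext scale h x - lext scale h y"
  using lext_add[of h x "- y"] by (simp add: lext_uminus)

lemma lext_sum: "lext scale h (sum g I) = (\<Sum>i\<in>I. lext scale h (g i))"
  by (induction I rule: infinite_finite_induct) (auto simp: lext_add)

lemma lext_cong: "(\<And>w. w \<in> Poly_Mapping.keys x \<Longrightarrow> h w = h' w) \<Longrightarrow> lext scale h x = lext scale h' x"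
  by (simp add: lext_def)

lemma lext_fun_add: "lext scale (\<lambda>w. h w + h' w) x = lext scale h x + lext scale h' x"
  by (simp add: lext_def scale_right_distrib sum.distrib)

lemma lext_fun_diff: "lext scale (\<lambda>w. h w - h' w) x = lext scale h x - lext scale h' x"
  by (simp add: lext_def scale_right_diff_distrib sum_subtractf)

lemma lext_fun_psc: "lext scale (\<lambda>w. scale c (h w)) x = scale c (lext scale h x)"
  by (simp add: lext_def scale_sum_right mult.commute)

lemma lext_mem:
  assumes "subspace S" "\<And>w. w \<in> Poly_Mapping.keys x \<Longrightarrow> h w \<in> S"
  shows "lext scale h x \<in> S"
  unfolding lext_def using assms by (intro subspace_sum subspace_scale)

lemma lext_span:
  assumes "x \<in> comb.span B" "subspace S" "\<And>b. b \<in> B \<Longrightarrow> lext scale h b \<in> S"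
  shows "lext scale h x \<in> S"
proof -
  have "comb.subspace {x. lext scale h x \<in> S}"
    using assms(2) by (auto simp: comb.subspace_def subspace_def lext_add lext_psc)
  then have "comb.span B \<subseteq> {x. lext scale h x \<in> S}"
    using assms(3) by (intro comb.span_minimal) auto
  with assms(1) show ?thesis by auto
qed

end

lemma lin_eq_lext: "lin = lext psc"
  by (intro ext) (simp add: lin_def lext_def)

lemmas lin_add = comb.lext_add[folded lin_eq_lext]
  and lin_psc = comb.lext_psc[folded lin_eq_lext]
  and lin_mon [simp] = comb.lext_mon[folded lin_eq_lext]
  and lin_0 [simp] = comb.lext_0[folded lin_eq_lext]
  and lin_diff = comb.lext_diff[folded lin_eq_lext]
  and lin_cong = comb.lext_cong[folded lin_eq_lext]
  and lin_fun_add = comb.lext_fun_add[folded lin_eq_lext]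
  and lin_fun_diff = comb.lext_fun_diff[folded lin_eq_lext]
  and lin_fun_psc = comb.lext_fun_psc[folded lin_eq_lext]
  and lin_mem = comb.lext_mem[folded lin_eq_lext]
  and lin_span = comb.lext_span[folded lin_eq_lext]

lemma (in vector_space) lext_lin: "lext scale h (lin g x) = lext scale (\<lambda>w. lext scale h (g w)) x"
  unfolding lin_def lext_sum lext_psc by (simp add: lext_def)

lemmas lin_lin = comb.lext_lin[folded lin_eq_lext]

lemma lin_mon_id: "lin mon x = x"
proof (rule poly_mapping_eqI)
  fix k
  have "Poly_Mapping.lookup (lin mon x) k
      = (\<Sum>w\<in>Poly_Mapping.keys x. Poly_Mapping.lookup x w * Poly_Mapping.lookup (mon w) k)"
    by (simp add: lin_def Poly_Mapping.lookup_sum)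
  also have "\<dots> = (\<Sum>w\<in>Poly_Mapping.keys x. if w = k then Poly_Mapping.lookup x w else 0)"
    by (intro sum.cong) (auto simp: mon_def lookup_single)
  also have "\<dots> = Poly_Mapping.lookup x k"
    by (simp add: in_keys_iff)
  finally show "Poly_Mapping.lookup (lin mon x) k = Poly_Mapping.lookup x k" .
qed

lemma tens_mon [simp]: "tens (mon u) (mon v) = mon (u, v)"
  by (simp add: tens_def)

lemma tens_add_left: "tens (x + x') y = tens x y + tens x' y"
  and tens_diff_left: "tens (x - x') y = tens x y - tens x' y"
  and tens_0_left [simp]: "tens 0 y = 0"
  by (simp_all add: tens_def lin_add lin_diff)

lemma tens_add_right: "tens x (y + y') = tens x y + tens x y'"
  and tens_diff_right: "tens x (y - y') = tens x y - tens x y'"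
  and tens_0_right [simp]: "tens x 0 = 0"
  by (simp_all add: tens_def lin_add lin_diff lin_fun_add lin_fun_diff) (simp add: lin_def)

lemma tens_psc_right: "tens x (psc c y) = psc c (tens x y)"
  by (simp add: tens_def lin_psc lin_fun_psc)

lemma tens_sum_right: "tens x (sum g I) = (\<Sum>i\<in>I. tens x (g i))"
  by (induction I rule: infinite_finite_induct) (simp_all add: tens_add_right)

lemma tens_eq_lin: "tens x y = lin (\<lambda>w. tens x (mon w)) y"
proof -
  have "tens x (lin mon y) = lin (\<lambda>w. tens x (mon w)) y"
    unfolding lin_def[of _ y] by (simp add: tens_sum_right tens_psc_right)
  then show ?thesis by (simp add: lin_mon_id)
qed

section \<open>Sums over unshuffles\<close>

text \<open>
  The sum of \<open>\<phi> u v\<close>, with Koszul signs, over all splittings of \<open>w\<close> into complementary subwords \<open>u\<close>, \<open>v\<close>.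
  Both may be empty, so \<open>\<phi> u v = u \<otimes> v\<close> gives the unreduced comultiplication.
\<close>

fun unsh :: "('a word \<Rightarrow> 'a word \<Rightarrow> 'c::ab_group_add) \<Rightarrow> 'a word \<Rightarrow> 'c" where
  "unsh \<phi> [] = \<phi> [] []"
| "unsh \<phi> (z # w) = unsh (\<lambda>u v. \<phi> (z # u) v) w + unsh (\<lambda>u v. sg (fst z * deg u) (\<phi> u (z # v))) w"

lemma deg_simps [simp]: "deg [] = 0" "deg (z # w) = fst z + deg w" "deg (u @ v) = deg u + deg v"
  by (simp_all add: deg_def)

lemma deg_mset: "deg w = sum_mset (image_mset fst (mset w))"
  by (induction w) simp_all

text \<open>A splitting is remembered only through the multisets of letters. The arguments below use
  the degree, the length and the membership of letters, none of which depends on the order inside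
  the two parts.\<close>

lemma mset_split:
  assumes "mset u + mset v = mset w"
  shows "deg w = deg u + deg v" "length w = length u + length v" "set w = set u \<union> set v"
  using arg_cong[OF assms, of "\<lambda>M. sum_mset (image_mset fst M)"]
    arg_cong[OF assms, of size] arg_cong[OF assms, of set_mset]
  by (simp_all add: deg_mset)

lemma unsh_cong:
  "(\<And>u v. mset u + mset v = mset w \<Longrightarrow> \<phi> u v = \<psi> u v) \<Longrightarrow> unsh \<phi> w = unsh \<psi> w"
proof (induction w arbitrary: \<phi> \<psi>)
  case (Cons z w)
  show ?case
    unfolding unsh.simps by (intro arg_cong2[of _ _ _ _ "(+)"] Cons.IH arg_cong[of _ _ "sg _"] Cons.prems) auto
qed auto

lemma unsh_hom:
  "(\<And>x y. h (x + y) = h x + h y) \<Longrightarrow> h (unsh \<phi> w) = unsh (\<lambda>u v. h (\<phi> u v)) w"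
proof (induction w arbitrary: \<phi>)
  case (Cons z w)
  then show ?case by (simp add: sg_hom[of h])
qed auto

lemma unsh_add: "unsh (\<lambda>u v. \<phi> u v + \<psi> u v) w = unsh \<phi> w + unsh \<psi> w"
proof (induction w arbitrary: \<phi> \<psi>)
  case (Cons z w)
  then show ?case by (simp add: sg_add algebra_simps)
qed auto

lemma unsh_0 [simp]: "unsh (\<lambda>u v. 0) w = 0"
  using unsh_add[of "\<lambda>u v. 0" "\<lambda>u v. 0" w] by simp

lemma unsh_sg: "unsh (\<lambda>u v. sg d (\<phi> u v)) w = sg d (unsh \<phi> w)"
  using unsh_hom[of "sg d" \<phi> w] by (simp add: sg_add)

lemma unsh_uminus: "unsh (\<lambda>u v. - \<phi> u v) w = - unsh \<phi> w"
  using unsh_hom[of uminus \<phi> w] by simp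

lemma unsh_diff: "unsh (\<lambda>u v. \<phi> u v - \<psi> u v) w = unsh \<phi> w - unsh \<psi> w"
  using unsh_add[of \<phi> "\<lambda>u v. - \<psi> u v" w] by (simp add: unsh_uminus)

lemma unsh_mem:
  assumes "subgroup_of K" "\<And>u v. mset u + mset v = mset w \<Longrightarrow> \<phi> u v \<in> K"
  shows "unsh \<phi> w \<in> K"
  using assms(2)
proof (induction w arbitrary: \<phi>)
  case (Cons z w)
  show ?case
    unfolding unsh.simps
    by (intro subgroup_of_intros[OF assms(1)] Cons.IH Cons.prems) auto
qed auto

text \<open>Needed for \<open>h x = mon ((d, x) # b)\<close>, which is additive only modulo the
  relations and only on the component of degree \<open>d\<close>; hence the two subgroups
  \<open>K\<close> and \<open>S\<close>.\<close>

lemma unsh_hom_mod: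
  assumes K: "subgroup_of K" and S: "subgroup_of S"
    and h: "\<And>x y. x \<in> S \<Longrightarrow> y \<in> S \<Longrightarrow> h (x + y) - h x - h y \<in> K"
    and \<phi>: "\<And>u v. mset u + mset v = mset w \<Longrightarrow> \<phi> u v \<in> S"
  shows "h (unsh \<phi> w) - unsh (\<lambda>u v. h (\<phi> u v)) w \<in> K"
proof -
  note [intro] = subgroup_of_intros[OF S]
  have h0: "h 0 \<in> K"
    using subgroup_of_uminus[OF K h[of 0 0]] subgroup_of_0[OF S] by simp
  have hm: "h (- x) + h x \<in> K" if "x \<in> S" for x
    using subgroup_of_diff[OF K h0 h[of x "- x"]] that by (auto simp: algebra_simps)
  have hs: "h (sg d x) - sg d (h x) \<in> K" if "x \<in> S" for d x
    using that hm subgroup_of_0[OF K] by (simp add: sg_def)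
  show ?thesis
    using \<phi>
  proof (induction w arbitrary: \<phi>)
    case (Cons z w)
    let ?a = "unsh (\<lambda>u v. \<phi> (z # u) v) w"
    let ?b = "unsh (\<lambda>u v. sg (fst z * deg u) (\<phi> u (z # v))) w"
    let ?c = "unsh (\<lambda>u v. h (\<phi> (z # u) v)) w"
    let ?d = "unsh (\<lambda>u v. h (sg (fst z * deg u) (\<phi> u (z # v)))) w"
    let ?e = "unsh (\<lambda>u v. sg (fst z * deg u) (h (\<phi> u (z # v)))) w"
    have S1: "\<phi> (z # u) v \<in> S" "\<phi> u (z # v) \<in> S" if "mset u + mset v = mset w" for u v
      using that by (auto intro!: Cons.prems)
    then have "?a \<in> S" "?b \<in> S"
      by (auto intro!: unsh_mem[OF S])
    then have 1: "h (?a + ?b) - h ?a - h ?b \<in> K" by (rule h)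
    have 2: "h ?a - ?c \<in> K" by (intro Cons.IH S1)
    have 3: "h ?b - ?d \<in> K" by (intro Cons.IH subgroup_of_sg[OF S] S1)
    have 4: "?d - ?e \<in> K"
      unfolding unsh_diff[symmetric] by (intro unsh_mem[OF K] hs S1)
    have "(h (?a + ?b) - h ?a - h ?b) + (h ?a - ?c) + (h ?b - ?d) + (?d - ?e) \<in> K"
      by (intro subgroup_of_add[OF K] 1 2 3 4)
    then show ?case by (simp add: algebra_simps)
  qed (simp add: subgroup_of_0[OF K])
qed

text \<open>Coassociativity of the unreduced comultiplication, tested against an arbitrary
  \<open>\<phi>\<close>. A letter sent to the last part passes both others, and its sign splits
  because degrees add.\<close>

lemma unsh_assoc:
  "unsh (\<lambda>d c. unsh (\<lambda>a b. \<phi> a b c) d) w = unsh (\<lambda>a d. unsh (\<lambda>b c. \<phi> a b c) d) w"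
proof (induction w arbitrary: \<phi>)
  case (Cons z w)
  have 1: "unsh (\<lambda>d c. unsh (\<lambda>a b. sg (fst z * deg d) (\<phi> a b (z # c))) d) w
      = unsh (\<lambda>d c. unsh (\<lambda>a b. sg (fst z * deg a + fst z * deg b) (\<phi> a b (z # c))) d) w"
    by (intro unsh_cong) (simp add: mset_split(1) distrib_left)
  show ?case
    by (simp add: unsh_add sg_add 1 Cons.IH unsh_sg[symmetric] distrib_left add.assoc)
qed auto

text \<open>Graded cocommutativity. In the induction, the exponent \<open>deg u * deg v\<close>
  grows by \<open>fst z\<close> times the degree of the part that does not receive
  \<open>z\<close>.\<close>

lemma unsh_comm: "unsh \<phi> w = unsh (\<lambda>u v. sg (deg u * deg v) (\<phi> v u)) w"
proof (induction w arbitrary: \<phi>)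
  case (Cons z w)
  have "unsh \<phi> (z # w) = unsh (\<lambda>u v. \<phi> (z # u) v) w + unsh (\<lambda>u v. sg (fst z * deg u) (\<phi> u (z # v))) w"
    by simp
  also have "unsh (\<lambda>u v. \<phi> (z # u) v) w = unsh (\<lambda>u v. sg (deg u * deg v) (\<phi> (z # v) u)) w"
    by (subst Cons.IH) simp
  also have "\<dots> = unsh (\<lambda>u v. sg (fst z * deg u) (sg (deg u * deg (z # v)) (\<phi> (z # v) u))) w"
    by (intro unsh_cong) (auto intro!: sg_parity simp: algebra_simps)
  also have "unsh (\<lambda>u v. sg (fst z * deg u) (\<phi> u (z # v))) w
      = unsh (\<lambda>u v. sg (deg u * deg v) (sg (fst z * deg v) (\<phi> v (z # u)))) w"
    by (subst Cons.IH) simp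
  also have "\<dots> = unsh (\<lambda>u v. sg (deg (z # u) * deg v) (\<phi> v (z # u))) w"
    by (intro unsh_cong) (auto intro!: sg_parity simp: algebra_simps)
  finally show ?case by (simp add: add.commute)
qed auto

section \<open>Maps acting letter by letter\<close>

definition lmap :: "(int \<Rightarrow> 'a \<Rightarrow> 'b) \<Rightarrow> 'a word \<Rightarrow> 'b word" where
  "lmap e w = map (\<lambda>(i, v). (i, e i v)) w"

lemma lmap_simps [simp]:
  "lmap e [] = []" "lmap e (z # w) = (fst z, e (fst z) (snd z)) # lmap e w"
  "lmap e (u @ v) = lmap e u @ lmap e v" "deg (lmap e w) = deg w" "length (lmap e w) = length w"
  "lmap e w = [] \<longleftrightarrow> w = []"
  by (auto simp: lmap_def deg_def comp_def case_prod_beta)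

lemma lmap_comp: "lmap e (lmap e' w) = lmap (\<lambda>i v. e i (e' i v)) w"
  by (simp add: lmap_def comp_def case_prod_beta)

lemma unsh_lmap: "unsh \<phi> (lmap e w) = unsh (\<lambda>u v. \<phi> (lmap e u) (lmap e v)) w"
  by (induction w arbitrary: \<phi>) simp_all

text \<open>Counit law: exactly one splitting has an empty second part, and it carries no sign. This
  isolates linear components later.\<close>

lemma unsh_right_Nil: "unsh (\<lambda>u v. if v = [] then \<phi> u v else 0) w = \<phi> w []"
  by (induction w arbitrary: \<phi>) simp_all

lemma unsh_left_Nil: "unsh (\<lambda>u v. if u = [] then \<phi> u v else 0) w = \<phi> [] w"
proof -
  have "unsh (\<lambda>u v. if u = [] then \<phi> u v else 0) w
      = unsh (\<lambda>u v. if v = [] then \<phi> v u else 0) w"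
    by (subst unsh_comm) (intro unsh_cong, simp)
  then show ?thesis by (simp add: unsh_right_Nil)
qed


section \<open>The comultiplication as a sum over unshuffles\<close>

text \<open>The Koszul exponent of moving the letters at positions in \<open>A\<close> to the front:
  each of them passes the earlier letters that stay behind.\<close>

definition cross_deg :: "nat set \<Rightarrow> 'a word \<Rightarrow> int" where
  "cross_deg A w =
     (\<Sum>(a, b) \<in> {(a, b). b < a \<and> a < length w \<and> a \<in> A \<and> b \<notin> A}. fst (w ! a) * fst (w ! b))"

lemma cross_deg_alt:
  "cross_deg A w = (\<Sum>a<length w. \<Sum>b<a. if a \<in> A \<and> b \<notin> A then fst (w ! a) * fst (w ! b) else 0)"
proof -
  have "cross_deg A w = (\<Sum>(a, b) \<in> (SIGMA a:{..<length w}. {..<a}).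
      if a \<in> A \<and> b \<notin> A then fst (w ! a) * fst (w ! b) else 0)"
    unfolding cross_deg_def by (rule sum.mono_neutral_cong_left) (auto split: if_splits)
  then show ?thesis by (simp add: sum.Sigma)
qed

lemma deg_nths: "deg (nths w A) = (\<Sum>a<length w. if a \<in> A then fst (w ! a) else 0)"
proof (induction w rule: rev_induct)
  case (snoc x w)
  have "(\<Sum>a<length w. if a \<in> A then fst ((w @ [x]) ! a) else 0)
      = (\<Sum>a<length w. if a \<in> A then fst (w ! a) else 0)"
    by (intro sum.cong) (auto simp: nth_append)
  with snoc show ?case
    by (simp add: nths_append)
qed (simp add: deg_def)

lemma cross_deg_Cons_in: "cross_deg (insert 0 (Suc ` B)) (z # w) = cross_deg B w"
  unfolding cross_deg_alt
  by (simp add: sum.lessThan_Suc_shift del: sum.lessThan_Suc)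
     (auto intro!: sum.cong simp: image_iff)

lemma cross_deg_Cons_notin: "cross_deg (Suc ` B) (z # w) = fst z * deg (nths w B) + cross_deg B w"
  unfolding cross_deg_alt deg_nths
  by (simp add: sum.lessThan_Suc_shift sum_distrib_left sum.distrib[symmetric] del: sum.lessThan_Suc)
     (auto intro!: sum.cong simp: image_iff)

lemma Pow_lessThan_Suc:
  "Pow {..<Suc m} = (\<lambda>B. insert 0 (Suc ` B)) ` Pow {..<m} \<union> (`) Suc ` Pow {..<m}"
proof -
  have "A \<in> (\<lambda>B. insert 0 (Suc ` B)) ` Pow {..<m} \<union> (`) Suc ` Pow {..<m}" if "A \<subseteq> {..<Suc m}" for A
  proof -
    let ?B = "{j. Suc j \<in> A}"
    have B: "?B \<in> Pow {..<m}" using that by auto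
    have "A = (if 0 \<in> A then insert 0 (Suc ` ?B) else Suc ` ?B)"
      by (auto simp: image_iff) (metis not0_implies_Suc)+
    with B show ?thesis by (metis (mono_tags, lifting) Un_iff image_eqI)
  qed
  then have "Pow {..<Suc m} \<subseteq> (\<lambda>B. insert 0 (Suc ` B)) ` Pow {..<m} \<union> (`) Suc ` Pow {..<m}"
    by (intro subsetI) simp
  moreover have "(\<lambda>B. insert 0 (Suc ` B)) ` Pow {..<m} \<union> (`) Suc ` Pow {..<m} \<subseteq> Pow {..<Suc m}"
    by auto
  ultimately show ?thesis by (rule equalityI)
qed

text \<open>The two summands of the recursion are the subsets of positions that contain 0 and those
  that do not.\<close>

lemma unsh_subsets:
  "unsh \<phi> w = (\<Sum>A\<in>Pow {..<length w}. sg (cross_deg A w) (\<phi> (nths w A) (nths w (- A))))"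
proof (induction w arbitrary: \<phi>)
  case Nil
  then show ?case by (simp add: cross_deg_def)
next
  case (Cons z w)
  let ?P = "Pow {..<length w}"
  let ?i = "\<lambda>B. insert 0 (Suc ` B)"
  let ?F = "\<lambda>A. sg (cross_deg A (z # w)) (\<phi> (nths (z # w) A) (nths (z # w) (- A)))"
  have inj: "inj_on ?i ?P" "inj_on ((`) Suc) ?P"
    by (auto intro!: inj_onI)
  have "(\<Sum>A\<in>Pow {..<length (z # w)}. ?F A) = (\<Sum>A\<in>?i ` ?P. ?F A) + (\<Sum>A\<in>(`) Suc ` ?P. ?F A)"
    unfolding list.size add_0_right Pow_lessThan_Suc add_Suc_right
    by (rule sum.union_disjoint) auto
  also have "(\<Sum>A\<in>?i ` ?P. ?F A) = unsh (\<lambda>u v. \<phi> (z # u) v) w"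
    unfolding Cons.IH sum.reindex[OF inj(1)]
    by (intro sum.cong refl) (simp add: cross_deg_Cons_in nths_Cons image_iff Compl_eq)
  also have "(\<Sum>A\<in>(`) Suc ` ?P. ?F A) = unsh (\<lambda>u v. sg (fst z * deg u) (\<phi> u (z # v))) w"
    unfolding Cons.IH sum.reindex[OF inj(2)]
    by (intro sum.cong refl) (simp add: cross_deg_Cons_notin nths_Cons image_iff Compl_eq add.commute)
  finally show ?case by simp
qed

lemma nths_eq_map_filter: "nths w A = map ((!) w) (filter (\<lambda>i. i \<in> A) [0..<length w])"
proof (induction w rule: rev_induct)
  case (snoc x w)
  have "map ((!) w) (filter (\<lambda>i. i \<in> A) [0..<length w])
      = map ((!) (w @ [x])) (filter (\<lambda>i. i \<in> A) [0..<length w])"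
    by (auto simp: nth_append)
  with snoc show ?case by (auto simp: nths_append)
qed simp

lemma map_upt_unique:
  assumes "strict_mono_on {a..<b} \<sigma>" "\<sigma> ` {a..<b} = A" "A \<subseteq> {..<m}"
  shows "map \<sigma> [a..<b] = filter (\<lambda>i. i \<in> A) [0..<m]"
proof (rule sorted_distinct_set_unique)
  have mono: "\<sigma> x < \<sigma> y" if "x < y" "a \<le> x" "y < b" for x y
    using assms(1) that by (auto simp: strict_mono_on_def)
  then show "sorted (map \<sigma> [a..<b])"
    by (auto simp: sorted_map sorted_wrt_iff_nth_less intro!: less_imp_le)
  have "inj_on \<sigma> {a..<b}" using assms(1) by (rule strict_mono_on_imp_inj_on)
  then show "distinct (map \<sigma> [a..<b])" by (simp add: distinct_map)
  show "set (map \<sigma> [a..<b]) = set (filter (\<lambda>i. i \<in> A) [0..<m])"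
    using assms(2,3) by auto
qed (auto intro: sorted_wrt_filter)

lemma shuffle_perms_lists:
  assumes "\<sigma> \<in> shuffle_perms p m" "p \<le> m"
  shows "map \<sigma> [0..<p] = filter (\<lambda>i. i \<in> \<sigma> ` {..<p}) [0..<m]"
    and "map \<sigma> [p..<m] = filter (\<lambda>i. i \<in> - \<sigma> ` {..<p}) [0..<m]"
    and "\<sigma> ` {..<p} \<subseteq> {..<m}" "\<sigma> ` {p..<m} = {..<m} - \<sigma> ` {..<p}"
proof -
  have \<sigma>: "\<sigma> permutes {..<m}" "strict_mono_on {..<p} \<sigma>" "strict_mono_on {p..<m} \<sigma>"
    using assms(1) by (auto simp: shuffle_perms_def)
  have im: "\<sigma> ` {..<m} = {..<m}" and inj: "inj_on \<sigma> {..<m}"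
    using \<sigma>(1) by (auto simp: permutes_image intro: permutes_inj_on)
  have U: "{..<m} = {..<p} \<union> {p..<m}" using assms(2) by auto
  show sub: "\<sigma> ` {..<p} \<subseteq> {..<m}" using im U by auto
  have "\<sigma> ` ({..<m} - {..<p}) = \<sigma> ` {..<m} - \<sigma> ` {..<p}"
    by (rule inj_on_image_set_diff[OF inj]) (use assms(2) in auto)
  moreover have "{..<m} - {..<p} = {p..<m}" by auto
  ultimately show D: "\<sigma> ` {p..<m} = {..<m} - \<sigma> ` {..<p}" by (simp add: im)
  show "map \<sigma> [0..<p] = filter (\<lambda>i. i \<in> \<sigma> ` {..<p}) [0..<m]"
    using \<sigma>(2) sub by (intro map_upt_unique) (auto simp: lessThan_atLeast0)
  have "map \<sigma> [p..<m] = filter (\<lambda>i. i \<in> {..<m} - \<sigma> ` {..<p}) [0..<m]"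
    using \<sigma>(3) D by (intro map_upt_unique) auto
  also have "\<dots> = filter (\<lambda>i. i \<in> - \<sigma> ` {..<p}) [0..<m]"
    by (rule filter_cong) auto
  finally show "map \<sigma> [p..<m] = filter (\<lambda>i. i \<in> - \<sigma> ` {..<p}) [0..<m]" .
qed

text \<open>A shuffle is increasing on both blocks, so an inversion has its first index in the first
  block and its second index in the other. Applying \<open>\<sigma>\<close> turns inversions into
  pairs of a selected letter and an earlier unselected one.\<close>

lemma koszul_sign_eq:
  assumes "\<sigma> \<in> shuffle_perms p (length w)" "p \<le> length w"
  shows "koszul_sign \<sigma> w = sgn_pow (cross_deg (\<sigma> ` {..<p}) w)"
proof -
  let ?m = "length w"
  let ?A = "\<sigma> ` {..<p}"
  let ?I = "{(i, j). i < j \<and> j < ?m \<and> \<sigma> j < \<sigma> i}"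
  let ?X = "{(a, b). b < a \<and> a < ?m \<and> a \<in> ?A \<and> b \<notin> ?A}"
  have \<sigma>: "\<sigma> permutes {..<?m}" "strict_mono_on {..<p} \<sigma>" "strict_mono_on {p..<?m} \<sigma>"
    using assms(1) by (auto simp: shuffle_perms_def)
  have inj: "inj \<sigma>" using \<sigma>(1) by (rule permutes_inj)
  have I: "i < p \<and> p \<le> j" if "i < j" "j < ?m" "\<sigma> j < \<sigma> i" for i j
  proof (rule ccontr)
    assume "\<not> ?thesis"
    then consider "j < p" | "p \<le> i" using that by linarith
    then have "\<sigma> i < \<sigma> j"
      using \<sigma>(2,3) that by cases (auto simp: strict_mono_on_def)
    with that show False by simp
  qed
  have "bij_betw (map_prod \<sigma> \<sigma>) ?I ?X"
    unfolding bij_betw_def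
  proof
    show "inj_on (map_prod \<sigma> \<sigma>) ?I"
      by (rule inj_onI) (auto simp: inj_eq[OF inj])
    have 1: "map_prod \<sigma> \<sigma> (i, j) \<in> ?X" if "(i, j) \<in> ?I" for i j
    proof -
      have ij: "i < j" "j < ?m" "\<sigma> j < \<sigma> i" using that by auto
      with I have "i < p" "p \<le> j" by auto
      have "\<sigma> i \<in> {..<?m}" using permutes_in_image[OF \<sigma>(1), of i] ij by simp
      moreover have "\<sigma> j \<notin> ?A"
      proof
        assume "\<sigma> j \<in> ?A"
        then obtain k where "\<sigma> j = \<sigma> k" "k < p" by blast
        then show False using injD[OF inj, of j k] \<open>p \<le> j\<close> by simp
      qed
      ultimately show ?thesis using ij \<open>i < p\<close> by simp
    qed
    have 2: "(a, b) \<in> map_prod \<sigma> \<sigma> ` ?I" if "(a, b) \<in> ?X" for a b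
    proof -
      have ab: "b < a" "a < ?m" "a \<in> ?A" "b \<notin> ?A" using that by auto
      then obtain i where i: "i < p" "a = \<sigma> i" by auto
      have "b \<in> \<sigma> ` {p..<?m}" using shuffle_perms_lists(4)[OF assms] ab by auto
      then obtain j where "p \<le> j" "j < ?m" "b = \<sigma> j" by auto
      with i ab show ?thesis by (auto intro!: image_eqI[of _ _ "(i, j)"])
    qed
    show "map_prod \<sigma> \<sigma> ` ?I = ?X"
    proof (intro equalityI subsetI)
      fix x assume "x \<in> map_prod \<sigma> \<sigma> ` ?I"
      then obtain y where "y \<in> ?I" "x = map_prod \<sigma> \<sigma> y" by (rule imageE)
      with 1[of "fst y" "snd y"] show "x \<in> ?X" by (simp only: prod.collapse)
    next
      fix x assume "x \<in> ?X"
      with 2[of "fst x" "snd x"] show "x \<in> map_prod \<sigma> \<sigma> ` ?I" by (simp only: prod.collapse)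
    qed
  qed
  then have "cross_deg ?A w = (\<Sum>x\<in>?I. (\<lambda>(a, b). fst (w ! a) * fst (w ! b)) (map_prod \<sigma> \<sigma> x))"
    unfolding cross_deg_def by (rule sum.reindex_bij_betw[symmetric])
  also have "\<dots> = (\<Sum>(i, j)\<in>?I. fst (w ! \<sigma> i) * fst (w ! \<sigma> j))"
    by (intro sum.cong) auto
  finally have c: "cross_deg ?A w = (\<Sum>(i, j)\<in>?I. fst (w ! \<sigma> i) * fst (w ! \<sigma> j))" .
  have "sgn_pow (\<Sum>x\<in>J. g x) = (\<Prod>x\<in>J. sgn_pow (g x) :: 'b)" for J and g :: "nat \<times> nat \<Rightarrow> int"
    by (induction J rule: infinite_finite_induct) (simp_all add: sgn_pow_add, simp_all add: sgn_pow_def)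
  then show ?thesis
    unfolding c koszul_sign_def by (simp add: case_prod_beta)
qed

text \<open>Listing \<open>A\<close> and then its complement, both in increasing order, gives the
  shuffle; beyond \<open>m\<close> it has to be the identity, as \<open>permutes\<close>
  demands.\<close>

lemma ex_shuffle:
  assumes "A \<subseteq> {..<m}"
  shows "\<exists>\<sigma>\<in>shuffle_perms (card A) m. \<sigma> ` {..<card A} = A"
proof -
  let ?B = "{..<m} - A"
  define xs ys where "xs = sorted_list_of_set A" and "ys = sorted_list_of_set ?B"
  define \<sigma> where "\<sigma> i = (if i < m then (xs @ ys) ! i else i)" for i
  let ?p = "card A"
  have fin: "finite A" using assms finite_subset by blast
  have set: "set xs = A" "set ys = ?B" and dist: "distinct xs" "distinct ys"
    and sort: "sorted_wrt (<) xs" "sorted_wrt (<) ys"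
    using fin by (auto simp: xs_def ys_def)
  have len: "length xs = ?p" "length (xs @ ys) = m"
    using fin assms by (auto simp: xs_def ys_def card_Diff_subset card_mono subset_eq_atLeast0_lessThan_card)
      (metis card_lessThan card_mono finite_lessThan le_add_diff_inverse)
  have p: "?p \<le> m" using len by simp
  have 1: "bij_betw ((!) (xs @ ys)) {..<m} (set (xs @ ys))"
    using dist set len by (intro bij_betw_nth) auto
  have "set (xs @ ys) = {..<m}" using set assms by auto
  with 1 have "bij_betw \<sigma> {..<m} {..<m}"
    by (subst bij_betw_cong[of _ _ "(!) (xs @ ys)"]) (auto simp: \<sigma>_def)
  then have "\<sigma> permutes {..<m}"
    by (rule bij_imp_permutes) (simp add: \<sigma>_def)
  moreover have "strict_mono_on {..<?p} \<sigma>" "strict_mono_on {?p..<m} \<sigma>"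
    using sort len p
    by (auto simp: strict_mono_on_def \<sigma>_def nth_append sorted_wrt_iff_nth_less)
  moreover have "\<sigma> ` {..<?p} = A"
  proof -
    have "\<sigma> ` {..<?p} = (!) xs ` {..<length xs}"
      using len p by (intro image_cong) (auto simp: \<sigma>_def nth_append)
    then show ?thesis using set(1) by (auto simp: set_conv_nth)
  qed
  ultimately show ?thesis by (auto simp: shuffle_perms_def)
qed

text \<open>A shuffle is determined by the image of its first block, and all nonempty proper subsets
  of positions occur. From here on the comultiplication is handled by recursion over letters; the
  empty parts, which \<open>unsh\<close> admits, are suppressed by hand.\<close>

lemma comult_eq_unsh: "comult w = unsh (\<lambda>u v. if u = [] \<or> v = [] then 0 else mon (u, v)) w"
proof -
  let ?m = "length w"
  let ?S = "SIGMA p:{1..<?m}. shuffle_perms p ?m"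
  let ?T = "{A. A \<subseteq> {..<?m} \<and> A \<noteq> {} \<and> A \<noteq> {..<?m}}"
  let ?g = "\<lambda>A. sg (cross_deg A w) (mon (nths w A, nths w (- A)))"
  have bij: "bij_betw (\<lambda>(p, \<sigma>). \<sigma> ` {..<p}) ?S ?T"
    unfolding bij_betw_def
  proof
    have card: "card (\<sigma> ` {..<p}) = p" if "\<sigma> \<in> shuffle_perms p ?m" for p \<sigma>
      using that by (subst card_image) (auto simp: shuffle_perms_def intro: strict_mono_on_imp_inj_on)
    show "inj_on (\<lambda>(p, \<sigma>). \<sigma> ` {..<p}) ?S"
    proof (rule inj_onI, clarify)
      fix p \<sigma> p' \<tau>
      assume *: "p \<in> {1..<?m}" "\<sigma> \<in> shuffle_perms p ?m" "p' \<in> {1..<?m}" "\<tau> \<in> shuffle_perms p' ?m"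
        and eq: "\<sigma> ` {..<p} = \<tau> ` {..<p'}"
      have "p = p'" using card[OF *(2)] card[OF *(4)] eq by simp
      have p: "p \<le> ?m" "p' \<le> ?m" using * by auto
      have "map \<sigma> [0..<p] = map \<tau> [0..<p]" "map \<sigma> [p..<?m] = map \<tau> [p..<?m]"
        using shuffle_perms_lists(1,2)[OF *(2) p(1)] shuffle_perms_lists(1,2)[OF *(4) p(2)] eq
        by (simp_all only: \<open>p = p'\<close>)
      then have "\<sigma> i = \<tau> i" if "i < ?m" for i
        using that by (cases "i < p") auto
      moreover have "\<sigma> i = \<tau> i" if "\<not> i < ?m" for i
        using *(2,4) that by (auto simp: shuffle_perms_def permutes_def)
      ultimately show "p = p' \<and> \<sigma> = \<tau>" using \<open>p = p'\<close> by blast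
    qed
    have 1: "\<sigma> ` {..<p} \<in> ?T" if "p \<in> {1..<?m}" "\<sigma> \<in> shuffle_perms p ?m" for p \<sigma>
    proof -
      have "\<sigma> ` {..<p} \<subseteq> {..<?m}" using shuffle_perms_lists(3)[OF that(2)] that(1) by simp
      moreover have "\<sigma> ` {..<p} \<noteq> {}" using that(1) by (simp add: lessThan_empty_iff)
      moreover have "\<sigma> ` {..<p} \<noteq> {..<?m}"
        using card[OF that(2)] that(1) card_lessThan[of ?m] by (metis atLeastLessThan_iff less_irrefl)
      ultimately show ?thesis by simp
    qed
    have 2: "A \<in> (\<lambda>(p, \<sigma>). \<sigma> ` {..<p}) ` ?S" if "A \<in> ?T" for A
    proof -
      have "A \<subseteq> {..<?m}" using that by simp
      from ex_shuffle[OF this] obtain \<sigma> where "\<sigma> \<in> shuffle_perms (card A) ?m" "\<sigma> ` {..<card A} = A"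
        by blast
      moreover have "card A \<in> {1..<?m}"
        using that finite_subset[of A "{..<?m}"] psubset_card_mono[of "{..<?m}" A]
        by (auto simp: Suc_le_eq card_gt_0_iff)
      ultimately show ?thesis by (auto intro!: image_eqI[of _ _ "(card A, \<sigma>)"])
    qed
    show "(\<lambda>(p, \<sigma>). \<sigma> ` {..<p}) ` ?S = ?T"
    proof (intro equalityI subsetI)
      fix A assume "A \<in> (\<lambda>(p, \<sigma>). \<sigma> ` {..<p}) ` ?S"
      then obtain p \<sigma> where "p \<in> {1..<?m}" "\<sigma> \<in> shuffle_perms p ?m" "A = \<sigma> ` {..<p}" by blast
      with 1 show "A \<in> ?T" by (simp only:)
    qed (rule 2)
  qed
  have fin: "finite (shuffle_perms p ?m)" for p
    by (rule finite_subset[OF _ finite_permutations[of "{..<?m}"]]) (auto simp: shuffle_perms_def)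
  have "comult w = (\<Sum>p = 1..<?m. \<Sum>\<sigma> \<in> shuffle_perms p ?m. ?g (\<sigma> ` {..<p}))"
    unfolding comult_def
  proof (intro sum.cong refl)
    fix p \<sigma> assume "p \<in> {1..<?m}" and \<sigma>: "\<sigma> \<in> shuffle_perms p ?m"
    then have p: "p \<le> ?m" by simp
    have "map (\<lambda>i. w ! \<sigma> i) [0..<p] = map ((!) w) (map \<sigma> [0..<p])"
      "map (\<lambda>i. w ! \<sigma> i) [p..<?m] = map ((!) w) (map \<sigma> [p..<?m])"
      by simp_all
    then show "psc (koszul_sign \<sigma> w)
          (mon (map (\<lambda>i. w ! \<sigma> i) [0..<p], map (\<lambda>i. w ! \<sigma> i) [p..<length w])) = ?g (\<sigma> ` {..<p})"
      by (simp only: koszul_sign_eq[OF \<sigma> p] shuffle_perms_lists(1,2)[OF \<sigma> p] nths_eq_map_filter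
          comb.scale_sgn_pow)
  qed
  also have "\<dots> = (\<Sum>x\<in>?S. ?g ((\<lambda>(p, \<sigma>). \<sigma> ` {..<p}) x))"
    using fin by (simp add: sum.Sigma case_prod_beta)
  also have "\<dots> = (\<Sum>A\<in>?T. ?g A)"
    by (rule sum.reindex_bij_betw[OF bij])
  also have "\<dots> = unsh (\<lambda>u v. if u = [] \<or> v = [] then 0 else mon (u, v)) w"
  proof -
    have "nths w A = [] \<longleftrightarrow> A = {}" "nths w (- A) = [] \<longleftrightarrow> A = {..<?m}" if "A \<subseteq> {..<?m}" for A
      using that by (auto simp: nths_eq_map_filter filter_empty_conv)
    then show ?thesis
      unfolding unsh_subsets by (intro sum.mono_neutral_cong_left) auto
  qed
  finally show ?thesis .
qed

section \<open>Functions on words that respect the relations\<close>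

definition words0 :: "('k, 'a) gvs \<Rightarrow> 'a word set" where
  "words0 V = {w. \<forall>(i, v) \<in> set w. v \<in> cmp V i}"

lemma words_eq: "words V = words0 V - {[]}"
  by (auto simp: words_def words0_def)

lemma words0_simps [simp]:
  "[] \<in> words0 V" "z # w \<in> words0 V \<longleftrightarrow> snd z \<in> cmp V (fst z) \<and> w \<in> words0 V"
  "u @ v \<in> words0 V \<longleftrightarrow> u \<in> words0 V \<and> v \<in> words0 V"
  by (auto simp: words0_def case_prod_beta)

lemma words0_split:
  assumes "mset u + mset v = mset w" "w \<in> words0 V"
  shows "u \<in> words0 V" "v \<in> words0 V"
  using assms(2) mset_split(3)[OF assms(1)] by (auto simp: words0_def)

text \<open>
  A function on words descends to the quotient by \<open>sym_rel V\<close>, modulo \<open>K\<close>, if it respects the relations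
  at every position; \<open>descends_head\<close> is the condition at the beginning of a word.
\<close>

definition descends_head ::
  "('k::field, 'a::ab_group_add) gvs \<Rightarrow> ('k \<Rightarrow> 'c \<Rightarrow> 'c) \<Rightarrow> 'c::ab_group_add set \<Rightarrow> ('a word \<Rightarrow> 'c) \<Rightarrow> bool" where
  "descends_head V s K \<Phi> \<longleftrightarrow>
     (\<forall>b i v v'. b \<in> words0 V \<and> v \<in> cmp V i \<and> v' \<in> cmp V i \<longrightarrow>
        \<Phi> ((i, v + v') # b) - \<Phi> ((i, v) # b) - \<Phi> ((i, v') # b) \<in> K) \<and>
     (\<forall>b i c v. b \<in> words0 V \<and> v \<in> cmp V i \<longrightarrow>
        \<Phi> ((i, scl V c v) # b) - s c (\<Phi> ((i, v) # b)) \<in> K) \<and>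
     (\<forall>b i j v v'. b \<in> words0 V \<and> v \<in> cmp V i \<and> v' \<in> cmp V j \<longrightarrow>
        \<Phi> ((i, v) # (j, v') # b) - sg (i * j) (\<Phi> ((j, v') # (i, v) # b)) \<in> K)"

definition descends ::
  "('k::field, 'a::ab_group_add) gvs \<Rightarrow> ('k \<Rightarrow> 'c \<Rightarrow> 'c) \<Rightarrow> 'c::ab_group_add set \<Rightarrow> ('a word \<Rightarrow> 'c) \<Rightarrow> bool" where
  "descends V s K \<Phi> \<longleftrightarrow> (\<forall>a\<in>words0 V. descends_head V s K (\<lambda>w. \<Phi> (a @ w)))"

lemma descendsI:
  assumes "\<And>a b i v v'. a \<in> words0 V \<Longrightarrow> b \<in> words0 V \<Longrightarrow> v \<in> cmp V i \<Longrightarrow> v' \<in> cmp V i \<Longrightarrow>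
        \<Phi> (a @ (i, v + v') # b) - \<Phi> (a @ (i, v) # b) - \<Phi> (a @ (i, v') # b) \<in> K"
    and "\<And>a b i c v. a \<in> words0 V \<Longrightarrow> b \<in> words0 V \<Longrightarrow> v \<in> cmp V i \<Longrightarrow>
        \<Phi> (a @ (i, scl V c v) # b) - s c (\<Phi> (a @ (i, v) # b)) \<in> K"
    and "\<And>a b i j v v'. a \<in> words0 V \<Longrightarrow> b \<in> words0 V \<Longrightarrow> v \<in> cmp V i \<Longrightarrow> v' \<in> cmp V j \<Longrightarrow>
        \<Phi> (a @ (i, v) # (j, v') # b) - sg (i * j) (\<Phi> (a @ (j, v') # (i, v) # b)) \<in> K"
  shows "descends V s K \<Phi>"
  unfolding descends_def descends_head_def using assms by simp

lemma descendsD: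
  assumes "descends V s K \<Phi>" "a \<in> words0 V" "b \<in> words0 V" "v \<in> cmp V i"
  shows "v' \<in> cmp V i \<Longrightarrow> \<Phi> (a @ (i, v + v') # b) - \<Phi> (a @ (i, v) # b) - \<Phi> (a @ (i, v') # b) \<in> K"
    and "\<Phi> (a @ (i, scl V c v) # b) - s c (\<Phi> (a @ (i, v) # b)) \<in> K"
    and "v' \<in> cmp V j \<Longrightarrow> \<Phi> (a @ (i, v) # (j, v') # b) - sg (i * j) (\<Phi> (a @ (j, v') # (i, v) # b)) \<in> K"
  using assms unfolding descends_def descends_head_def by auto

lemma descends0D:
  assumes "descends V s {0} \<Phi>" "a \<in> words0 V" "b \<in> words0 V" "v \<in> cmp V i"
  shows "v' \<in> cmp V i \<Longrightarrow> \<Phi> (a @ (i, v + v') # b) = \<Phi> (a @ (i, v) # b) + \<Phi> (a @ (i, v') # b)"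
    and "\<Phi> (a @ (i, scl V c v) # b) = s c (\<Phi> (a @ (i, v) # b))"
    and "v' \<in> cmp V j \<Longrightarrow> \<Phi> (a @ (i, v) # (j, v') # b) = sg (i * j) (\<Phi> (a @ (j, v') # (i, v) # b))"
  using descendsD(1)[OF assms, of v'] descendsD(2)[OF assms, of c] descendsD(3)[OF assms, of v' j]
  by (simp_all add: diff_diff_eq)

lemma descends0I:
  assumes "\<And>a b i v v'. a \<in> words0 V \<Longrightarrow> b \<in> words0 V \<Longrightarrow> v \<in> cmp V i \<Longrightarrow> v' \<in> cmp V i \<Longrightarrow>
        \<Phi> (a @ (i, v + v') # b) = \<Phi> (a @ (i, v) # b) + \<Phi> (a @ (i, v') # b)"
    and "\<And>a b i c v. a \<in> words0 V \<Longrightarrow> b \<in> words0 V \<Longrightarrow> v \<in> cmp V i \<Longrightarrow>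
        \<Phi> (a @ (i, scl V c v) # b) = s c (\<Phi> (a @ (i, v) # b))"
    and "\<And>a b i j v v'. a \<in> words0 V \<Longrightarrow> b \<in> words0 V \<Longrightarrow> v \<in> cmp V i \<Longrightarrow> v' \<in> cmp V j \<Longrightarrow>
        \<Phi> (a @ (i, v) # (j, v') # b) = sg (i * j) (\<Phi> (a @ (j, v') # (i, v) # b))"
  shows "descends V s {0} \<Phi>"
  by (rule descendsI; unfold singleton_iff diff_diff_eq right_minus_eq; rule assms)

lemma descends_Cons:
  assumes "descends V s K \<Phi>" "snd z \<in> cmp V (fst z)"
  shows "descends V s K (\<lambda>w. \<Phi> (z # w))"
  by (rule descendsI; use descendsD[OF assms(1), of "z # _"] assms(2) in auto)

context vector_space
begin

text \<open>All three kinds of relations preserve the total degree, so a sign that depends only on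
  the degree can be inserted freely.\<close>

lemma descends_sg:
  assumes K: "subspace K" and \<Phi>: "descends V scale K \<Phi>"
    and c: "\<And>u u'. deg u = deg u' \<Longrightarrow> c u = c u'"
  shows "descends V scale K (\<lambda>u. sg (c u) (\<Phi> u))"
proof (rule descendsI)
  note [intro!] = subgroup_of_sg[OF subspace_subgroup_of[OF K]]
  fix a b :: "'c word" and i j v v'
  assume ab: "a \<in> words0 V" "b \<in> words0 V" and v: "v \<in> cmp V i"
  have "sg (c (a @ (i, x) # b)) y = sg (c (a @ (i, v) # b)) y" for x and y :: 'b
    using c[of "a @ (i, x) # b" "a @ (i, v) # b"] by simp
  note c1 = this[of "v + v'"] this[of v'] this[of "scl V _ v"]
  {
    assume "v' \<in> cmp V i"
    then show "sg (c (a @ (i, v + v') # b)) (\<Phi> (a @ (i, v + v') # b)) - sg (c (a @ (i, v) # b)) (\<Phi> (a @ (i, v) # b))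
        - sg (c (a @ (i, v') # b)) (\<Phi> (a @ (i, v') # b)) \<in> K"
      unfolding c1 sg_diff[symmetric] using descendsD(1)[OF \<Phi> ab v] by auto
  next
    fix k
    show "sg (c (a @ (i, scl V k v) # b)) (\<Phi> (a @ (i, scl V k v) # b)) - scale k (sg (c (a @ (i, v) # b)) (\<Phi> (a @ (i, v) # b))) \<in> K"
      unfolding c1 scale_sg sg_diff[symmetric] using descendsD(2)[OF \<Phi> ab v] by auto
  next
    assume "v' \<in> cmp V j"
    have e: "c (a @ (i, v) # (j, v') # b) = c (a @ (j, v') # (i, v) # b)" by (rule c) simp
    show "sg (c (a @ (i, v) # (j, v') # b)) (\<Phi> (a @ (i, v) # (j, v') # b))
        - sg (i * j) (sg (c (a @ (j, v') # (i, v) # b)) (\<Phi> (a @ (j, v') # (i, v) # b))) \<in> K"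
      unfolding e sg_simps add.commute[of "i * j"]
      unfolding sg_simps(3)[symmetric] sg_diff[symmetric]
      using descendsD(3)[OF \<Phi> ab v \<open>v' \<in> cmp V j\<close>] by auto
  }
qed

text \<open>Reduces relations at an arbitrary position to the head of the word. Peeling off a letter
  turns the functions of interest (\<open>unsh\<close>, \<open>ssum\<close>) into a sum of two
  functions, so the class \<open>X\<close> has to be closed under that decomposition.\<close>

lemma descends_induct:
  assumes K: "subspace K" and head: "\<And>\<Phi>. \<Phi> \<in> X \<Longrightarrow> descends_head V scale K \<Phi>"
    and step: "\<And>\<Phi> z. \<Phi> \<in> X \<Longrightarrow> snd z \<in> cmp V (fst z) \<Longrightarrow>
      \<exists>\<Phi>\<^sub>1\<in>X. \<exists>\<Phi>\<^sub>2\<in>X. \<forall>w. \<Phi> (z # w) = \<Phi>\<^sub>1 w + \<Phi>\<^sub>2 w"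
    and "\<Phi> \<in> X"
  shows "descends V scale K \<Phi>"
  unfolding descends_def
proof
  note G = subspace_subgroup_of[OF K]
  fix a assume "a \<in> words0 V"
  then show "descends_head V scale K (\<lambda>w. \<Phi> (a @ w))"
    using \<open>\<Phi> \<in> X\<close>
  proof (induction a arbitrary: \<Phi>)
    case (Cons z a)
    then obtain \<Phi>\<^sub>1 \<Phi>\<^sub>2 where X: "\<Phi>\<^sub>1 \<in> X" "\<Phi>\<^sub>2 \<in> X" and \<Phi>: "\<And>w. \<Phi> (z # w) = \<Phi>\<^sub>1 w + \<Phi>\<^sub>2 w"
      using step[of \<Phi> z] by auto
    have "descends_head V scale K (\<lambda>w. \<Phi>\<^sub>1 (a @ w))" "descends_head V scale K (\<lambda>w. \<Phi>\<^sub>2 (a @ w))"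
      using Cons X by auto
    moreover have E: "x + y - (x' + y') - (x'' + y'') = (x - x' - x'') + (y - y' - y'')"
      "x + y - (x' + y') = (x - x') + (y - y')" for x y x' y' x'' y'' :: 'b
      by simp_all
    ultimately show ?case
      using subgroup_of_add[OF G] unfolding descends_head_def append_Cons \<Phi> scale_right_distrib sg_add E
      by simp
  qed (simp add: head)
qed

text \<open>Compatibility in each part separately suffices, because the unshuffle sign is itself the
  Koszul sign of the reordering. \<open>B\<close> is that hypothesis in a form stable under
  prefixing a letter to either part.\<close>

lemma descends_unsh:
  assumes K: "subspace K"
    and 1: "\<And>v. v \<in> words0 V \<Longrightarrow> descends V scale K (\<lambda>u. \<psi> u v)"
    and 2: "\<And>u. u \<in> words0 V \<Longrightarrow> descends V scale K (\<lambda>v. \<psi> u v)"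
  shows "descends V scale K (unsh \<psi>)"
proof -
  note G = subspace_subgroup_of[OF K]
  define B where "B \<psi> \<longleftrightarrow> (\<forall>v\<in>words0 V. descends V scale K (\<lambda>u. \<psi> u v)) \<and>
    (\<forall>u\<in>words0 V. descends V scale K (\<lambda>v. \<psi> u v))" for \<psi>
  have B1: "B (\<lambda>u v. \<psi> (z # u) v)" if "B \<psi>" "snd z \<in> cmp V (fst z)" for \<psi> z
    using that unfolding B_def by (auto intro: descends_Cons)
  have B2: "B (\<lambda>u v. sg (fst z * deg u) (\<psi> u (z # v)))" if "B \<psi>" "snd z \<in> cmp V (fst z)" for \<psi> z
    using that unfolding B_def by (auto intro!: descends_sg[OF K] intro: descends_Cons)
  have L: "\<psi> ((i, v + v') # a) b - \<psi> ((i, v) # a) b - \<psi> ((i, v') # a) b \<in> K"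
      "\<psi> a ((i, v + v') # b) - \<psi> a ((i, v) # b) - \<psi> a ((i, v') # b) \<in> K"
    if "B \<psi>" "a \<in> words0 V" "b \<in> words0 V" "v \<in> cmp V i" "v' \<in> cmp V i" for \<psi> a b i v v'
    using that descendsD(1)[of V scale K "\<lambda>u. \<psi> u b" "[]" a v i v']
      descendsD(1)[of V scale K "\<lambda>u. \<psi> a u" "[]" b v i v'] unfolding B_def by auto
  have S: "\<psi> ((i, scl V c v) # a) b - scale c (\<psi> ((i, v) # a) b) \<in> K"
      "\<psi> a ((i, scl V c v) # b) - scale c (\<psi> a ((i, v) # b)) \<in> K"
    if "B \<psi>" "a \<in> words0 V" "b \<in> words0 V" "v \<in> cmp V i" for \<psi> a b i v c
    using that descendsD(2)[of V scale K "\<lambda>u. \<psi> u b" "[]" a v i c]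
      descendsD(2)[of V scale K "\<lambda>u. \<psi> a u" "[]" b v i c] unfolding B_def by auto
  have C: "\<psi> ((i, v) # (j, v') # a) b - sg (i * j) (\<psi> ((j, v') # (i, v) # a) b) \<in> K"
      "\<psi> a ((i, v) # (j, v') # b) - sg (i * j) (\<psi> a ((j, v') # (i, v) # b)) \<in> K"
    if "B \<psi>" "a \<in> words0 V" "b \<in> words0 V" "v \<in> cmp V i" "v' \<in> cmp V j" for \<psi> a b i j v v'
    using that descendsD(3)[of V scale K "\<lambda>u. \<psi> u b" "[]" a v i v' j]
      descendsD(3)[of V scale K "\<lambda>u. \<psi> a u" "[]" b v i v' j] unfolding B_def by auto
  have hs: "scale c (unsh \<psi> w) = unsh (\<lambda>u v. scale c (\<psi> u v)) w" for c w and \<psi> :: "'c word \<Rightarrow> 'c word \<Rightarrow> 'b"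
    by (rule unsh_hom) (rule scale_right_distrib)
  have "descends_head V scale K (unsh \<psi>)" if "B \<psi>" for \<psi>
    unfolding descends_head_def
  proof (intro conjI allI impI; elim conjE)
    fix b i v v' assume b: "b \<in> words0 V" and v: "v \<in> cmp V i" "v' \<in> cmp V i"
    have "unsh \<psi> ((i, v + v') # b) - unsh \<psi> ((i, v) # b) - unsh \<psi> ((i, v') # b)
      = unsh (\<lambda>x y. \<psi> ((i, v + v') # x) y - \<psi> ((i, v) # x) y - \<psi> ((i, v') # x) y) b
      + unsh (\<lambda>x y. sg (i * deg x) (\<psi> x ((i, v + v') # y) - \<psi> x ((i, v) # y) - \<psi> x ((i, v') # y))) b"
      by (simp add: unsh_diff sg_diff)
    also have "\<dots> \<in> K"
      by (intro subgroup_of_add[OF G] unsh_mem[OF G] subgroup_of_sg[OF G] L that v)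
         (use b words0_split in blast)+
    finally show "unsh \<psi> ((i, v + v') # b) - unsh \<psi> ((i, v) # b) - unsh \<psi> ((i, v') # b) \<in> K" .
  next
    fix b i c v assume b: "b \<in> words0 V" and v: "v \<in> cmp V i"
    have "unsh \<psi> ((i, scl V c v) # b) - scale c (unsh \<psi> ((i, v) # b))
      = unsh (\<lambda>x y. \<psi> ((i, scl V c v) # x) y - scale c (\<psi> ((i, v) # x) y)) b
      + unsh (\<lambda>x y. sg (i * deg x) (\<psi> x ((i, scl V c v) # y) - scale c (\<psi> x ((i, v) # y)))) b"
      by (simp add: unsh_diff sg_diff hs scale_sg scale_right_distrib)
    also have "\<dots> \<in> K"
      by (intro subgroup_of_add[OF G] unsh_mem[OF G] subgroup_of_sg[OF G] S that v)
         (use b words0_split in blast)+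
    finally show "unsh \<psi> ((i, scl V c v) # b) - scale c (unsh \<psi> ((i, v) # b)) \<in> K" .
  next
    fix b i j v v' assume b: "b \<in> words0 V" and v: "v \<in> cmp V i" "v' \<in> cmp V j"
    let ?x = "(i, v)" and ?y = "(j, v')"
    \<comment> \<open>If the two exchanged letters land in different parts, the terms agree exactly,
      without any relation: one letter passes the other in one order and not in the other order, and
      this difference is the sign \<open>i * j\<close>.\<close>
    have mixed1: "unsh (\<lambda>p q. sg (j * deg p) (\<psi> (?x # p) (?y # q))) b
      = sg (i * j) (unsh (\<lambda>p q. sg (j * (i + deg p)) (\<psi> (?x # p) (?y # q))) b)"
      unfolding unsh_sg[symmetric] by (intro unsh_cong) (auto intro!: sg_parity simp: algebra_simps)
    have mixed2: "unsh (\<lambda>p q. sg (i * (j + deg p)) (\<psi> (?y # p) (?x # q))) b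
      = sg (i * j) (unsh (\<lambda>p q. sg (i * deg p) (\<psi> (?y # p) (?x # q))) b)"
      unfolding unsh_sg[symmetric] by (intro unsh_cong) (auto intro!: sg_parity simp: algebra_simps)
    have last: "unsh (\<lambda>p q. sg (j * deg p + i * deg p) (\<psi> p (?x # ?y # q))) b
        - sg (i * j) (unsh (\<lambda>p q. sg (i * deg p + j * deg p) (\<psi> p (?y # ?x # q))) b)
      = unsh (\<lambda>p q. sg (i * deg p + j * deg p) (\<psi> p (?x # ?y # q) - sg (i * j) (\<psi> p (?y # ?x # q)))) b"
      unfolding unsh_sg[symmetric] unsh_diff[symmetric]
      by (intro unsh_cong) (auto simp: sg_diff add.commute)
    have x: "unsh \<psi> (?x # ?y # b) = unsh (\<lambda>p q. \<psi> (?x # ?y # p) q) b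
        + unsh (\<lambda>p q. sg (j * deg p) (\<psi> (?x # p) (?y # q))) b
        + (unsh (\<lambda>p q. sg (i * (j + deg p)) (\<psi> (?y # p) (?x # q))) b
        + unsh (\<lambda>p q. sg (j * deg p + i * deg p) (\<psi> p (?x # ?y # q))) b)"
      by simp
    have y: "unsh \<psi> (?y # ?x # b) = unsh (\<lambda>p q. \<psi> (?y # ?x # p) q) b
        + unsh (\<lambda>p q. sg (i * deg p) (\<psi> (?y # p) (?x # q))) b
        + (unsh (\<lambda>p q. sg (j * (i + deg p)) (\<psi> (?x # p) (?y # q))) b
        + unsh (\<lambda>p q. sg (i * deg p + j * deg p) (\<psi> p (?y # ?x # q))) b)"
      by simp
    have "unsh \<psi> (?x # ?y # b) - sg (i * j) (unsh \<psi> (?y # ?x # b))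
      = unsh (\<lambda>p q. \<psi> (?x # ?y # p) q - sg (i * j) (\<psi> (?y # ?x # p) q)) b
      + unsh (\<lambda>p q. sg (i * deg p + j * deg p) (\<psi> p (?x # ?y # q) - sg (i * j) (\<psi> p (?y # ?x # q)))) b"
      unfolding last[symmetric] x y mixed1 mixed2
      by (simp add: unsh_diff sg_add unsh_sg del: sg_simps)
    also have "\<dots> \<in> K"
      by (intro subgroup_of_add[OF G] unsh_mem[OF G] subgroup_of_sg[OF G] C that v)
         (use b words0_split in blast)+
    finally show "unsh \<psi> (?x # ?y # b) - sg (i * j) (unsh \<psi> (?y # ?x # b)) \<in> K" .
  qed
  note head = this
  show ?thesis
  proof (rule descends_induct[OF K, where X = "unsh ` {\<psi>. B \<psi>}"])
    show "unsh \<psi> \<in> unsh ` {\<psi>. B \<psi>}" using 1 2 by (simp add: B_def)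
    fix \<Phi> :: "'c word \<Rightarrow> 'b" assume "\<Phi> \<in> unsh ` {\<psi>. B \<psi>}"
    then obtain \<psi> where \<psi>: "B \<psi>" "\<Phi> = unsh \<psi>" by blast
    then show "descends_head V scale K \<Phi>" using head by simp
    fix z :: "int \<times> 'c" assume "snd z \<in> cmp V (fst z)"
    then show "\<exists>\<Phi>\<^sub>1\<in>unsh ` {\<psi>. B \<psi>}. \<exists>\<Phi>\<^sub>2\<in>unsh ` {\<psi>. B \<psi>}. \<forall>w. \<Phi> (z # w) = \<Phi>\<^sub>1 w + \<Phi>\<^sub>2 w"
      using B1[OF \<psi>(1)] B2[OF \<psi>(1)] unfolding \<psi>(2) unsh.simps by blast
  qed
qed

text \<open>The universal property of the quotient: linear extension is tested on the generators of
  \<open>sym_rel\<close>, which is what \<open>descends\<close> records.\<close>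

lemma lext_sym_rel:
  assumes K: "subspace K" and \<Phi>: "descends V scale K \<Phi>" and r: "r \<in> sym_rel V"
  shows "lext scale \<Phi> r \<in> K"
  using r unfolding sym_rel_def
proof (rule lext_span[OF _ K], elim UnE CollectE exE conjE, goal_cases)
  case (1 b u w i v v')
  then show ?case using descendsD(1)[OF \<Phi>, of u w v i v'] by (auto simp: lext_diff words_eq)
next
  case (2 b u w i c v)
  then show ?case using descendsD(2)[OF \<Phi>, of u w v i c] by (auto simp: lext_diff lext_psc words_eq)
next
  case (3 b u w x y)
  then show ?case using descendsD(3)[OF \<Phi>, of u w "snd x" "fst x" "snd y" "fst y"]
    by (auto simp: lext_diff lext_psc words_eq sg_hom[of "lext scale \<Phi>", OF lext_add])
qed

end

lemmas lin_sym_rel = comb.lext_sym_rel[folded lin_eq_lext]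

lemma sym_rel_subspace: "comb.subspace (sym_rel V)" "subgroup_of (sym_rel V)"
  unfolding sym_rel_def by (simp_all add: comb.subspace_subgroup_of)

lemma tens_rel_subspace: "comb.subspace (tens_rel V)" "subgroup_of (tens_rel V)"
  unfolding tens_rel_def by (simp_all add: comb.subspace_subgroup_of)

lemma zero_sym_rel [simp]: "0 \<in> sym_rel V" and zero_tens_rel [simp]: "0 \<in> tens_rel V"
  by (rule subgroup_of_0[OF sym_rel_subspace(2)], rule subgroup_of_0[OF tens_rel_subspace(2)])

lemma descends_mon: "descends V psc (sym_rel V) mon"
  unfolding sym_rel_def
proof (rule descendsI, goal_cases)
  case (1 a b i v v')
  show ?case
    by (rule comb.span_base, rule UnI1, rule UnI1, rule CollectI,
        rule exI[of _ a], rule exI[of _ b], rule exI[of _ i], rule exI[of _ v], rule exI[of _ v'])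
       (use 1 in \<open>simp add: words_eq\<close>)
next
  case (2 a b i c v)
  show ?case
    by (rule comb.span_base, rule UnI1, rule UnI2, rule CollectI,
        rule exI[of _ a], rule exI[of _ b], rule exI[of _ i], rule exI[of _ c], rule exI[of _ v])
       (use 2 in \<open>simp add: words_eq\<close>)
next
  case (3 a b i j v v')
  show ?case
    by (rule comb.span_base, rule UnI2, rule CollectI,
        rule exI[of _ a], rule exI[of _ b], rule exI[of _ "(i, v)"], rule exI[of _ "(j, v')"])
       (use 3 in \<open>simp add: words_eq\<close>)
qed

text \<open>The relations are stable under concatenation on either side, so concatenation descends
  to the quotient.\<close>

lemma descends_mon_context:
  assumes "a \<in> words0 V" "b \<in> words0 V"
  shows "descends V psc (sym_rel V) (\<lambda>w. mon (a @ w @ b))"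
proof (rule descendsI, goal_cases)
  case (1 c d i v v')
  then show ?case using descendsD(1)[OF descends_mon, of "a @ c" V "d @ b" v i v'] assms by simp
next
  case (2 c d i k v)
  then show ?case using descendsD(2)[OF descends_mon, of "a @ c" V "d @ b" v i k] assms by simp
next
  case (3 c d i j v v')
  then show ?case using descendsD(3)[OF descends_mon, of "a @ c" V "d @ b" v i v' j] assms by simp
qed

section \<open>The coderivation with given components\<close>

text \<open>The bracket of the selected subword is put in front of the rest, so the degree -1
  operation passes no letter and the unshuffle sign is the only one. The empty subword is excluded:
  there is no bracket of arity 0.\<close>

definition cod :: "('a word \<Rightarrow> 'a) \<Rightarrow> 'a word \<Rightarrow> ('a word \<Rightarrow>\<^sub>0 'k::field)" where
  "cod q w = unsh (\<lambda>u v. if u = [] then 0 else mon ((deg u - 1, q u) # v)) w"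

definition jacobi :: "('a word \<Rightarrow> 'a::ab_group_add) \<Rightarrow> 'a word \<Rightarrow> 'a" where
  "jacobi q w = unsh (\<lambda>u v. if u = [] then 0 else q ((deg u - 1, q u) # v)) w"

definition symop :: "int \<Rightarrow> ('k::field, 'a::ab_group_add) gvs \<Rightarrow> ('k, 'b::ab_group_add) gvs \<Rightarrow> ('a word \<Rightarrow> 'b) \<Rightarrow> bool" where
  "symop d V W q \<longleftrightarrow> (\<forall>w\<in>words V. q w \<in> cmp W (deg w + d)) \<and>
descends V (scl W) {0} q"

locale graded =
  fixes V :: "('k::field, 'a::ab_group_add) gvs"
  assumes graded_space: "graded_space V"
begin

sublocale vector_space "scl V"
  using graded_space by (simp add: graded_space_def)

lemma subspace_cmp: "subspace (cmp V i)"
  using graded_space by (simp add: graded_space_def)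

lemma cmp_intros [simp, intro]:
  "0 \<in> cmp V i" "x \<in> cmp V i \<Longrightarrow> scl V c x \<in> cmp V i" "x \<in> cmp V i \<Longrightarrow> sg d x \<in> cmp V i"
  "x \<in> cmp V i \<Longrightarrow> y \<in> cmp V i \<Longrightarrow> x + y \<in> cmp V i" "x \<in> cmp V i \<Longrightarrow> y \<in> cmp V i \<Longrightarrow> x - y \<in> cmp V i"
  "x \<in> cmp V i \<Longrightarrow> - x \<in> cmp V i"
  using subspace_cmp
  by (simp_all add: subspace_0 subspace_scale subspace_add subspace_diff subspace_neg
      subgroup_of_sg[OF subspace_subgroup_of])

lemma subgroup_cmp: "subgroup_of (cmp V i)"
  using subspace_cmp by (rule subspace_subgroup_of)

definition part1 :: "int \<Rightarrow> 'a word \<Rightarrow> 'a" where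
  "part1 i u = (if length u = 1 \<and> fst (hd u) = i then snd (hd u) else 0)"

lemma proj1_eq_lext: "proj1 V x i = lext (scl V) (part1 i) x"
  unfolding proj1_def lext_def part1_def
  by (rule sum.mono_neutral_cong_left) auto

lemma descends_part1: "descends V (scl V) {0} (part1 i)"
  by (rule descends0I) (auto simp: part1_def Cons_eq_append_conv append_eq_Cons_conv)

lemma proj1_sym_rel: "r \<in> sym_rel V \<Longrightarrow> proj1 V r i = 0"
  using lext_sym_rel[OF _ descends_part1, of r i] unfolding proj1_eq_lext
  by (auto simp: subspace_def)

lemma proj1_add: "proj1 V (x + y) i = proj1 V x i + proj1 V y i"
  and proj1_diff: "proj1 V (x - y) i = proj1 V x i - proj1 V y i"
  and proj1_mon: "proj1 V (mon u) i = part1 i u"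
  and proj1_0: "proj1 V 0 i = 0"
  by (simp_all add: proj1_eq_lext lext_add lext_diff)

lemma mon_zero: "v \<in> words0 V \<Longrightarrow> mon ((i, 0) # v) \<in> sym_rel V"
  using descendsD(2)[OF descends_mon, of "[]" V v 0 i 0] by simp

end


lemma symopD:
  assumes "symop d V W q"
  shows "w \<in> words0 V \<Longrightarrow> w \<noteq> [] \<Longrightarrow> q w \<in> cmp W (deg w + d)"
    and "descends V (scl W) {0} q"
  using assms by (auto simp: symop_def words_eq)

lemma keys_subset_subspace: "comb.subspace {x. Poly_Mapping.keys x \<subseteq> A}"
proof -
  have "Poly_Mapping.keys (psc c x) \<subseteq> Poly_Mapping.keys x" for c :: "'k::field" and x :: "'x \<Rightarrow>\<^sub>0 'k"
    by (auto simp: in_keys_iff)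
  then show ?thesis
    using keys_add by (fastforce simp: comb.subspace_def)
qed

lemma keys_mon [simp]: "Poly_Mapping.keys (mon w :: 'x \<Rightarrow>\<^sub>0 'k::field) = {w}"
  by (simp add: mon_def)

lemma free_space_subspace: "comb.subspace (free_space V)"
  unfolding free_space_def by (rule keys_subset_subspace)

lemma mon_free [simp]: "mon w \<in> free_space V \<longleftrightarrow> w \<in> words V"
  by (simp add: free_space_def)

lemma free_spaceI_subspace:
  assumes "x \<in> free_space V" "comb.subspace S" "\<And>w. w \<in> words V \<Longrightarrow> g w \<in> S"
  shows "lin g x \<in> S"
  using assms by (intro lin_mem) (auto simp: free_space_def)

lemma lin_unsh: "lin g (unsh \<phi> w) = unsh (\<lambda>u v. lin g (\<phi> u v)) w"
  by (rule unsh_hom) (rule lin_add)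

lemma lin_comult: "lin g (comult w) = unsh (\<lambda>u v. if u = [] \<or> v = [] then 0 else g (u, v)) w"
  unfolding comult_eq_unsh lin_unsh by (intro unsh_cong) auto

lemma lin_cod: "lin g (cod q w) = unsh (\<lambda>u v. if u = [] then 0 else g ((deg u - 1, q u) # v)) w"
  unfolding cod_def lin_unsh by (intro unsh_cong) auto

lemma tens_unsh_left: "tens (unsh \<phi> w) y = unsh (\<lambda>u v. tens (\<phi> u v) y) w"
  by (rule unsh_hom[of "\<lambda>x. tens x y"]) (rule tens_add_left)

lemma tens_unsh_right: "tens y (unsh \<phi> w) = unsh (\<lambda>u v. tens y (\<phi> u v)) w"
  by (rule unsh_hom) (rule tens_add_right)

text \<open>This is an equality of formal combinations, before passing to the quotient.
  \<open>X\<close> collects the terms whose bracket lies in the left tensor factor, \<open>Y\<close>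
  those in the right one; both sides are regroupings of splittings into three parts.\<close>

lemma comult_cod:
  fixes q :: "'a word \<Rightarrow> 'a"
  shows "lin comult (cod q w) = (lin (\<lambda>(a, b). tens (cod q a) (mon b) + psc (sgn_pow (deg a)) (tens (mon a) (cod q b)))
             (comult w) :: _ \<Rightarrow>\<^sub>0 'k::field)"
proof -
  define Q where "Q u = (deg u - 1, q u)" for u
  define X :: "'a word \<Rightarrow> 'a word \<Rightarrow> 'a word \<Rightarrow> ('a word \<times> 'a word \<Rightarrow>\<^sub>0 'k)"
    where "X u a b = (if u = [] \<or> b = [] then 0 else mon (Q u # a, b))" for u a b
  define Y :: "'a word \<Rightarrow> 'a word \<Rightarrow> 'a word \<Rightarrow> ('a word \<times> 'a word \<Rightarrow>\<^sub>0 'k)"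
    where "Y a u b = (if u = [] \<or> a = [] then 0 else mon (a, Q u # b))" for a u b
  have dQ: "fst (Q u) = deg u - 1" for u by (simp add: Q_def)
  have 1: "(if u = [] then 0 else comult (Q u # v))
      = unsh (\<lambda>a b. X u a b) v + unsh (\<lambda>a b. sg ((deg u - 1) * deg a) (Y a u b)) v" for u v
    unfolding comult_eq_unsh unsh.simps dQ
    by (auto simp: X_def Y_def intro!: arg_cong2[of _ _ _ _ "(+)"] unsh_cong)
  have l: "lin comult (cod q w) = unsh (\<lambda>u c. unsh (\<lambda>a b. X u a b) c) w
      + unsh (\<lambda>u c. unsh (\<lambda>a b. sg ((deg u - 1) * deg a) (Y a u b)) c) w"
    unfolding lin_cod Q_def[symmetric] 1 unsh_add ..
  have X0: "X u c [] = 0" "X [] c u = 0" and Y0: "Y [] = (\<lambda>u c. 0)" "Y u [] c = 0" for u c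
    by (simp_all add: X_def Y_def fun_eq_iff)
  have 2: "(if a = [] \<or> b = [] then 0
        else tens (cod q a) (mon b) + psc (sgn_pow (deg a)) (tens (mon a) (cod q b)))
      = unsh (\<lambda>u c. X u c b) a + unsh (\<lambda>u c. sg (deg a) (Y a u c)) b" for a b
  proof -
    have "tens (cod q a) (mon b) = unsh (\<lambda>u c. X u c b) a" if "b \<noteq> []"
      unfolding cod_def tens_unsh_left using that by (intro unsh_cong) (auto simp: X_def Q_def)
    moreover have "tens (mon a) (cod q b) = unsh (\<lambda>u c. Y a u c) b" if "a \<noteq> []"
      unfolding cod_def tens_unsh_right using that by (intro unsh_cong) (auto simp: Y_def Q_def)
    ultimately show ?thesis
      using X0 Y0 by (auto simp: unsh_sg)
  qed
  have r: "lin (\<lambda>(a, b). tens (cod q a) (mon b) + psc (sgn_pow (deg a)) (tens (mon a) (cod q b))) (comult w)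
      = unsh (\<lambda>a b. unsh (\<lambda>u c. X u c b) a) w + unsh (\<lambda>a b. unsh (\<lambda>u c. sg (deg a) (Y a u c)) b) w"
    unfolding lin_comult prod.case 2 unsh_add ..
  \<comment> \<open>Exchanging \<open>u\<close> and \<open>a\<close> adds
    \<open>deg u * deg a\<close> to the exponent \<open>(deg u - 1) * deg a\<close>, which leaves
    \<open>deg a\<close> modulo 2: the sign of moving the coderivation past
    \<open>a\<close>.\<close>
  have "unsh (\<lambda>u c. unsh (\<lambda>a b. sg ((deg u - 1) * deg a) (Y a u b)) c) w
      = unsh (\<lambda>d b. unsh (\<lambda>u a. sg ((deg u - 1) * deg a) (Y a u b)) d) w"
    by (rule unsh_assoc[symmetric])
  also have "\<dots> = unsh (\<lambda>d b. unsh (\<lambda>a u. sg (deg a) (Y a u b)) d) w"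
    by (subst unsh_comm) (intro unsh_cong, auto intro!: sg_parity simp: algebra_simps)
  also have "\<dots> = unsh (\<lambda>a b. unsh (\<lambda>u c. sg (deg a) (Y a u c)) b) w"
    by (rule unsh_assoc)
  finally show ?thesis
    unfolding l r by (simp add: unsh_assoc)
qed

context graded
begin

lemma descends_mon_Cons:
  assumes q: "symop d V V q" and v: "v \<in> words0 V"
    and c: "\<And>u u'. deg u = deg u' \<Longrightarrow> c u = c u'"
    and cq: "\<And>u. u \<in> words0 V \<Longrightarrow> u \<noteq> [] \<Longrightarrow> q u \<in> cmp V (c u)"
  shows "descends V psc (sym_rel V) (\<lambda>u. if u = [] then 0 else mon ((c u, q u) # v))"
proof (rule descendsI, goal_cases)
  case (1 a b i x y)
  have e: "c (a @ (i, x + y) # b) = c (a @ (i, x) # b)" "c (a @ (i, y) # b) = c (a @ (i, x) # b)"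
    by (auto intro!: c)
  have "q (a @ (i, x) # b) \<in> cmp V (c (a @ (i, x) # b))" "q (a @ (i, y) # b) \<in> cmp V (c (a @ (i, x) # b))"
    using cq[of "a @ (i, x) # b"] cq[of "a @ (i, y) # b"] 1 e by auto
  then show ?case
    using descends0D(1)[OF symopD(2)[OF q] 1] descendsD(1)[OF descends_mon, of "[]" V v] v e by simp
next
  case (2 a b i k x)
  have e: "c (a @ (i, scl V k x) # b) = c (a @ (i, x) # b)" by (auto intro!: c)
  have "q (a @ (i, x) # b) \<in> cmp V (c (a @ (i, x) # b))"
    using cq[of "a @ (i, x) # b"] 2 by auto
  then show ?case
    using descends0D(2)[OF symopD(2)[OF q] 2] descendsD(2)[OF descends_mon, of "[]" V v] v e by simp
next
  case (3 a b i j x y)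
  have e: "c (a @ (i, x) # (j, y) # b) = c (a @ (j, y) # (i, x) # b)" by (auto intro!: c)
  have "q (a @ (j, y) # (i, x) # b) \<in> cmp V (c (a @ (j, y) # (i, x) # b))"
    using cq[of "a @ (j, y) # (i, x) # b"] 3 by auto
  then show ?case
    using descends0D(3)[OF symopD(2)[OF q] 3] e v
      descendsD(2)[OF descends_mon, of "[]" V v "q (a @ (j, y) # (i, x) # b)" _ "sgn_pow (i * j)"] by simp
qed

lemma descends_cod:
  assumes q: "symop (-1) V V q"
  shows "descends V psc (sym_rel V) (cod q)"
  unfolding cod_def[abs_def]
proof (rule comb.descends_unsh[OF sym_rel_subspace(1)])
  fix v assume "v \<in> words0 V"
  then show "descends V psc (sym_rel V) (\<lambda>u. if u = [] then 0 else mon ((deg u - 1, q u) # v))"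
    using symopD(1)[OF q] by (intro descends_mon_Cons[OF q]) auto
next
  fix u assume u: "u \<in> words0 V"
  show "descends V psc (sym_rel V) (\<lambda>v. if u = [] then 0 else mon ((deg u - 1, q u) # v))"
  proof (cases "u = []")
    case False
    then show ?thesis
      using symopD(1)[OF q u] by (auto intro!: descends_Cons[OF descends_mon])
  qed (simp add: descends_def descends_head_def zero_sym_rel)
qed

lemma cod_mem:
  assumes q: "symop (-1) V V q" and w: "w \<in> words V"
  shows "Poly_Mapping.keys (cod q w) \<subseteq> {u \<in> words V. deg u = deg w + - 1}"
proof -
  have "cod q w \<in> {x. Poly_Mapping.keys x \<subseteq> {u \<in> words V. deg u = deg w + - 1}}"
    unfolding cod_def
  proof (rule unsh_mem[OF comb.subspace_subgroup_of[OF keys_subset_subspace]])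
    fix u v assume s: "mset u + mset v = mset w"
    have "u \<in> words0 V" "v \<in> words0 V" using words0_split[OF s] w by (auto simp: words_eq)
    with symopD(1)[OF q, of u] show "(if u = [] then 0 else mon ((deg u - 1, q u) # v))
        \<in> {x. Poly_Mapping.keys x \<subseteq> {u \<in> words V. deg u = deg w + - 1}}"
      by (simp add: words_eq mset_split(1)[OF s])
  qed
  then show ?thesis by simp
qed

lemma cod_free:
  assumes q: "symop (-1) V V q" and w: "w \<in> words V"
  shows "cod q w \<in> free_space V"
  using cod_mem[OF assms] by (auto simp: free_space_def)

lemma coderivation_cod:
  assumes q: "symop (-1) V V q"
  shows "coderivation V (cod q)"
  unfolding coderivation_def sym_map_def
proof (intro conjI ballI)
  fix w assume w: "w \<in> words V"
  show "cod q w \<in> free_space V" by (rule cod_free[OF q w])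
  show "\<exists>y. Poly_Mapping.keys y \<subseteq> {u \<in> words V. deg u = deg w + - 1} \<and> sym_eq V (cod q w) y"
    using cod_mem[OF q w] by (intro exI[of _ "cod q w"]) (simp add: sym_eq_def zero_sym_rel)
  show "tens_eq V (lin comult (cod q w))
     (lin (\<lambda>(a, b). tens (cod q a) (mon b) + psc (sgn_pow (deg a)) (tens (mon a) (cod q b))) (comult w))"
    unfolding comult_cod tens_eq_def by (simp add: zero_tens_rel)
next
  fix r assume "r \<in> sym_rel V"
  then show "lin (cod q) r \<in> sym_rel V"
    by (rule lin_sym_rel[OF sym_rel_subspace(1) descends_cod[OF q]])
qed

lemma proj1_unsh: "proj1 V (unsh \<phi> w) i = unsh (\<lambda>u v. proj1 V (\<phi> u v) i) w"
  by (rule unsh_hom[of "\<lambda>x. proj1 V x i"]) (rule proj1_add)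

lemma has_components_cod: "has_components (-1) V V (cod q) q"
  unfolding has_components_def
proof (intro ballI ext)
  fix w i assume w: "w \<in> words V"
  have "proj1 V (cod q w) i
      = unsh (\<lambda>u v. if v = [] then if u \<noteq> [] \<and> deg u - 1 = i then q u else 0 else 0) w"
    unfolding cod_def proj1_unsh
    by (intro unsh_cong) (auto simp: proj1_mon proj1_0 part1_def)
  also have "\<dots> = (if i = deg w + - 1 then q w else 0)"
    using w by (subst unsh_right_Nil) (auto simp: words_eq)
  finally show "proj1 V (cod q w) i = (if i = deg w + - 1 then q w else 0)" .
qed

text \<open>The Jacobi expression is the linear component of the square, so it can be read off from
  a square that vanishes modulo the relations.\<close>

lemma proj1_cod_square:
  assumes q: "symop (-1) V V q" and w: "w \<in> words V"
  shows "proj1 V (lin (cod q) (cod q w)) (deg w - 2) = jacobi q w"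
  unfolding lin_cod proj1_unsh jacobi_def
proof (intro unsh_cong)
  fix u v assume s: "mset u + mset v = mset w"
  have uv: "u \<in> words0 V" "v \<in> words0 V" using words0_split[OF s] w by (auto simp: words_eq)
  show "proj1 V (if u = [] then 0 else cod q ((deg u - 1, q u) # v)) (deg w - 2)
      = (if u = [] then 0 else q ((deg u - 1, q u) # v))"
  proof (cases "u = []")
    case False
    then have "(deg u - 1, q u) # v \<in> words V"
      using uv symopD(1)[OF q uv(1)] by (simp add: words_eq)
    with has_components_cod[of q] show ?thesis
      using False by (simp add: has_components_def mset_split(1)[OF s])
  qed (simp add: proj1_0)
qed

text \<open>
  The terms of \<open>cod q (cod q w)\<close> in which the two brackets are nested add up to Jacobi expressions; those
  in which they act on disjoint subwords cancel in pairs, by cocommutativity.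
\<close>

lemma cod_square:
  assumes q: "symop (-1) V V q" and J: "\<And>w. w \<in> words V \<Longrightarrow> jacobi q w = 0" and w: "w \<in> words V"
    and two: "(2 :: 'k) \<noteq> 0"
  shows "lin (cod q) (cod q w) \<in> sym_rel V"
proof -
  note G = sym_rel_subspace(2)[of V]
  have w0: "w \<in> words0 V" using w by (simp add: words_eq)
  define Q where "Q u = (deg u - 1, q u)" for u
  have Qc: "snd (Q u) \<in> cmp V (fst (Q u))" if "u \<in> words0 V" "u \<noteq> []" for u
    using symopD(1)[OF q that] by (simp add: Q_def)
  define X :: "'a word \<Rightarrow> 'a word \<Rightarrow> 'a word \<Rightarrow> ('a word \<Rightarrow>\<^sub>0 'k)"
    where "X u a b = (if u = [] then 0 else mon (Q (Q u # a) # b))" for u a b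
  define Y :: "'a word \<Rightarrow> 'a word \<Rightarrow> 'a word \<Rightarrow> ('a word \<Rightarrow>\<^sub>0 'k)"
    where "Y u a b = (if u = [] \<or> a = [] then 0 else mon (Q a # Q u # b))" for a u b
  have dQ: "fst (Q u) = deg u - 1" for u by (simp add: Q_def)
  have 1: "(if u = [] then 0 else cod q (Q u # v))
      = unsh (\<lambda>a b. X u a b) v + unsh (\<lambda>a b. sg ((deg u - 1) * deg a) (Y u a b)) v" for u v
    unfolding cod_def unsh.simps dQ Q_def[symmetric]
    by (auto simp: X_def Y_def intro!: arg_cong2[of _ _ _ _ "(+)"] unsh_cong)
  have l: "lin (cod q) (cod q w) = unsh (\<lambda>d b. unsh (\<lambda>u a. X u a b) d) w
      + unsh (\<lambda>d b. unsh (\<lambda>u a. sg ((deg u - 1) * deg a) (Y u a b)) d) w"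
    unfolding lin_cod Q_def[symmetric] 1 unsh_add unsh_assoc ..
  have A0: "unsh (\<lambda>u a. X u a b) d \<in> sym_rel V" if b: "b \<in> words0 V" and d: "d \<in> words0 V" for b d
  proof (cases "d = []")
    case False
    let ?h = "\<lambda>x. mon ((deg d - 2, x) # b) :: 'a word \<Rightarrow>\<^sub>0 'k"
    let ?\<phi> = "\<lambda>u a. if u = [] then 0 else q (Q u # a)"
    have 1: "?h (unsh ?\<phi> d) - unsh (\<lambda>u a. ?h (?\<phi> u a)) d \<in> sym_rel V"
    proof (rule unsh_hom_mod[OF G subgroup_cmp[of "deg d - 2"]])
      show "?h (x + y) - ?h x - ?h y \<in> sym_rel V" if "x \<in> cmp V (deg d - 2)" "y \<in> cmp V (deg d - 2)" for x y
        using descendsD(1)[OF descends_mon, of "[]" V b] that b by simp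
      fix u a assume s: "mset u + mset a = mset d"
      have "u \<in> words0 V" "a \<in> words0 V" using words0_split[OF s d] by auto
      with Qc[of u] show "?\<phi> u a \<in> cmp V (deg d - 2)"
        using symopD(1)[OF q, of "Q u # a"] mset_split(1)[OF s] by (simp add: dQ)
    qed
    have 0: "unsh ?\<phi> d = 0"
      using J[of d] d False unfolding jacobi_def Q_def by (simp add: words_eq)
    have 2: "unsh (\<lambda>u a. ?h (?\<phi> u a) - X u a b) d \<in> sym_rel V"
    proof (rule unsh_mem[OF G])
      fix u a assume s: "mset u + mset a = mset d"
      show "?h (?\<phi> u a) - X u a b \<in> sym_rel V"
        using mset_split(1)[OF s] mon_zero[OF b, of "deg d - 2"] subgroup_of_0[OF G]
        by (cases "u = []") (simp_all add: X_def dQ Q_def)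
    qed
    show ?thesis
      using subgroup_of_diff[OF G subgroup_of_diff[OF G mon_zero[OF b] 1] 2, of "deg d - 2"]
      by (simp add: unsh_diff 0)
  qed (simp add: X_def subgroup_of_0[OF G])
  have A: "unsh (\<lambda>d b. unsh (\<lambda>u a. X u a b) d) w \<in> sym_rel V"
    by (rule unsh_mem[OF G]) (rule A0[OF words0_split(2)[OF _ w0] words0_split(1)[OF _ w0]])
  have B0: "unsh (\<lambda>u a. sg ((deg u - 1) * deg a) (Y u a b)) d \<in> sym_rel V" (is "?t \<in> _")
    if b: "b \<in> words0 V" and d: "d \<in> words0 V" for b d
  proof -
    have t: "?t = unsh (\<lambda>u a. sg (deg u) (Y a u b)) d"
      by (subst unsh_comm) (intro unsh_cong, auto intro!: sg_parity simp: algebra_simps)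
    \<comment> \<open>The sum is added to its transposed form, which avoids choosing one splitting
      from each pair; the factor 2 is divided out at the end.\<close>
    have "?t + ?t = unsh (\<lambda>u a. sg ((deg u - 1) * deg a) (Y u a b) + sg (deg u) (Y a u b)) d"
      by (simp only: unsh_add t[symmetric])
    also have "\<dots> \<in> sym_rel V"
    proof (rule unsh_mem[OF G])
      fix u a assume s: "mset u + mset a = mset d"
      have ua: "u \<in> words0 V" "a \<in> words0 V" using words0_split[OF s d] by auto
      show "sg ((deg u - 1) * deg a) (Y u a b) + sg (deg u) (Y a u b) \<in> sym_rel V"
      proof (cases "u = [] \<or> a = []")
        case False
        have "Y u a b - sg ((deg u - 1) * (deg a - 1)) (Y a u b) \<in> sym_rel V"
          using descendsD(3)[OF descends_mon, of "[]" V b "q a" "deg a - 1" "q u" "deg u - 1"]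
            Qc[of u] Qc[of a] ua False b by (simp add: Y_def Q_def mult.commute)
        then have "sg ((deg u - 1) * deg a) (Y u a b - sg ((deg u - 1) * (deg a - 1)) (Y a u b)) \<in> sym_rel V"
          by (rule subgroup_of_sg[OF G])
        also have "sg ((deg u - 1) * deg a) (Y u a b - sg ((deg u - 1) * (deg a - 1)) (Y a u b))
            = sg ((deg u - 1) * deg a) (Y u a b) - sg (deg u - 1) (Y a u b)"
          by (simp add: sg_diff) (rule sg_parity, auto)
        also have "\<dots> = sg ((deg u - 1) * deg a) (Y u a b) + sg (deg u) (Y a u b)"
          by (simp add: sg_def)
        finally show ?thesis .
      qed (auto simp: Y_def subgroup_of_0[OF G])
    qed
    finally have "psc (1 / 2) (?t + ?t) \<in> sym_rel V"
      by (intro comb.subspace_scale[OF sym_rel_subspace(1)])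
    also have "?t + ?t = psc 2 ?t"
      using comb.scale_left_distrib[of 1 1 ?t] by simp
    finally show ?thesis using two by simp
  qed
  have B: "unsh (\<lambda>d b. unsh (\<lambda>u a. sg ((deg u - 1) * deg a) (Y u a b)) d) w \<in> sym_rel V"
    by (rule unsh_mem[OF G]) (rule B0[OF words0_split(2)[OF _ w0] words0_split(1)[OF _ w0]])
  show ?thesis unfolding l by (intro subgroup_of_add[OF G] A B)
qed

end

section \<open>Primitive elements and uniqueness\<close>

context
  fixes V :: "('k::field_char_0, 'a::ab_group_add) gvs"
begin

lemma mon_move:
  assumes "a \<in> words0 V" "b \<in> words0 V" "u \<in> words0 V" "snd z \<in> cmp V (fst z)"
  shows "mon (a @ z # u @ b) - sg (fst z * deg u) (mon (a @ u @ z # b)) \<in> sym_rel V"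
  using assms
proof (induction u arbitrary: a)
  case Nil
  then show ?case by (simp add: zero_sym_rel)
next
  case (Cons y u)
  have 1: "mon (a @ z # y # u @ b) - sg (fst z * fst y) (mon (a @ y # z # u @ b)) \<in> sym_rel V"
    using descendsD(3)[OF descends_mon, of a V "u @ b" "snd z" "fst z" "snd y" "fst y"] Cons.prems by simp
  have "mon ((a @ [y]) @ z # u @ b) - sg (fst z * deg u) (mon ((a @ [y]) @ u @ z # b)) \<in> sym_rel V"
    using Cons.prems by (intro Cons.IH) auto
  then have "sg (fst z * fst y) (mon (a @ y # z # u @ b) - sg (fst z * deg u) (mon (a @ y # u @ z # b))) \<in> sym_rel V"
    by (intro subgroup_of_sg[OF sym_rel_subspace(2)]) simp
  from subgroup_of_add[OF sym_rel_subspace(2) 1 this] show ?case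
    by (simp add: sg_diff algebra_simps)
qed

text \<open>Each of the \<open>2 ^ length w\<close> splittings contributes the same element of the
  quotient, since sorting the letters back costs exactly the unshuffle sign. The prefix
  \<open>a\<close> absorbs the letters already treated by the induction.\<close>

lemma unsh_concat:
  assumes "a \<in> words0 V" "w \<in> words0 V"
  shows "unsh (\<lambda>u v. mon (a @ u @ v)) w - psc (2 ^ length w) (mon (a @ w)) \<in> sym_rel V"
  using assms
proof (induction w arbitrary: a)
  case Nil
  then show ?case by (simp add: zero_sym_rel)
next
  case (Cons z w)
  note G = sym_rel_subspace(2)[of V]
  let ?X = "unsh (\<lambda>u v. mon (a @ z # u @ v)) w :: 'a word \<Rightarrow>\<^sub>0 'k"
  let ?Y = "unsh (\<lambda>u v. sg (fst z * deg u) (mon (a @ u @ z # v))) w :: 'a word \<Rightarrow>\<^sub>0 'k"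
  have 1: "?X - psc (2 ^ length w) (mon (a @ z # w)) \<in> sym_rel V"
    using Cons.IH[of "a @ [z]"] Cons.prems by simp
  have 2: "?X - ?Y \<in> sym_rel V"
    unfolding unsh_diff[symmetric]
  proof (rule unsh_mem[OF G])
    fix u v assume s: "mset u + mset v = mset w"
    show "mon (a @ z # u @ v) - sg (fst z * deg u) (mon (a @ u @ z # v)) \<in> sym_rel V"
      using words0_split[OF s] Cons.prems by (intro mon_move) auto
  qed
  have "(?X - psc (2 ^ length w) (mon (a @ z # w))) + (?X - psc (2 ^ length w) (mon (a @ z # w))) - (?X - ?Y) \<in> sym_rel V"
    by (intro subgroup_of_add[OF G] subgroup_of_diff[OF G] 1 2)
  moreover have "psc (2 ^ length (z # w)) (mon (a @ z # w))
      = psc (2 ^ length w) (mon (a @ z # w)) + (psc (2 ^ length w) (mon (a @ z # w)) :: 'a word \<Rightarrow>\<^sub>0 'k)"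
    by (simp flip: comb.scale_left_distrib add: mult_2[symmetric])
  ultimately show ?case by (simp add: algebra_simps)
qed

lemma concat_comult:
  assumes w: "w \<in> words V"
  shows "lin (\<lambda>(u, v). mon (u @ v)) (comult w) - psc (2 ^ length w - 2) (mon w) \<in> sym_rel V"
proof -
  \<comment> \<open>Inclusion and exclusion of the splittings with an empty part; the doubly empty
    one disappears because \<open>w\<close> is nonempty.\<close>
  have "(if u = [] \<or> v = [] then 0 else mon (u @ v) :: 'a word \<Rightarrow>\<^sub>0 'k)
      = mon (u @ v) - (if u = [] then mon (u @ v) else 0) - (if v = [] then mon (u @ v) else 0)
        + (if v = [] then if u = [] then mon (u @ v) else 0 else 0)"
    for u v :: "'a word" by simp
  then have "lin (\<lambda>(u, v). mon (u @ v)) (comult w) = unsh (\<lambda>u v. mon (u @ v)) w - mon w - (mon w :: _ \<Rightarrow>\<^sub>0 'k)"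
    using w unfolding lin_comult prod.case
    by (simp only: unsh_add unsh_diff unsh_left_Nil unsh_right_Nil) (auto simp: words_eq)
  moreover have "psc (2 ^ length w - 2) (mon w) = psc (2 ^ length w) (mon w) - mon w - (mon w :: _ \<Rightarrow>\<^sub>0 'k)"
    using comb.scale_left_diff_distrib[of "2 ^ length w" 2 "mon w"] comb.scale_left_distrib[of "1::'k" 1 "mon w"]
    by (simp add: algebra_simps)
  ultimately show ?thesis
    using unsh_concat[of "[]" w] w by (simp add: words_eq)
qed

lemma lin_concat_tens_rel:
  assumes "x \<in> tens_rel V"
  shows "lin (\<lambda>(u, v). mon (u @ v)) x \<in> sym_rel V"
  using assms unfolding tens_rel_def
proof (rule lin_span[OF _ sym_rel_subspace(1)])
  fix b assume "b \<in> {tens r (mon w) | r w. r \<in> sym_rel V \<and> w \<in> words V} \<union>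
      {tens (mon w) r | r w. r \<in> sym_rel V \<and> w \<in> words V}"
  then consider r w where "r \<in> sym_rel V" "w \<in> words V" "b = tens r (mon w)"
    | r w where "r \<in> sym_rel V" "w \<in> words V" "b = tens (mon w) r" by blast
  then show "lin (\<lambda>(u, v). mon (u @ v)) b \<in> sym_rel V"
  proof cases
    case 1
    have "lin (\<lambda>(u, v). mon (u @ v)) b = lin (\<lambda>u. mon (u @ w)) r"
      by (simp add: 1 tens_def lin_lin)
    also have "\<dots> \<in> sym_rel V"
      using 1 descends_mon_context[of "[]" V w]
      by (intro lin_sym_rel[OF sym_rel_subspace(1)]) (auto simp: words_eq)
    finally show ?thesis .
  next
    case 2
    have "lin (\<lambda>(u, v). mon (u @ v)) b = lin (\<lambda>v. mon (w @ v)) r"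
      by (simp add: 2 tens_def lin_lin)
    also have "\<dots> \<in> sym_rel V"
      using 2 descends_mon_context[of w V "[]"]
      by (intro lin_sym_rel[OF sym_rel_subspace(1)]) (auto simp: words_eq)
    finally show ?thesis .
  qed
qed

text \<open>Each generating relation involves words of one length only, so rescaling by a function
  of the length is well defined on the quotient.\<close>

lemma rescale_sym_rel:
  fixes c :: "nat \<Rightarrow> 'k"
  assumes "r \<in> sym_rel V"
  shows "lin (\<lambda>w. psc (c (length w)) (mon w)) r \<in> sym_rel V"
proof (rule lin_sym_rel[OF sym_rel_subspace(1) _ assms], rule descendsI, goal_cases)
  case (1 a b i v v')
  then show ?case
    using comb.subspace_scale[OF sym_rel_subspace(1) descendsD(1)[OF descends_mon, of a V b v i v']]
    by (simp add: comb.scale_right_diff_distrib)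
next
  case (2 a b i k v)
  then show ?case
    using comb.subspace_scale[OF sym_rel_subspace(1) descendsD(2)[OF descends_mon, of a V b v i k],
        of "c (length (a @ (i, v) # b))"]
    by (simp add: comb.scale_right_diff_distrib mult.commute)
next
  case (3 a b i j v v')
  then show ?case
    using comb.subspace_scale[OF sym_rel_subspace(1) descendsD(3)[OF descends_mon, of a V b v i v' j]]
    by (simp add: comb.scale_right_diff_distrib comb.scale_sg)
qed

lemma two_power_neq: "m \<ge> 2 \<Longrightarrow> (2::'k) ^ m \<noteq> 2"
proof -
  assume "m \<ge> 2"
  then have "(2::nat) ^ 1 < 2 ^ m" by (intro power_strict_increasing) auto
  then have "(2::nat) ^ m \<noteq> 2" by simp
  then have "of_nat (2 ^ m) \<noteq> (of_nat 2 :: 'k)" by (simp only: of_nat_eq_iff) simp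
  then show ?thesis by simp
qed

text \<open>
  Concatenation after comultiplication is multiplication by \<open>2\<^sup>m - 2\<close> on words of length \<open>m\<close>; the
  rescaling below has the junk value \<open>1 / 0 = 0\<close> at \<open>m = 1\<close>, which kills the linear part.
\<close>

lemma primitive_linear:
  assumes x: "x \<in> free_space V" and p: "lin comult x \<in> tens_rel V"
  shows "x - lin (\<lambda>w. if length w = 1 then mon w else 0) x \<in> sym_rel V"
proof -
  note G = sym_rel_subspace(2)[of V]
  let ?c = "\<lambda>m. 1 / (2 ^ m - 2 :: 'k)"
  let ?y = "lin (\<lambda>w. psc (2 ^ length w - 2) (mon w)) x :: 'a word \<Rightarrow>\<^sub>0 'k"
  have "lin (\<lambda>(u, v). mon (u @ v)) (lin comult x) - ?y \<in> sym_rel V"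
    unfolding lin_lin lin_fun_diff[symmetric]
    using x sym_rel_subspace(1) concat_comult by (rule free_spaceI_subspace)
  then have "?y \<in> sym_rel V"
    using subgroup_of_diff[OF G lin_concat_tens_rel[OF p]] by fastforce
  from rescale_sym_rel[OF this, of ?c]
  have "lin (\<lambda>w. psc (2 ^ length w - 2) (psc (?c (length w)) (mon w))) x \<in> sym_rel V"
    by (simp add: lin_lin lin_psc)
  also have "lin (\<lambda>w. psc (2 ^ length w - 2) (psc (?c (length w)) (mon w))) x
      = lin (\<lambda>w. mon w - (if length w = 1 then mon w else 0)) x"
  proof (rule lin_cong)
    fix w assume "w \<in> Poly_Mapping.keys x"
    then have "length w \<noteq> 0" using x by (auto simp: free_space_def words_def)
    then consider "length w = 1" | "length w \<ge> 2" by linarith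
    then show "psc (2 ^ length w - 2) (psc (?c (length w)) (mon w))
        = mon w - (if length w = 1 then mon w else 0)"
      using two_power_neq[of "length w"] by cases auto
  qed
  finally show ?thesis by (simp add: lin_fun_diff lin_mon_id)
qed

end

text \<open>One-letter words of the same degree add up, modulo the relations, to a single letter
  carrying the corresponding value of \<open>proj1\<close>. If that value is zero in every degree,
  nothing is left.\<close>

lemma (in graded) linear_part_sym_rel:
  assumes x: "x \<in> free_space V" and p: "\<And>i. proj1 V x i = 0"
  shows "lin (\<lambda>w. if length w = 1 then mon w else 0) x \<in> sym_rel V"
proof -
  note G = sym_rel_subspace(2)[of V]
  let ?K = "Poly_Mapping.keys x" and ?l = "Poly_Mapping.lookup x"
  let ?U = "\<lambda>i. {u \<in> ?K. length u = 1 \<and> fst (hd u) = i}"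
  let ?I = "(\<lambda>u. fst (hd u)) ` ?K"
  have part: "(\<Sum>u\<in>U. psc (?l u) (mon u)) - mon [(i, \<Sum>u\<in>U. scl V (?l u) (snd (hd u)))] \<in> sym_rel V"
    if "U \<subseteq> ?U i" for U i
  proof -
    have "finite U" using that finite_subset[of U ?K] by auto
    then show ?thesis using that
    proof (induction U)
      case empty
      then show ?case using subgroup_of_uminus[OF G mon_zero[of "[]" i]] by simp
    next
      case (insert u U)
      obtain v where v: "u = [(i, v)]" using insert.prems by (cases u) auto
      have vc: "v \<in> cmp V i" using x insert.prems v by (auto simp: free_space_def words_def)
      have "w = [(i, snd (hd w))] \<and> snd (hd w) \<in> cmp V i" if "w \<in> U" for w
      proof -
        have w: "w \<in> ?K" "length w = 1" "fst (hd w) = i" using that insert.prems by auto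
        then obtain v' where "w = [(i, v')]" by (cases w) auto
        then show ?thesis using w x by (auto simp: free_space_def words_def)
      qed
      then have s: "(\<Sum>u\<in>U. scl V (?l u) (snd (hd u))) \<in> cmp V i" (is "?s \<in> _")
        by (intro subspace_sum[OF subspace_cmp]) auto
      have 1: "mon [(i, scl V (?l u) v + ?s)] - mon [(i, scl V (?l u) v)] - mon [(i, ?s)] \<in> sym_rel V"
        using descendsD(1)[OF descends_mon, of "[]" V "[]" "scl V (?l u) v" i ?s] s vc by simp
      have 2: "mon [(i, scl V (?l u) v)] - psc (?l u) (mon [(i, v)]) \<in> sym_rel V"
        using descendsD(2)[OF descends_mon, of "[]" V "[]" v i "?l u"] vc by simp
      have 3: "(\<Sum>u\<in>U. psc (?l u) (mon u)) - mon [(i, ?s)] \<in> sym_rel V"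
        using insert by auto
      from subgroup_of_diff[OF G subgroup_of_diff[OF G 3 1] 2] show ?case
        using insert.hyps v by (simp add: algebra_simps)
    qed
  qed
  have "lin (\<lambda>w. if length w = 1 then mon w else 0) x = (\<Sum>u\<in>{u \<in> ?K. length u = 1}. psc (?l u) (mon u))"
    unfolding lin_def by (rule sum.mono_neutral_cong_right) auto
  also have "\<dots> = (\<Sum>i\<in>?I. \<Sum>u\<in>{u \<in> {u \<in> ?K. length u = 1}. fst (hd u) = i}. psc (?l u) (mon u))"
    by (rule sum.group[symmetric]) auto
  also have "\<dots> \<in> sym_rel V"
  proof (rule subgroup_of_sum[OF G])
    fix i
    have "{u \<in> {u \<in> ?K. length u = 1}. fst (hd u) = i} = ?U i" by auto
    moreover have "(\<Sum>u\<in>?U i. psc (?l u) (mon u)) \<in> sym_rel V"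
      using part[of "?U i" i] p[of i] subgroup_of_add[OF G _ mon_zero[of "[]" i]]
      unfolding proj1_def by fastforce
    ultimately show "(\<Sum>u\<in>{u \<in> {u \<in> ?K. length u = 1}. fst (hd u) = i}. psc (?l u) (mon u)) \<in> sym_rel V"
      by simp
  qed
  finally show ?thesis .
qed

lemma primitive_zero:
  fixes V :: "('k::field_char_0, 'a::ab_group_add) gvs"
  assumes "graded_space V" "x \<in> free_space V" "lin comult x \<in> tens_rel V" "\<And>i. proj1 V x i = 0"
  shows "x \<in> sym_rel V"
  using subgroup_of_add[OF sym_rel_subspace(2) primitive_linear[OF assms(2,3)]
      graded.linear_part_sym_rel[OF graded.intro[OF assms(1)] assms(2,4)]]
  by simp

section \<open>Uniqueness of maps with given components\<close>

lemma tens_rel_left: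
  assumes "r \<in> sym_rel V" "y \<in> free_space V"
  shows "tens r y \<in> tens_rel V"
proof -
  have "tens r (mon w) \<in> tens_rel V" if "w \<in> words V" for w
    unfolding tens_rel_def using assms(1) that by (intro comb.span_base) auto
  then show ?thesis
    unfolding tens_eq_lin[of r y] by (rule free_spaceI_subspace[OF assms(2) tens_rel_subspace(1)])
qed

lemma tens_rel_right:
  assumes "r \<in> sym_rel V" "y \<in> free_space V"
  shows "tens y r \<in> tens_rel V"
proof -
  have "tens (mon w) r \<in> tens_rel V" if "w \<in> words V" for w
    unfolding tens_rel_def using assms(1) that by (intro comb.span_base) auto
  then have "lin (\<lambda>w. tens (mon w) r) y \<in> tens_rel V"
    by (rule free_spaceI_subspace[OF assms(2) tens_rel_subspace(1)])
  then show ?thesis by (simp add: tens_def)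
qed

lemma unsh_proper_mem:
  assumes "subgroup_of K" "w \<in> words V"
    and "\<And>u v. u \<in> words V \<Longrightarrow> v \<in> words V \<Longrightarrow> length u < length w \<Longrightarrow> length v < length w \<Longrightarrow> \<phi> u v \<in> K"
  shows "unsh (\<lambda>u v. if u = [] \<or> v = [] then 0 else \<phi> u v) w \<in> K"
proof (rule unsh_mem[OF assms(1)])
  fix u v assume s: "mset u + mset v = mset w"
  have "u \<in> words0 V" "v \<in> words0 V" using words0_split[OF s] assms(2) by (auto simp: words_eq)
  then show "(if u = [] \<or> v = [] then 0 else \<phi> u v) \<in> K"
    using assms(3)[of u v] mset_split(2)[OF s] subgroup_of_0[OF assms(1)] by (auto simp: words_eq)
qed

text \<open>Uniqueness by induction on word length: the difference of two maps with the same
  components is primitive modulo the relations, and its linear part vanishes.\<close>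

lemma maps_unique:
  fixes V :: "('k::field_char_0, 'a::ab_group_add) gvs" and W :: "('k, 'b::ab_group_add) gvs"
  assumes W: "graded_space W"
    and free: "\<And>w. w \<in> words V \<Longrightarrow> F w \<in> free_space W" "\<And>w. w \<in> words V \<Longrightarrow> F' w \<in> free_space W"
    and comult: "\<And>w. w \<in> words V \<Longrightarrow> lin comult (F w) - lin (\<lambda>(a, b). \<Theta> a b) (comult w) \<in> tens_rel W"
      "\<And>w. w \<in> words V \<Longrightarrow> lin comult (F' w) - lin (\<lambda>(a, b). \<Theta>' a b) (comult w) \<in> tens_rel W"
    and step: "\<And>a b. a \<in> words V \<Longrightarrow> b \<in> words V \<Longrightarrow> F a - F' a \<in> sym_rel W \<Longrightarrow> F b - F' b \<in> sym_rel W \<Longrightarrow>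
      \<Theta> a b - \<Theta>' a b \<in> tens_rel W"
    and q: "has_components d V W F q" "has_components d V W F' q"
    and w: "w \<in> words V"
  shows "F w - F' w \<in> sym_rel W"
  using w
proof (induction "length w" arbitrary: w rule: less_induct)
  case less
  note T = tens_rel_subspace(2)[of W]
  interpret graded W by unfold_locales (rule W)
  have 1: "lin comult (F w - F' w) - lin (\<lambda>(a, b). \<Theta> a b - \<Theta>' a b) (comult w) \<in> tens_rel W"
    using subgroup_of_diff[OF T comult[OF less.prems]]
    by (simp add: lin_diff lin_fun_diff case_prod_beta' algebra_simps)
  \<comment> \<open>The reduced comultiplication has only proper splittings, so the induction
    hypothesis applies to both factors.\<close>
  have 2: "lin (\<lambda>(a, b). \<Theta> a b - \<Theta>' a b) (comult w) \<in> tens_rel W"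
    unfolding lin_comult prod.case
    by (rule unsh_proper_mem[OF T less.prems]) (intro step less.hyps)
  show ?case
  proof (rule primitive_zero[OF W])
    show "F w - F' w \<in> free_space W"
      using free[OF less.prems] comb.subspace_diff[OF free_space_subspace] by blast
    show "lin comult (F w - F' w) \<in> tens_rel W"
      using subgroup_of_add[OF T 1 2] by simp
    show "proj1 W (F w - F' w) i = 0" for i
      using q less.prems by (simp add: proj1_diff has_components_def)
  qed
qed

lemma coderivation_unique:
  fixes V :: "('k::field_char_0, 'a::ab_group_add) gvs"
  assumes V: "graded_space V" and \<delta>: "coderivation V \<delta>" and \<delta>': "coderivation V \<delta>'"
    and q: "has_components (-1) V V \<delta> q" "has_components (-1) V V \<delta>' q"
    and w: "w \<in> words V"
  shows "\<delta> w - \<delta>' w \<in> sym_rel V"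
proof -
  note T = tens_rel_subspace(2)[of V]
  let ?\<Theta> = "\<lambda>\<delta> a b. tens (\<delta> a) (mon b) + psc (sgn_pow (deg a)) (tens (mon a) (\<delta> b))"
  show ?thesis
  proof (rule maps_unique[where \<Theta> = "?\<Theta> \<delta>" and \<Theta>' = "?\<Theta> \<delta>'", OF V _ _ _ _ _ q w])
    fix a b assume "a \<in> words V" "b \<in> words V" "\<delta> a - \<delta>' a \<in> sym_rel V" "\<delta> b - \<delta>' b \<in> sym_rel V"
    then have "tens (\<delta> a - \<delta>' a) (mon b) + sg (deg a) (tens (mon a) (\<delta> b - \<delta>' b)) \<in> tens_rel V"
      by (intro subgroup_of_add[OF T] subgroup_of_sg[OF T] tens_rel_left tens_rel_right) auto
    then show "?\<Theta> \<delta> a b - ?\<Theta> \<delta>' a b \<in> tens_rel V"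
      by (simp add: tens_diff_left tens_diff_right sg_diff algebra_simps)
  qed (use \<delta> \<delta>' in \<open>auto simp: coderivation_def sym_map_def tens_eq_def\<close>)
qed

lemma coalgebra_morphism_unique:
  fixes V :: "('k::field_char_0, 'a::ab_group_add) gvs" and W :: "('k, 'b::ab_group_add) gvs"
  assumes W: "graded_space W" and F: "coalgebra_morphism V W F" and F': "coalgebra_morphism V W F'"
    and q: "has_components 0 V W F q" "has_components 0 V W F' q"
    and w: "w \<in> words V"
  shows "F w - F' w \<in> sym_rel W"
proof (rule maps_unique[where \<Theta> = "\<lambda>a b. tens (F a) (F b)" and \<Theta>' = "\<lambda>a b. tens (F' a) (F' b)",
      OF W _ _ _ _ _ q w])
  note T = tens_rel_subspace(2)[of W]
  have free: "F w \<in> free_space W" "F' w \<in> free_space W" if "w \<in> words V" for w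
    using F F' that by (auto simp: coalgebra_morphism_def sym_map_def)
  fix a b assume "a \<in> words V" "b \<in> words V" "F a - F' a \<in> sym_rel W" "F b - F' b \<in> sym_rel W"
  then have "tens (F a - F' a) (F b) + tens (F' a) (F b - F' b) \<in> tens_rel W"
    using free by (intro subgroup_of_add[OF T] tens_rel_left tens_rel_right) auto
  then show "tens (F a) (F b) - tens (F' a) (F' b) \<in> tens_rel W"
    by (simp add: tens_diff_left tens_diff_right algebra_simps)
qed (use F F' in \<open>auto simp: coalgebra_morphism_def sym_map_def tens_eq_def\<close>)


section \<open>Suspension of skew-symmetric maps\<close>

definition shift :: "int \<Rightarrow> 'a word \<Rightarrow> 'a word" where
  "shift d w = map (\<lambda>(i, v). (i + d, v)) w"

lemma shift_simps [simp]:
  "shift d [] = []" "shift d (z # w) = (fst z + d, snd z) # shift d w"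
  "shift d (a @ b) = shift d a @ shift d b" "shift d w = [] \<longleftrightarrow> w = []" "length (shift d w) = length w"
  "shift c (shift d w) = shift (d + c) w" "shift 0 w = w"
  by (simp_all add: shift_def case_prod_beta comp_def add.assoc)

lemma deg_shift [simp]: "deg (shift d w) = deg w + d * int (length w)"
  by (induction w) (simp_all add: algebra_simps)

lemma cmp_susp [simp]: "cmp (susp V) i = cmp V (i - 1)" "scl (susp V) = scl V"
  by (simp_all add: susp_def)

lemma words0_shift [simp]:
  "shift (- 1) w \<in> words0 V \<longleftrightarrow> w \<in> words0 (susp V)" "shift 1 w \<in> words0 (susp V) \<longleftrightarrow> w \<in> words0 V"
  by (induction w) simp_all

lemma graded_susp: "graded_space V \<Longrightarrow> graded_space (susp V)"
  by (simp add: graded_space_def)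

primrec susp_exp :: "'a word \<Rightarrow> int" where
  "susp_exp [] = 0"
| "susp_exp (z # w) = int (length w) * fst z + susp_exp w"

lemma susp_exp_append: "susp_exp (a @ b) = int (length b) * deg a + susp_exp a + susp_exp b"
  by (induction a) (simp_all add: algebra_simps)

lemma susp_exp_eq: "(\<Sum>j<length w. int (length w - 1 - j) * fst (w ! j)) = susp_exp w"
  by (induction w) (simp_all add: sum.lessThan_Suc_shift del: sum.lessThan_Suc)

lemma suspended_eq:
  assumes "vector_space (scl W)"
  shows "suspended W m w = sg (int (length w * (length w - 1) div 2) + susp_exp w) (m (length w) (shift (- 1) w))"
proof -
  interpret vector_space "scl W" by (rule assms)
  have "map (\<lambda>(i, v). (i - 1, v)) w = shift (- 1) w" by (simp add: shift_def)
  then show ?thesis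
    unfolding suspended_def Let_def susp_exp_eq sgn_pow_add[symmetric] by simp
qed

lemma skew_mapD:
  assumes "skew_map k d L L' m"
  shows "w \<in> words0 L \<Longrightarrow> w \<noteq> [] \<Longrightarrow> length w = k \<Longrightarrow> m w \<in> cmp L' (deg w + d)"
    and "a \<in> words0 L \<Longrightarrow> b \<in> words0 L \<Longrightarrow> v \<in> cmp L i \<Longrightarrow> v' \<in> cmp L i \<Longrightarrow> length a + 1 + length b = k \<Longrightarrow>
      m (a @ (i, v + v') # b) = m (a @ (i, v) # b) + m (a @ (i, v') # b)"
    and "a \<in> words0 L \<Longrightarrow> b \<in> words0 L \<Longrightarrow> v \<in> cmp L i \<Longrightarrow> length a + 1 + length b = k \<Longrightarrow>
      m (a @ (i, scl L c v) # b) = scl L' c (m (a @ (i, v) # b))"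
    and "a \<in> words0 L \<Longrightarrow> b \<in> words0 L \<Longrightarrow> v \<in> cmp L i \<Longrightarrow> v' \<in> cmp L j \<Longrightarrow> length a + 2 + length b = k \<Longrightarrow>
      m (a @ (i, v) # (j, v') # b) = scl L' (- sgn_pow (i * j)) (m (a @ (j, v') # (i, v) # b))"
proof (goal_cases)
  note S = assms[unfolded skew_map_def words_eq]
  case 1
  then show ?case using S[THEN conjunct1] by blast
next
  note S = assms[unfolded skew_map_def words_eq]
  case 2
  then show ?case using S[THEN conjunct2, THEN conjunct1, rule_format, of a i v b v'] by simp
next
  note S = assms[unfolded skew_map_def words_eq]
  case 3
  then show ?case using S[THEN conjunct2, THEN conjunct2, THEN conjunct1, rule_format, of a i v b c] by simp
next
  note S = assms[unfolded skew_map_def words_eq]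
  case 4
  then show ?case
    using S[THEN conjunct2, THEN conjunct2, THEN conjunct2, rule_format, of a "(i, v)" "(j, v')" b] by simp
qed

text \<open>Decalage. Exchanging neighbours of degrees \<open>i\<close> and \<open>j\<close> in the
  suspension changes \<open>susp_exp\<close> by \<open>i + j\<close> modulo 2, and
  \<open>(i - 1) * (j - 1) + 1 + i + j\<close> has the parity of \<open>i * j\<close>: skew symmetry
  becomes symmetry.\<close>

lemma symop_suspended:
  assumes L: "graded_space L" and l: "\<And>k. k \<ge> 1 \<Longrightarrow> skew_map k (int k - 2) L L (l k)"
  shows "symop (- 1) (susp L) (susp L) (suspended L l)"
proof -
  interpret graded L by unfold_locales (rule L)
  note S = suspended_eq[OF vector_space_axioms]
  show ?thesis
    unfolding symop_def
  proof (intro conjI ballI descends0I)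
    fix w assume w: "w \<in> words (susp L)"
    then have "length w \<ge> 1" "shift (- 1) w \<in> words0 L" "w \<noteq> []"
      by (auto simp: words_eq Suc_le_eq)
    then have "l (length w) (shift (- 1) w) \<in> cmp L (deg (shift (- 1) w) + (int (length w) - 2))"
      by (intro skew_mapD(1)[OF l]) auto
    then show "suspended L l w \<in> cmp (susp L) (deg w + - 1)" by (simp add: S)
  next
    fix a b :: "'b word" and i v v'
    assume "a \<in> words0 (susp L)" "b \<in> words0 (susp L)" "v \<in> cmp (susp L) i" "v' \<in> cmp (susp L) i"
    then show "suspended L l (a @ (i, v + v') # b) = suspended L l (a @ (i, v) # b) + suspended L l (a @ (i, v') # b)"
      using skew_mapD(2)[OF l, of "length a + 1 + length b" "shift (- 1) a" "shift (- 1) b" v "i - 1" v']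
      by (simp add: S susp_exp_append sg_add)
  next
    fix a b :: "'b word" and i c v
    assume "a \<in> words0 (susp L)" "b \<in> words0 (susp L)" "v \<in> cmp (susp L) i"
    then show "suspended L l (a @ (i, scl (susp L) c v) # b) = scl (susp L) c (suspended L l (a @ (i, v) # b))"
      using skew_mapD(3)[OF l, of "length a + 1 + length b" "shift (- 1) a" "shift (- 1) b" v "i - 1" c]
      by (simp add: S susp_exp_append scale_sg)
  next
    fix a b :: "'b word" and i j v v'
    assume "a \<in> words0 (susp L)" "b \<in> words0 (susp L)" "v \<in> cmp (susp L) i" "v' \<in> cmp (susp L) j"
    then have "l (length a + 2 + length b) (shift (- 1) a @ (i - 1, v) # (j - 1, v') # shift (- 1) b)
        = scl L (- sgn_pow ((i - 1) * (j - 1))) (l (length a + 2 + length b) (shift (- 1) a @ (j - 1, v') # (i - 1, v) # shift (- 1) b))"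
      by (intro skew_mapD(4)[OF l]) auto
    then have "l (length a + 2 + length b) (shift (- 1) a @ (i - 1, v) # (j - 1, v') # shift (- 1) b)
        = sg ((i - 1) * (j - 1) + 1) (l (length a + 2 + length b) (shift (- 1) a @ (j - 1, v') # (i - 1, v) # shift (- 1) b))"
      by (simp add: sg_def)
    then show "suspended L l (a @ (i, v) # (j, v') # b) = sg (i * j) (suspended L l (a @ (j, v') # (i, v) # b))"
      by (simp add: S susp_exp_append) (rule sg_parity, auto)
  qed
qed

text \<open>Inverse decalage: the same sign once more, computed from the suspended degrees, since
  signs square to one.\<close>

definition desuspended :: "('a word \<Rightarrow> 'b::ab_group_add) \<Rightarrow> nat \<Rightarrow> 'a word \<Rightarrow> 'b" where
  "desuspended q k w = sg (int (k * (k - 1) div 2) + susp_exp (shift 1 w)) (q (shift 1 w))"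

lemma suspended_desuspended:
  assumes "vector_space (scl W)"
  shows "suspended W (desuspended q) w = q w"
  unfolding suspended_eq[OF assms] desuspended_def by (simp add: sg_def)

lemma skew_map_desuspended:
  assumes L: "graded_space L" and q: "symop (- 1) (susp L) (susp L) q"
  shows "skew_map k (int k - 2) L L (desuspended q k)"
proof -
  interpret graded L by unfold_locales (rule L)
  note D = descends0D[OF symopD(2)[OF q]]
  show ?thesis
    unfolding skew_map_def
  proof (intro conjI ballI allI impI, goal_cases)
    case (1 w)
    then have "q (shift 1 w) \<in> cmp (susp L) (deg (shift 1 w) + - 1)"
      by (intro symopD(1)[OF q]) (auto simp: words_eq)
    with 1 show ?case by (auto simp: desuspended_def add_diff_eq)
  next
    case (2 a b i v v')
    then show ?case
      using D(1)[of "shift 1 a" "shift 1 b" v "i + 1" v']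
      by (simp add: desuspended_def words_eq susp_exp_append sg_add)
  next
    case (3 a b i c v)
    then show ?case
      using D(2)[of "shift 1 a" "shift 1 b" v "i + 1" c]
      by (simp add: desuspended_def words_eq susp_exp_append scale_sg)
  next
    case (4 a b x y)
    then have "q (shift 1 a @ (fst x + 1, snd x) # (fst y + 1, snd y) # shift 1 b)
        = sg ((fst x + 1) * (fst y + 1)) (q (shift 1 a @ (fst y + 1, snd y) # (fst x + 1, snd x) # shift 1 b))"
      by (intro D(3)) (auto simp: words_eq)
    then show ?case
      by (simp add: desuspended_def susp_exp_append) (auto simp: sg_def)
  qed
qed


section \<open>L-infinity algebras and strict morphisms in terms of suspended brackets\<close>

lemma Linf_algebra_graded: "Linf_algebra L l \<Longrightarrow> graded_space L"
  by (simp add: Linf_algebra_def)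

lemma Linf_algebra_symop: "Linf_algebra L l \<Longrightarrow> symop (- 1) (susp L) (susp L) (suspended L l)"
  by (rule symop_suspended) (auto simp: Linf_algebra_def)

lemma codiff_cod:
  assumes "Linf_algebra L l"
  shows "codiff L l (cod (suspended L l))"
proof -
  interpret graded "susp L"
    by unfold_locales (intro graded_susp Linf_algebra_graded[OF assms])
  show ?thesis
    unfolding codiff_def
    by (intro conjI coderivation_cod has_components_cod Linf_algebra_symop[OF assms])
qed

lemma codiff_unique:
  assumes "Linf_algebra L l" "codiff L l \<delta>" "w \<in> words (susp L)"
  shows "\<delta> w - cod (suspended L l) w \<in> sym_rel (susp L)"
  using assms codiff_cod[OF assms(1)] unfolding codiff_def
  by (intro coderivation_unique[OF graded_susp[OF Linf_algebra_graded[OF assms(1)]]]) auto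

text \<open>The given \<open>\<delta>\<close> agrees with the canonical coderivation only modulo the
  relations. The two squares differ by \<open>\<delta>\<close> applied to a relation and by a
  relation-valued map applied to the canonical coderivation; projecting to the linear part then
  yields an exact identity.\<close>

lemma Linf_algebra_jacobi:
  assumes L: "Linf_algebra L l" and w: "w \<in> words (susp L)"
  shows "jacobi (suspended L l) w = 0"
proof -
  interpret graded "susp L"
    by unfold_locales (intro graded_susp Linf_algebra_graded[OF L])
  note G = sym_rel_subspace(2)[of "susp L"] and q = Linf_algebra_symop[OF L]
  let ?d = "cod (suspended L l)"
  obtain \<delta> where \<delta>: "codiff L l \<delta>" "\<And>w. w \<in> words (susp L) \<Longrightarrow> lin \<delta> (\<delta> w) \<in> sym_rel (susp L)"
    using L by (auto simp: Linf_algebra_def sym_eq_def)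
  note u = codiff_unique[OF L \<delta>(1)]
  have resp: "lin \<delta> r \<in> sym_rel (susp L)" if "r \<in> sym_rel (susp L)" for r
    using \<delta>(1) that by (auto simp: codiff_def coderivation_def sym_map_def)
  have 1: "lin \<delta> (\<delta> w - ?d w) \<in> sym_rel (susp L)"
    by (intro resp u w)
  have 2: "lin (\<lambda>v. \<delta> v - ?d v) (?d w) \<in> sym_rel (susp L)"
    by (rule free_spaceI_subspace[OF cod_free[OF q w] sym_rel_subspace(1) u])
  have "lin \<delta> (\<delta> w) - lin \<delta> (\<delta> w - ?d w) - lin (\<lambda>v. \<delta> v - ?d v) (?d w) \<in> sym_rel (susp L)"
    by (intro subgroup_of_diff[OF G] 1 2 \<delta>(2) w)
  then have "lin ?d (?d w) \<in> sym_rel (susp L)"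
    by (simp add: lin_diff lin_fun_diff)
  then show ?thesis
    using proj1_cod_square[OF q w] proj1_sym_rel by simp
qed

lemma Linf_algebraI:
  fixes M :: "('k::field_char_0, 'a::ab_group_add) gvs"
  assumes M: "graded_space M" and q: "symop (- 1) (susp M) (susp M) q"
    and J: "\<And>w. w \<in> words (susp M) \<Longrightarrow> jacobi q w = 0"
  shows "Linf_algebra M (desuspended q)"
proof -
  interpret graded "susp M"
    by unfold_locales (intro graded_susp M)
  have s: "suspended M (desuspended q) = q"
    using suspended_desuspended[of M q] vector_space_axioms by auto
  show ?thesis
    unfolding Linf_algebra_def codiff_def s sym_eq_def
    using coderivation_cod[OF q] has_components_cod[of q] cod_square[OF q J] skew_map_desuspended[OF M q] M
    by (auto intro!: exI[of _ "cod q"])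
qed

section \<open>Strict morphisms as letterwise maps\<close>

definition glin :: "('k, 'a::ab_group_add) gvs \<Rightarrow> ('k, 'b::ab_group_add) gvs \<Rightarrow> (int \<Rightarrow> 'a \<Rightarrow> 'b) \<Rightarrow> bool" where
  "glin V W g \<longleftrightarrow> (\<forall>i. \<forall>v\<in>cmp V i. g i v \<in> cmp W i \<and> (\<forall>c. g i (scl V c v) = scl W c (g i v)) \<and>
     (\<forall>v'\<in>cmp V i. g i (v + v') = g i v + g i v'))"

definition strict_map :: "(int \<Rightarrow> 'a \<Rightarrow> 'b::zero) \<Rightarrow> nat \<Rightarrow> 'a word \<Rightarrow> 'b" where
  "strict_map g k w = (if k = 1 then g (fst (hd w)) (snd (hd w)) else 0)"

text \<open>Only the degree is shifted: the suspension sign is trivial in arity one.\<close>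

definition susp_map :: "(int \<Rightarrow> 'a \<Rightarrow> 'b) \<Rightarrow> int \<Rightarrow> 'a \<Rightarrow> 'b" where
  "susp_map g i = g (i - 1)"

lemma glin_susp: "glin V W g \<Longrightarrow> glin (susp V) (susp W) (susp_map g)"
  by (simp add: glin_def susp_map_def)

lemma lmap_words0: "glin V W g \<Longrightarrow> w \<in> words0 V \<Longrightarrow> lmap g w \<in> words0 W"
  by (induction w) (auto simp: glin_def)

text \<open>Splitting a word commutes with maps acting on letters, so compatibility with the
  comultiplication is an equality of formal combinations.\<close>

lemma coalgebra_morphism_lmap:
  fixes V :: "('k::field, 'a::ab_group_add) gvs" and W :: "('k, 'b::ab_group_add) gvs"
  assumes g: "glin V W g"
  shows "coalgebra_morphism V W (\<lambda>w. mon (lmap g w))"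
proof -
  note G = sym_rel_subspace(2)[of W]
  have "descends V psc (sym_rel W) (\<lambda>w. mon (lmap g w))"
  proof (rule descendsI, goal_cases)
    case (1 a b i v v')
    then show ?case
      using descendsD(1)[OF descends_mon lmap_words0[OF g 1(1)] lmap_words0[OF g 1(2)], of "g i v" i "g i v'"] g
      by (simp add: glin_def)
  next
    case (2 a b i c v)
    then show ?case
      using descendsD(2)[OF descends_mon lmap_words0[OF g 2(1)] lmap_words0[OF g 2(2)], of "g i v" i c] g
      by (simp add: glin_def)
  next
    case (3 a b i j v v')
    then show ?case
      using descendsD(3)[OF descends_mon lmap_words0[OF g 3(1)] lmap_words0[OF g 3(2)], of "g i v" i "g j v'" j] g
      by (simp add: glin_def)
  qed
  note resp = lin_sym_rel[OF sym_rel_subspace(1) this]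
  have words: "lmap g w \<in> words W" if "w \<in> words V" for w
    using that lmap_words0[OF g] by (auto simp: words_eq)
  have "lin comult (mon (lmap g w) :: 'b word \<Rightarrow>\<^sub>0 'k) = lin (\<lambda>(a, b). tens (mon (lmap g a)) (mon (lmap g b))) (comult w)" for w
    unfolding lin_comult lin_mon tens_mon prod.case by (simp add: comult_eq_unsh unsh_lmap)
  moreover have "\<exists>y. Poly_Mapping.keys y \<subseteq> {u \<in> words W. deg u = deg w + 0} \<and> mon (lmap g w) - y \<in> sym_rel W"
    if "w \<in> words V" for w
    using words[OF that] by (intro exI[of _ "mon (lmap g w)"]) (simp add: subgroup_of_0[OF G])
  ultimately show ?thesis
    unfolding coalgebra_morphism_def sym_map_def tens_eq_def sym_eq_def
    using words resp zero_tens_rel by simp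
qed

lemma has_components_lmap:
  assumes W: "graded_space W" and q: "\<And>w. w \<in> words V \<Longrightarrow> q w = strict_map g (length w) w"
  shows "has_components 0 V W (\<lambda>w. mon (lmap g w)) q"
proof -
  interpret graded W by unfold_locales (rule W)
  show ?thesis
    unfolding has_components_def
  proof (intro ballI ext)
    fix w i assume w: "w \<in> words V"
    show "proj1 W (mon (lmap g w)) i = (if i = deg w + 0 then q w else 0)"
    proof (cases "length w = 1")
      case True
      then obtain z where "w = [z]" by (auto simp: length_Suc_conv)
      then show ?thesis using q[OF w] by (auto simp: proj1_mon part1_def strict_map_def)
    qed (use q[OF w] in \<open>auto simp: proj1_mon part1_def strict_map_def\<close>)
  qed
qed

text \<open>\<open>cod\<close> is built from splittings and brackets alone, so a letterwise map that
  intertwines the brackets intertwines the coderivations exactly.\<close>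

lemma lin_lmap_cod:
  assumes q: "\<And>w. w \<in> words V \<Longrightarrow> q' (lmap g w) = g (deg w - 1) (q w)" and w: "w \<in> words V"
  shows "lin (\<lambda>w. mon (lmap g w)) (cod q w) = cod q' (lmap g w)"
  unfolding lin_cod unfolding cod_def unsh_lmap
proof (rule unsh_cong)
  fix u v assume "mset u + mset v = mset w"
  then have "u \<in> words0 V" using words0_split w by (auto simp: words_eq)
  then show "(if u = [] then 0 else mon (lmap g ((deg u - 1, q u) # v)))
      = (if lmap g u = [] then 0 else mon ((deg (lmap g u) - 1, q' (lmap g u)) # lmap g v))"
    using q[of u] by (simp add: words_eq)
qed

lemma suspended_strict_map:
  assumes "vector_space (scl W)"
  shows "suspended W (strict_map g) w = strict_map (susp_map g) (length w) w"
proof (cases "length w = 1")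
  case True
  then obtain z where "w = [z]" by (auto simp: length_Suc_conv)
  then show ?thesis by (simp add: suspended_eq[OF assms] strict_map_def susp_map_def)
qed (simp add: suspended_eq[OF assms] strict_map_def)

lemma skew_map_strict_map:
  assumes W: "graded_space W" and g: "glin V W g"
  shows "skew_map k (int k - 1) V W (strict_map g k)"
proof -
  interpret graded W by unfold_locales (rule W)
  show ?thesis
  proof (cases "k = 1")
    case True
    with g show ?thesis
      unfolding skew_map_def strict_map_def glin_def
      by (auto simp: words_def length_Suc_conv deg_def)
  qed (simp add: skew_map_def strict_map_def)
qed

lemma comorph_strict:
  assumes W: "graded_space W" and g: "glin V W g"
    and f: "\<And>w. w \<in> words (susp V) \<Longrightarrow> suspended W f w = strict_map (susp_map g) (length w) w"
  shows "comorph V W f (\<lambda>w. mon (lmap (susp_map g) w))"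
  unfolding comorph_def
  using coalgebra_morphism_lmap[OF glin_susp[OF g]] has_components_lmap[OF graded_susp[OF W] f] by blast

lemma Linf_morphism_strict_map:
  fixes L :: "('k::field_char_0, 'a::ab_group_add) gvs" and M :: "('k, 'b::ab_group_add) gvs"
  assumes L: "Linf_algebra L l" and M: "Linf_algebra M m" and g: "glin L M g"
    and lm: "\<And>w. w \<in> words (susp L) \<Longrightarrow>
      suspended M m (lmap (susp_map g) w) = g (deg w - 2) (suspended L l w)"
  shows "Linf_morphism L l M m (strict_map g)"
proof -
  interpret graded M by unfold_locales (rule Linf_algebra_graded[OF M])
  let ?F = "\<lambda>w. mon (lmap (susp_map g) w) :: 'b word \<Rightarrow>\<^sub>0 'k"
  have 1: "lin ?F (cod (suspended L l) w) - lin (cod (suspended M m)) (?F w) \<in> sym_rel (susp M)"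
    if "w \<in> words (susp L)" for w
  proof -
    have "lin ?F (cod (suspended L l) w) = cod (suspended M m) (lmap (susp_map g) w)"
      by (rule lin_lmap_cod[of "susp L"]) (use lm that in \<open>simp_all add: susp_map_def\<close>)
    then show ?thesis by (simp add: zero_sym_rel)
  qed
  have "comorph L M (strict_map g) ?F"
    by (intro comorph_strict g suspended_strict_map graded_space vector_space_axioms)
  with 1 codiff_cod[OF L] codiff_cod[OF M] skew_map_strict_map[OF graded_space g] show ?thesis
    unfolding Linf_morphism_def sym_eq_def by blast
qed

lemma strict_on_suspended:
  assumes "vector_space (scl W)" "strict_on L f" "w \<in> words (susp L)"
  shows "suspended W f w = strict_map (susp_map (\<lambda>i v. f 1 [(i, v)])) (length w) w"
proof (cases "length w = 1")
  case True
  then obtain z where "w = [z]" by (auto simp: length_Suc_conv)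
  then show ?thesis by (simp add: suspended_eq[OF assms(1)] strict_map_def susp_map_def)
next
  case False
  then have "length w \<ge> 2" "shift (- 1) w \<in> words L"
    using assms(3) by (cases w; simp add: words_eq Suc_le_eq)+
  with assms(2) False show ?thesis
    by (simp add: suspended_eq[OF assms(1)] strict_map_def strict_on_def)
qed

lemma glin_morphism:
  assumes "skew_map 1 0 L L' (f 1)"
  shows "glin L L' (\<lambda>i v. f 1 [(i, v)])"
  unfolding glin_def
proof (intro allI ballI conjI, goal_cases)
  case (1 i v)
  then show ?case using skew_mapD(1)[OF assms, of "[(i, v)]"] by simp
next
  case (2 i v c)
  then show ?case using skew_mapD(3)[OF assms, of "[]" "[]" v i c] by simp
next
  case (3 i v v')
  then show ?case using skew_mapD(2)[OF assms, of "[]" "[]" v i v'] by simp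
qed

text \<open>Extracts an exact identity of brackets from a congruence between coalgebra maps.
  \<open>F\<close>, \<open>\<delta>\<close> and \<open>\<delta>'\<close> are traded for their
  canonical representatives, each exchange costing a relation, and the linear parts of the result
  are compared.\<close>

lemma strict_Linf_morphism:
  fixes L :: "('k::field_char_0, 'a::ab_group_add) gvs" and L' :: "('k, 'b::ab_group_add) gvs"
  assumes L: "Linf_algebra L l" and L': "Linf_algebra L' l'"
    and f: "Linf_morphism L l L' l' f" and st: "strict_on L f"
  defines "g \<equiv> \<lambda>i v. f 1 [(i, v)]"
  assumes w: "w \<in> words (susp L)"
  shows "suspended L' l' (lmap (susp_map g) w) = g (deg w - 2) (suspended L l w)"
proof -
  interpret V: graded "susp L" by unfold_locales (intro graded_susp Linf_algebra_graded[OF L])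
  interpret W: graded "susp L'" by unfold_locales (intro graded_susp Linf_algebra_graded[OF L'])
  note G = sym_rel_subspace(2)[of "susp L'"]
  note q = Linf_algebra_symop[OF L] and q' = Linf_algebra_symop[OF L']
  let ?d = "cod (suspended L l)" and ?d' = "cod (suspended L' l')"
  let ?F = "\<lambda>w. mon (lmap (susp_map g) w) :: 'b word \<Rightarrow>\<^sub>0 'k"
  have "skew_map 1 0 L L' (f 1)"
    using f unfolding Linf_morphism_def by (metis diff_self le_refl of_nat_1)
  then have g: "glin L L' g" unfolding g_def by (rule glin_morphism)
  obtain \<delta> \<delta>' F where *: "codiff L l \<delta>" "codiff L' l' \<delta>'" "comorph L L' f F"
    and eq: "\<And>w. w \<in> words (susp L) \<Longrightarrow> lin F (\<delta> w) - lin \<delta>' (F w) \<in> sym_rel (susp L')"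
    using f by (auto simp: Linf_morphism_def sym_eq_def)
  have "comorph L L' f ?F"
    using strict_on_suspended[OF _ st] W.vector_space_axioms unfolding g_def
    by (intro comorph_strict Linf_algebra_graded[OF L'] g[unfolded g_def]) auto
  with *(3) have F: "F w - ?F w \<in> sym_rel (susp L')" if "w \<in> words (susp L)" for w
    using that W.graded_space unfolding comorph_def by (auto intro: coalgebra_morphism_unique)
  have respF: "lin F r \<in> sym_rel (susp L')" if "r \<in> sym_rel (susp L)" for r
    using *(3) that by (auto simp: comorph_def coalgebra_morphism_def sym_map_def)
  have resp': "lin \<delta>' r \<in> sym_rel (susp L')" if "r \<in> sym_rel (susp L')" for r
    using *(2) that by (auto simp: codiff_def coderivation_def sym_map_def)
  have gw: "lmap (susp_map g) w \<in> words (susp L')"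
    using w lmap_words0[OF glin_susp[OF g]] by (auto simp: words_eq)
  have 1: "lin F (\<delta> w - ?d w) \<in> sym_rel (susp L')"
    by (intro respF codiff_unique L * w)
  have 2: "lin (\<lambda>v. F v - ?F v) (?d w) \<in> sym_rel (susp L')"
    by (rule free_spaceI_subspace[OF V.cod_free[OF q w] sym_rel_subspace(1) F])
  have 3: "lin \<delta>' (F w - ?F w) \<in> sym_rel (susp L')"
    by (intro resp' F w)
  have 4: "\<delta>' (lmap (susp_map g) w) - ?d' (lmap (susp_map g) w) \<in> sym_rel (susp L')"
    by (intro codiff_unique L' * gw)
  have "(lin F (\<delta> w) - lin \<delta>' (F w)) - lin F (\<delta> w - ?d w) - lin (\<lambda>v. F v - ?F v) (?d w)
      + lin \<delta>' (F w - ?F w) + (\<delta>' (lmap (susp_map g) w) - ?d' (lmap (susp_map g) w)) \<in> sym_rel (susp L')"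
    by (intro subgroup_of_add[OF G] subgroup_of_diff[OF G eq[OF w]] subgroup_of_diff[OF G] eq 1 2 3 4 w)
  then have 5: "lin ?F (?d w) - ?d' (lmap (susp_map g) w) \<in> sym_rel (susp L')"
    by (simp add: lin_diff lin_fun_diff algebra_simps)
  have "proj1 (susp L') (lin ?F (?d w)) (deg w - 1) = proj1 (susp L') (?d' (lmap (susp_map g) w)) (deg w - 1)"
    using W.proj1_sym_rel[OF 5, of "deg w - 1"] by (simp add: W.proj1_diff)
  also have "proj1 (susp L') (?d' (lmap (susp_map g) w)) (deg w - 1) = suspended L' l' (lmap (susp_map g) w)"
    using W.has_components_cod[of "suspended L' l'"] gw by (simp add: has_components_def)
  \<comment> \<open>A term has length one only if no letter is left beside the bracket.\<close>
  also have "proj1 (susp L') (lin ?F (?d w)) (deg w - 1)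
      = unsh (\<lambda>u v. if v = [] then if u = [] then 0 else g (deg w - 2) (suspended L l u) else 0) w"
    unfolding lin_cod W.proj1_unsh
  proof (rule unsh_cong)
    fix u v assume "mset u + mset v = mset w"
    from mset_split(1)[OF this]
    show "proj1 (susp L') (if u = [] then 0 else ?F ((deg u - 1, suspended L l u) # v)) (deg w - 1)
        = (if v = [] then if u = [] then 0 else g (deg w - 2) (suspended L l u) else 0)"
      by (auto simp: W.proj1_mon W.proj1_0 W.part1_def susp_map_def)
  qed
  also have "\<dots> = g (deg w - 2) (suspended L l w)"
    using w by (subst unsh_right_Nil) (auto simp: words_eq)
  finally show ?thesis by simp
qed

section \<open>Polynomials with vector coefficients\<close>

text \<open>Coefficients are vectors without a product, so the scalar action is passed explicitly to
  evaluation, derivative and antiderivative.\<close>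

definition pev :: "('k::comm_ring_1 \<Rightarrow> 'b \<Rightarrow> 'b) \<Rightarrow> 'k \<Rightarrow> 'b poly \<Rightarrow> 'b::ab_group_add" where
  "pev s c p = (\<Sum>n\<le>degree p. s (c ^ n) (coeff p n))"

definition pder :: "('k::comm_ring_1 \<Rightarrow> 'b \<Rightarrow> 'b) \<Rightarrow> 'b poly \<Rightarrow> 'b::ab_group_add poly" where
  "pder s p = Poly (map (\<lambda>n. s (of_nat (Suc n)) (coeff p (Suc n))) [0..<degree p])"

definition pint :: "('k::field \<Rightarrow> 'b \<Rightarrow> 'b) \<Rightarrow> 'b poly \<Rightarrow> 'b::ab_group_add poly" where
  "pint s p = pCons 0 (Poly (map (\<lambda>n. s (inverse (of_nat (Suc n))) (coeff p n)) [0..<Suc (degree p)]))"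

definition poly_space :: "('k, 'b::ab_group_add) gvs \<Rightarrow> ('k, 'b poly) gvs" where
  "poly_space V = \<lparr>scl = (\<lambda>c. map_poly (scl V c)), cmp = (\<lambda>i. {p. \<forall>n. coeff p n \<in> cmp V i})\<rparr>"

lemma poly_space_simps [simp]:
  "scl (poly_space V) c = map_poly (scl V c)"
  "p \<in> cmp (poly_space V) i \<longleftrightarrow> (\<forall>n. coeff p n \<in> cmp V i)"
  by (simp_all add: poly_space_def)

lemma coeff_shift: "coeff ((pCons 0 ^^ k) p) n = (if n < k then 0 else coeff p (n - k))"
  by (induction k arbitrary: n) (auto simp: coeff_pCons split: nat.split)

locale char0_space = vector_space scale for scale :: "'k::field_char_0 \<Rightarrow> 'b::ab_group_add \<Rightarrow> 'b"
begin

abbreviation (input) "ev \<equiv> pev scale"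
abbreviation (input) "dv \<equiv> pder scale"
abbreviation (input) "iv \<equiv> pint scale"

lemma coeff_pscl [simp]: "coeff (map_poly (scale c) p) n = scale c (coeff p n)"
  by (simp add: coeff_map_poly)

lemma coeff_pder [simp]: "coeff (dv p) n = scale (of_nat (Suc n)) (coeff p (Suc n))"
  by (simp add: pder_def nth_default_def coeff_eq_0 del: of_nat_Suc)

lemma coeff_pint: "coeff (iv p) n = (case n of 0 \<Rightarrow> 0 | Suc m \<Rightarrow> scale (inverse (of_nat (Suc m))) (coeff p m))"
  by (auto simp: pint_def coeff_pCons nth_default_def coeff_eq_0 simp del: of_nat_Suc upt_Suc split: nat.split)

lemma pev_superset: "degree p \<le> N \<Longrightarrow> ev c p = (\<Sum>n\<le>N. scale (c ^ n) (coeff p n))"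
  unfolding pev_def by (rule sum.mono_neutral_left) (auto simp: coeff_eq_0)

lemma pev_add: "ev c (p + q) = ev c p + ev c q"
proof -
  let ?N = "max (degree p) (degree q)"
  have "degree (p + q) \<le> ?N" by (rule degree_add_le_max)
  then show ?thesis by (simp add: pev_superset[of _ ?N] scale_right_distrib sum.distrib)
qed

lemma pev_0 [simp]: "ev c 0 = 0"
  by (simp add: pev_def)

lemma pev_uminus: "ev c (- p) = - ev c p"
  using pev_add[of c p "- p"] by (simp add: add_eq_0_iff2)

lemma pev_diff: "ev c (p - q) = ev c p - ev c q"
  using pev_add[of c p "- q"] by (simp add: pev_uminus)

lemma pev_sg: "ev c (sg d p) = sg d (ev c p)"
  by (simp add: sg_def pev_uminus)

lemma pev_sum: "ev c (sum f I) = (\<Sum>i\<in>I. ev c (f i))"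
  by (induction I rule: infinite_finite_induct) (simp_all add: pev_add)

lemma pev_pscl: "ev c (map_poly (scale k) p) = scale k (ev c p)"
proof -
  have "degree (map_poly (scale k) p) \<le> degree p" by (rule degree_le) (simp add: coeff_eq_0)
  then show ?thesis
    by (simp add: pev_superset[of _ "degree p"] scale_sum_right mult.commute)
qed

lemma pev_const [simp]: "ev c [:a:] = a"
  by (simp add: pev_def)

lemma pev_at_0: "ev 0 p = coeff p 0"
  unfolding pev_def by (subst sum.atMost_shift) simp

lemma pev_shift1: "ev c (pCons 0 p) = scale c (ev c p)"
proof (cases "p = 0")
  case False
  then show ?thesis
    by (simp add: pev_def sum.atMost_Suc_shift scale_sum_right del: sum.atMost_Suc)
qed simp

lemma pev_shift: "ev c ((pCons 0 ^^ n) p) = scale (c ^ n) (ev c p)"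
  by (induction n) (simp_all add: pev_shift1)

lemma pev_mem: "subspace S \<Longrightarrow> (\<And>n. coeff p n \<in> S) \<Longrightarrow> ev c p \<in> S"
  unfolding pev_def by (intro subspace_sum subspace_scale)

text \<open>Replacing \<open>c\<close> by \<open>2c\<close> and subtracting a multiple removes the top coefficient.\<close>

lemma vanishing_coeffs:
  assumes "\<And>c. (\<Sum>n\<le>N. scale (c ^ n) (a n)) = 0" "n \<le> N"
  shows "a n = 0"
  using assms
proof (induction N arbitrary: a n)
  case 0
  then show ?case using "0.prems"(1)[of 1] by simp
next
  case (Suc N)
  have "(\<Sum>n\<le>N. scale (c ^ n) (scale (2 ^ n - 2 ^ Suc N) (a n))) = 0" for c
  proof -
    have "(\<Sum>n\<le>Suc N. scale ((2 * c) ^ n) (a n)) - scale (2 ^ Suc N) (\<Sum>n\<le>Suc N. scale (c ^ n) (a n))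
        = (\<Sum>n\<le>Suc N. scale (c ^ n) (scale (2 ^ n - 2 ^ Suc N) (a n)))"
      unfolding scale_sum_right sum_subtractf[symmetric]
      by (intro sum.cong refl) (simp add: power_mult_distrib algebra_simps scale_left_diff_distrib del: power_Suc)
    then show ?thesis using Suc.prems(1)[of "2 * c"] Suc.prems(1)[of c] by simp
  qed
  then have "scale (2 ^ n - 2 ^ Suc N) (a n) = 0" if "n \<le> N" for n
    using Suc.IH[of "\<lambda>n. scale (2 ^ n - 2 ^ Suc N) (a n)" n] that by blast
  moreover have "(2::'k) ^ n \<noteq> 2 ^ Suc N" if "n \<le> N" for n
  proof -
    have "(2::nat) ^ n < 2 ^ Suc N" using that by (intro power_strict_increasing) auto
    then have "of_nat (2 ^ n) \<noteq> (of_nat (2 ^ Suc N) :: 'k)" by (simp only: of_nat_eq_iff)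
    then show ?thesis by simp
  qed
  ultimately have low: "a n = 0" if "n \<le> N" for n
    using that by (metis eq_iff_diff_eq_0 scale_eq_0_iff)
  moreover have "a (Suc N) = 0"
    using Suc.prems(1)[of 1] low by simp
  ultimately show ?case using Suc.prems(2) by (auto simp: le_Suc_eq)
qed

text \<open>A field of characteristic zero is infinite, so a polynomial is determined by its values.
  This justifies the pointwise verification of bracket identities.\<close>

lemma pev_eq_0: "(\<And>c. ev c p = 0) \<Longrightarrow> p = 0"
  using vanishing_coeffs[where N = "degree p" and a = "coeff p" and n = "degree p"] by (simp add: pev_def)

lemma pev_ext: "(\<And>c. ev c p = ev c q) \<Longrightarrow> p = q"
  using pev_eq_0[of "p - q"] by (simp add: pev_diff)

lemma pder_add: "dv (p + q) = dv p + dv q"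
  by (rule poly_eqI) (simp add: scale_right_distrib)

lemma pder_0 [simp]: "dv 0 = 0"
  by (rule poly_eqI) simp

lemma pder_const [simp]: "dv [:a:] = 0"
  by (rule poly_eqI) simp

lemma pder_sum: "dv (sum f I) = (\<Sum>i\<in>I. dv (f i))"
  by (induction I rule: infinite_finite_induct) (simp_all add: pder_add)

lemma pder_diff: "dv (p - q) = dv p - dv q"
  by (rule poly_eqI) (simp add: scale_right_diff_distrib)

lemma pder_sg: "dv (sg d p) = sg d (dv p)"
  by (rule sg_hom) (rule pder_add)

lemma pder_pscl: "dv (map_poly (scale c) p) = map_poly (scale c) (dv p)"
  by (rule poly_eqI) (simp add: mult.commute)

lemma pder_shift1: "dv (pCons 0 p) = p + pCons 0 (dv p)"
  by (rule poly_eqI) (auto simp: coeff_pCons scale_left_distrib split: nat.split)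

text \<open>Product rule for \<open>t ^ n\<close> times \<open>p\<close>. For \<open>n = 0\<close>
  the truncated exponent \<open>n - 1\<close> is harmless, since the factor \<open>of_nat n\<close>
  vanishes.\<close>

lemma pev_pder_shift:
  "ev c (dv ((pCons 0 ^^ n) p))
     = scale (of_nat n * c ^ (n - 1)) (ev c p) + scale (c ^ n) (ev c (dv p))"
proof (induction n)
  case (Suc n)
  have "of_nat n * c ^ (n - 1) * c = of_nat n * c ^ n"
    by (cases n) simp_all
  then show ?case
    using Suc by (simp add: pder_shift1 pev_add pev_shift1 pev_shift scale_right_distrib scale_left_distrib
        mult.commute mult.left_commute algebra_simps)
qed simp

lemma pev_pder: "ev c (dv p) = (\<Sum>n\<le>degree p. scale (of_nat n * c ^ (n - 1)) (coeff p n))"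
proof -
  let ?f = "\<lambda>n. scale (of_nat n * c ^ (n - 1)) (coeff p n)"
  have "degree (dv p) \<le> degree p"
    by (rule degree_le) (simp add: coeff_eq_0)
  then have "ev c (dv p) = (\<Sum>n\<le>degree p. ?f (Suc n))"
    by (simp add: pev_superset[of _ "degree p"] mult.commute)
  also have "\<dots> = (\<Sum>n\<le>Suc (degree p). ?f n)"
    by (subst sum.atMost_Suc_shift) simp
  also have "\<dots> = (\<Sum>n\<le>degree p. ?f n)"
    by (simp add: coeff_eq_0)
  finally show ?thesis .
qed

lemma pder_pint: "dv (iv p) = p"
  by (rule poly_eqI) (simp add: coeff_pint del: of_nat_Suc)

lemma pev_0_pint: "ev 0 (iv p) = 0"
  by (simp add: pev_at_0 coeff_pint)

text \<open>Coefficients of positive index are recovered from the derivative by dividing by the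
  index. In the contraction a polynomial is identified by its derivative and its value at 0.\<close>

lemma pder_eq_0: "dv p = 0 \<Longrightarrow> ev 0 p = 0 \<Longrightarrow> p = 0"
proof (rule poly_eqI)
  fix n assume p: "dv p = 0" "ev 0 p = 0"
  show "coeff p n = coeff 0 n"
  proof (cases n)
    case (Suc m)
    have "scale (of_nat (Suc m)) (coeff p (Suc m)) = 0"
      using coeff_pder[of p m] p(1) by simp
    then show ?thesis using Suc by (simp del: of_nat_Suc)
  qed (use p(2) in \<open>simp add: pev_at_0\<close>)
qed

lemma coeffs_mem:
  assumes S: "subspace S"
  shows "(\<And>n. coeff p n \<in> S) \<Longrightarrow> coeff (dv p) n \<in> S"
    and "(\<And>n. coeff p n \<in> S) \<Longrightarrow> coeff (iv p) n \<in> S"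
    and "(\<And>n. coeff p n \<in> S) \<Longrightarrow> coeff (sg d p) n \<in> S"
  using S by (auto simp: coeff_pint subspace_0 subspace_scale subspace_neg sg_def split: nat.split)

end


section \<open>Multilinear extension to polynomials\<close>

text \<open>The function \<open>g\<close> on words is read as multilinear and extended to polynomial coefficients.\<close>

fun pext :: "('b word \<Rightarrow> 'c) \<Rightarrow> 'b::zero poly word \<Rightarrow> 'c::comm_monoid_add poly" where
  "pext g [] = [:g []:]"
| "pext g (z # w) = (\<Sum>n\<le>degree (snd z). (pCons 0 ^^ n) (pext (\<lambda>u. g ((fst z, coeff (snd z) n) # u)) w))"

text \<open>
  The sum over all positions of \<open>w\<close> of \<open>\<phi>\<close> applied to the word in which that letter is replaced by its
  image under \<open>e1\<close>, a map of degree \<open>s\<close> acting from the right, and all others by their image under \<open>e0\<close>.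
\<close>

fun ssum :: "int \<Rightarrow> (int \<Rightarrow> 'x \<Rightarrow> 'y) \<Rightarrow> (int \<Rightarrow> 'x \<Rightarrow> 'y) \<Rightarrow> ('y word \<Rightarrow> 'c) \<Rightarrow> 'x word \<Rightarrow> 'c::ab_group_add" where
  "ssum s e0 e1 \<phi> [] = 0"
| "ssum s e0 e1 \<phi> (z # w) = sg (s * deg w) (\<phi> ((fst z + s, e1 (fst z) (snd z)) # lmap e0 w))
     + ssum s e0 e1 (\<lambda>u. \<phi> ((fst z, e0 (fst z) (snd z)) # u)) w"

section \<open>Calculus of sums over one distinguished letter\<close>

text \<open>In the application \<open>h\<close> is a bracket with one open slot, which is additive
  on a single homogeneous component; \<open>S\<close> is that component.\<close>

lemma ssum_hom_on:
  assumes S: "subgroup_of S" and h: "\<And>x y. x \<in> S \<Longrightarrow> y \<in> S \<Longrightarrow> h (x + y) = h x + h y"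
    and \<phi>: "\<And>u. deg u = deg w + s \<Longrightarrow> u \<noteq> [] \<Longrightarrow> u \<in> words0 V \<Longrightarrow> \<phi> u \<in> S"
    and e: "\<And>z. z \<in> set w \<Longrightarrow> e0 (fst z) (snd z) \<in> cmp V (fst z)"
      "\<And>z. z \<in> set w \<Longrightarrow> e1 (fst z) (snd z) \<in> cmp V (fst z + s)"
  shows "ssum s e0 e1 \<phi> w \<in> S \<and> h (ssum s e0 e1 \<phi> w) = ssum s e0 e1 (\<lambda>u. h (\<phi> u)) w"
proof -
  have h0: "h 0 = 0" using h[of 0 0] subgroup_of_0[OF S] by simp
  have hm: "h (- x) = - h x" if "x \<in> S" for x
    using h[of x "- x"] that h0 subgroup_of_uminus[OF S] by (simp add: add_eq_0_iff2)
  have hs: "h (sg d x) = sg d (h x)" if "x \<in> S" for d x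
    using that hm by (simp add: sg_def)
  show ?thesis
    using \<phi> e
  proof (induction w arbitrary: \<phi>)
    case Nil
    then show ?case by (simp add: h0 subgroup_of_0[OF S])
  next
    case (Cons z w)
    let ?x = "\<phi> ((fst z + s, e1 (fst z) (snd z)) # lmap e0 w)"
    have w0: "lmap e0 w \<in> words0 V"
      using Cons.prems(2) by (auto simp: words0_def lmap_def)
    have 1: "?x \<in> S"
      using Cons.prems(2)[of z] Cons.prems(3)[of z] w0 by (intro Cons.prems(1)) auto
    have "ssum s e0 e1 (\<lambda>u. \<phi> ((fst z, e0 (fst z) (snd z)) # u)) w \<in> S \<and>
      h (ssum s e0 e1 (\<lambda>u. \<phi> ((fst z, e0 (fst z) (snd z)) # u)) w)
        = ssum s e0 e1 (\<lambda>u. h (\<phi> ((fst z, e0 (fst z) (snd z)) # u))) w"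
      using Cons.prems(2,3) by (intro Cons.IH Cons.prems(1)) auto
    with 1 show ?case
      using h hs subgroup_of_add[OF S] subgroup_of_sg[OF S] by simp
  qed
qed

lemmas ssum_mem = ssum_hom_on[where h = "\<lambda>x. x", OF _ refl, THEN conjunct1]

lemma ssum_hom:
  assumes "\<And>x y. h (x + y) = h x + h y"
  shows "h (ssum s e0 e1 \<phi> w) = ssum s e0 e1 (\<lambda>u. h (\<phi> u)) w"
proof (induction w arbitrary: \<phi>)
  case Nil
  then show ?case using assms[of 0 0] by simp
qed (simp add: assms sg_hom[of h])

lemma ssum_add: "ssum s e0 e1 (\<lambda>u. \<phi> u + \<psi> u) w = ssum s e0 e1 \<phi> w + ssum s e0 e1 \<psi> w"
  by (induction w arbitrary: \<phi> \<psi>) (simp_all add: sg_add algebra_simps)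

lemma ssum_0 [simp]: "ssum s e0 e1 (\<lambda>u. 0) w = 0"
  using ssum_add[of s e0 e1 "\<lambda>u. 0" "\<lambda>u. 0" w] by simp

lemma ssum_sg: "ssum s e0 e1 (\<lambda>u. sg d (\<phi> u)) w = sg d (ssum s e0 e1 \<phi> w)"
  by (rule ssum_hom[symmetric]) (rule sg_add)

lemma ssum_sum: "ssum s e0 e1 (\<lambda>u. \<Sum>i\<in>I. \<phi> i u) w = (\<Sum>i\<in>I. ssum s e0 e1 (\<phi> i) w)"
  by (induction I rule: infinite_finite_induct) (simp_all add: ssum_add)

lemma ssum_cong:
  assumes "\<And>u. deg u = deg w + s \<Longrightarrow> u \<noteq> [] \<Longrightarrow> u \<in> words0 V \<Longrightarrow> \<phi> u = \<psi> u"
    and "\<And>z. z \<in> set w \<Longrightarrow> e0 (fst z) (snd z) \<in> cmp V (fst z)"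
      "\<And>z. z \<in> set w \<Longrightarrow> e1 (fst z) (snd z) \<in> cmp V (fst z + s)"
  shows "ssum s e0 e1 \<phi> w = ssum s e0 e1 \<psi> w"
proof -
  have "ssum s e0 e1 (\<lambda>u. \<phi> u + - \<psi> u) w \<in> {0}"
    using assms by (intro ssum_mem[where V = V]) auto
  moreover have "ssum s e0 e1 (\<lambda>u. - \<psi> u) w = - ssum s e0 e1 \<psi> w"
    by (rule ssum_hom[symmetric]) simp
  ultimately have "ssum s e0 e1 \<phi> w + - ssum s e0 e1 \<psi> w = 0"
    by (simp only: ssum_add singleton_iff)
  then show ?thesis by simp
qed

lemma ssum_deg_cong:
  assumes "\<And>u. deg u = deg w + s \<Longrightarrow> \<phi> u = \<psi> u"
  shows "ssum s e0 e1 \<phi> w = ssum s e0 e1 \<psi> w"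
  \<comment> \<open>With every component equal to \<open>UNIV\<close> the conditions on letters hold
    trivially, and only the degree of \<open>u\<close> is used.\<close>
  by (rule ssum_cong[where V = "\<lparr>scl = undefined, cmp = \<lambda>_. UNIV\<rparr>"]) (auto intro: assms)

lemma ssum_lmap:
  "ssum s e0 e1 (\<lambda>u. \<phi> (lmap h u)) w = ssum s (\<lambda>i x. h i (e0 i x)) (\<lambda>i x. h (i + s) (e1 i x)) \<phi> w"
  by (induction w arbitrary: \<phi>) (simp_all add: lmap_comp)

text \<open>The operation behaves like a derivation with respect to splittings: the replaced letter
  lies in \<open>u\<close>, where the operator coming from the right has first passed
  \<open>v\<close>, or it lies in \<open>v\<close>.\<close>

lemma ssum_unsh:
  "ssum s e0 e1 (unsh \<chi>) w = unsh (\<lambda>u v. sg (s * deg v) (ssum s e0 e1 (\<lambda>u'. \<chi> u' (lmap e0 v)) u)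
     + ssum s e0 e1 (\<lambda>v'. \<chi> (lmap e0 u) v') v) w"
proof (induction w arbitrary: \<chi>)
  case Nil
  then show ?case by simp
next
  case (Cons z w)
  let ?z0 = "(fst z, e0 (fst z) (snd z))" and ?z1 = "(fst z + s, e1 (fst z) (snd z))"
  let ?S = "ssum s e0 e1"
  have l1: "sg (s * deg w) (unsh \<chi> (?z1 # lmap e0 w))
      = unsh (\<lambda>u v. sg (s * deg v + s * deg u) (\<chi> (?z1 # lmap e0 u) (lmap e0 v))) w
      + unsh (\<lambda>u v. sg (fst z * deg u + s * deg v) (\<chi> (lmap e0 u) (?z1 # lmap e0 v))) w"
    unfolding unsh.simps unsh_lmap sg_add unsh_sg[symmetric]
    by (intro arg_cong2[of _ _ _ _ "(+)"] unsh_cong)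
       (auto simp: mset_split(1) algebra_simps intro!: sg_parity)
  have l2: "?S (unsh (\<lambda>u v. \<chi> (?z0 # u) v)) w
      = unsh (\<lambda>u v. sg (s * deg v) (?S (\<lambda>u'. \<chi> (?z0 # u') (lmap e0 v)) u)) w
      + unsh (\<lambda>u v. ?S (\<lambda>v'. \<chi> (?z0 # lmap e0 u) v') v) w"
    by (simp add: Cons.IH unsh_add)
  have "?S (\<lambda>u'. sg (fst z * deg u') (\<chi> u' (?z0 # lmap e0 v))) u
      = sg (fst z * (deg u + s)) (?S (\<lambda>u'. \<chi> u' (?z0 # lmap e0 v)) u)" for u v
    unfolding ssum_sg[symmetric] by (rule ssum_deg_cong) simp
  then have l3: "?S (unsh (\<lambda>u v. sg (fst z * deg u) (\<chi> u (?z0 # v)))) w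
      = unsh (\<lambda>u v. sg (fst z * deg u + (s * fst z + s * deg v)) (?S (\<lambda>u'. \<chi> u' (?z0 # lmap e0 v)) u)) w
      + unsh (\<lambda>u v. sg (fst z * deg u) (?S (\<lambda>v'. \<chi> (lmap e0 u) (?z0 # v')) v)) w"
    by (simp add: Cons.IH unsh_add ssum_sg algebra_simps)
  have "?S (unsh \<chi>) (z # w) = sg (s * deg w) (unsh \<chi> (?z1 # lmap e0 w))
      + (?S (unsh (\<lambda>u v. \<chi> (?z0 # u) v)) w + ?S (unsh (\<lambda>u v. sg (fst z * deg u) (\<chi> u (?z0 # v)))) w)"
    by (simp add: ssum_add)
  then show ?case
    unfolding l1 l2 l3 by (simp add: unsh_add sg_add distrib_left algebra_simps)
qed

section \<open>Compatibility of these sums with the relations\<close>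

text \<open>Linear maps of degree \<open>s\<close> are treated as degree-zero maps into a reindexed
  target, so that the facts about \<open>glin\<close> serve both.\<close>

abbreviation glins :: "int \<Rightarrow> ('k, 'a::ab_group_add) gvs \<Rightarrow> ('k, 'b::ab_group_add) gvs \<Rightarrow> (int \<Rightarrow> 'a \<Rightarrow> 'b) \<Rightarrow> bool" where
  "glins s V W \<equiv> glin V (W\<lparr>cmp := (\<lambda>i. cmp W (i + s))\<rparr>)"

lemma glinD:
  assumes "glin V W g" "v \<in> cmp V i"
  shows "g i v \<in> cmp W i" "g i (scl V c v) = scl W c (g i v)"
    "v' \<in> cmp V i \<Longrightarrow> g i (v + v') = g i v + g i v'"
  using assms by (auto simp: glin_def)

lemma descends_cong:
  assumes "\<And>w. w \<in> words0 V \<Longrightarrow> w \<noteq> [] \<Longrightarrow> \<Phi> w = \<Psi> w" "graded_space V" "descends V s K \<Psi>"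
  shows "descends V s K \<Phi>"
proof -
  interpret graded V by unfold_locales (rule assms(2))
  show ?thesis
    by (rule descendsI; use descendsD[OF assms(3)] in \<open>simp add: assms(1)\<close>)
qed

lemma descends_lmap:
  assumes e: "glin N V e" and \<phi>: "descends V s {0} \<phi>"
  shows "descends N s {0} (\<lambda>w. \<phi> (lmap e w))"
proof (rule descends0I, goal_cases)
  case (1 a b i v v')
  then show ?case
    using descends0D(1)[OF \<phi> lmap_words0[OF e 1(1)] lmap_words0[OF e 1(2)], of "e i v" i "e i v'"] glinD[OF e]
    by simp
next
  case (2 a b i c v)
  then show ?case
    using descends0D(2)[OF \<phi> lmap_words0[OF e 2(1)] lmap_words0[OF e 2(2)], of "e i v" i c] glinD[OF e]
    by simp
next
  case (3 a b i j v v')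
  then show ?case
    using descends0D(3)[OF \<phi> lmap_words0[OF e 3(1)] lmap_words0[OF e 3(2)], of "e i v" i "e j v'" j] glinD[OF e]
    by simp
qed

context vector_space
begin

lemma descends0_add:
  assumes "descends V scale {0} \<phi>" "descends V scale {0} \<psi>"
  shows "descends V scale {0} (\<lambda>w. \<phi> w + \<psi> w)"
proof (rule descends0I, goal_cases)
  case (1 a b i v v')
  show ?case using descends0D(1)[OF assms(1) 1] descends0D(1)[OF assms(2) 1] by simp
next
  case (2 a b i c v)
  show ?case using descends0D(2)[OF assms(1) 2] descends0D(2)[OF assms(2) 2] by (simp add: scale_right_distrib)
next
  case (3 a b i j v v')
  show ?case using descends0D(3)[OF assms(1) 3] descends0D(3)[OF assms(2) 3] by (simp add: sg_add)
qed

text \<open>Peeling off a letter leaves the class of functions \<open>ssum\<close>: the first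
  summand of the recursion is a function of the remaining word that already descends. Hence the
  class \<open>?X\<close> also contains all functions that descend.\<close>

lemma descends_ssum:
  assumes e0: "glin N V e0" and e1: "glins s N V e1" and \<phi>: "descends V scale {0} \<phi>"
  shows "descends N scale {0} (ssum s e0 e1 \<phi>)"
proof -
  note D = descends0D
  have letters: "z \<in> set w \<Longrightarrow> e0 (fst z) (snd z) \<in> cmp V (fst z)"
    "z \<in> set w \<Longrightarrow> e1 (fst z) (snd z) \<in> cmp V (fst z + s)" if "w \<in> words0 N" for w z
    using that glinD(1)[OF e0] glinD(1)[OF e1] by (fastforce simp: words0_def)+
  note cong = ssum_cong[where V = V, OF _ letters]
  let ?X = "ssum s e0 e1 ` {\<phi>. descends V scale {0} \<phi>} \<union> {\<Psi>. descends N scale {0} \<Psi>}"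
  have head: "descends_head N scale {0} (ssum s e0 e1 \<phi>)" if "descends V scale {0} \<phi>" for \<phi>
    unfolding descends_head_def singleton_iff diff_diff_eq right_minus_eq
  proof (intro conjI allI impI; elim conjE)
    fix b i v v' assume b: "b \<in> words0 N" and v: "v \<in> cmp N i" "v' \<in> cmp N i"
    have "ssum s e0 e1 (\<lambda>u. \<phi> ((i, e0 i (v + v')) # u)) b
        = ssum s e0 e1 (\<lambda>u. \<phi> ((i, e0 i v) # u) + \<phi> ((i, e0 i v') # u)) b"
      using D(1)[OF that, of "[]" _ "e0 i v" i "e0 i v'"] glinD[OF e0 v(1)] glinD[OF e0 v(2)] v b
      by (intro cong) auto
    moreover have "\<phi> ((i + s, e1 i (v + v')) # lmap e0 b)
        = \<phi> ((i + s, e1 i v) # lmap e0 b) + \<phi> ((i + s, e1 i v') # lmap e0 b)"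
      using D(1)[OF that, of "[]" "lmap e0 b" "e1 i v" "i + s" "e1 i v'"]
        glinD[OF e1 v(1)] glinD[OF e1 v(2)] v lmap_words0[OF e0 b] by simp
    ultimately show "ssum s e0 e1 \<phi> ((i, v + v') # b) = ssum s e0 e1 \<phi> ((i, v) # b) + ssum s e0 e1 \<phi> ((i, v') # b)"
      by (simp add: ssum_add sg_add)
  next
    fix b i c v assume b: "b \<in> words0 N" and v: "v \<in> cmp N i"
    have "ssum s e0 e1 (\<lambda>u. \<phi> ((i, e0 i (scl N c v)) # u)) b
        = ssum s e0 e1 (\<lambda>u. scale c (\<phi> ((i, e0 i v) # u))) b"
      using D(2)[OF that, of "[]" _ "e0 i v" i c] glinD[OF e0 v] b
      by (intro cong) auto
    also have "\<dots> = scale c (ssum s e0 e1 (\<lambda>u. \<phi> ((i, e0 i v) # u)) b)"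
      by (rule ssum_hom[symmetric]) (rule scale_right_distrib)
    finally have "ssum s e0 e1 (\<lambda>u. \<phi> ((i, e0 i (scl N c v)) # u)) b
        = scale c (ssum s e0 e1 (\<lambda>u. \<phi> ((i, e0 i v) # u)) b)" .
    moreover have "\<phi> ((i + s, e1 i (scl N c v)) # lmap e0 b) = scale c (\<phi> ((i + s, e1 i v) # lmap e0 b))"
      using D(2)[OF that, of "[]" "lmap e0 b" "e1 i v" "i + s" c]
        glinD[OF e1 v] lmap_words0[OF e0 b] by simp
    ultimately show "ssum s e0 e1 \<phi> ((i, scl N c v) # b) = scale c (ssum s e0 e1 \<phi> ((i, v) # b))"
      by (simp add: scale_right_distrib scale_sg)
  next
    fix b i j v v' assume b: "b \<in> words0 N" and v: "v \<in> cmp N i" "v' \<in> cmp N j"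
    let ?b = "lmap e0 b"
    have "ssum s e0 e1 (\<lambda>u. \<phi> ((i, e0 i v) # (j, e0 j v') # u)) b
        = ssum s e0 e1 (\<lambda>u. sg (i * j) (\<phi> ((j, e0 j v') # (i, e0 i v) # u))) b"
      using D(3)[OF that, of "[]" _ "e0 i v" i "e0 j v'" j] glinD[OF e0 v(1)] glinD[OF e0 v(2)] b
      by (intro cong) auto
    then have 1: "ssum s e0 e1 (\<lambda>u. \<phi> ((i, e0 i v) # (j, e0 j v') # u)) b
        = sg (i * j) (ssum s e0 e1 (\<lambda>u. \<phi> ((j, e0 j v') # (i, e0 i v) # u)) b)"
      by (simp add: ssum_sg)
    have 2: "\<phi> ((i + s, e1 i v) # (j, e0 j v') # ?b) = sg ((i + s) * j) (\<phi> ((j, e0 j v') # (i + s, e1 i v) # ?b))"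
      using D(3)[OF that, of "[]" ?b "e1 i v" "i + s" "e0 j v'" j]
        glinD[OF e1 v(1)] glinD[OF e0 v(2)] lmap_words0[OF e0 b] by simp
    have 3: "\<phi> ((i, e0 i v) # (j + s, e1 j v') # ?b) = sg (i * (j + s)) (\<phi> ((j + s, e1 j v') # (i, e0 i v) # ?b))"
      using D(3)[OF that, of "[]" ?b "e0 i v" i "e1 j v'" "j + s"]
        glinD[OF e1 v(2)] glinD[OF e0 v(1)] lmap_words0[OF e0 b] by simp
    \<comment> \<open>Exchanging a replaced letter with an ordinary one costs the shifted degree.
      The extra \<open>s * j\<close> cancels against the sign of the operator passing that letter,
      and the extra \<open>s * i\<close> accounts for its passing the other one.\<close>
    have 4: "sg (s * (j + deg b) + (i + s) * j) x = sg (i * j + s * deg b) x"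
      "sg (s * deg b + i * (j + s)) x = sg (i * j + s * (i + deg b)) x" for x :: 'b
      by (rule sg_parity, simp add: algebra_simps)+
    show "ssum s e0 e1 \<phi> ((i, v) # (j, v') # b) = sg (i * j) (ssum s e0 e1 \<phi> ((j, v') # (i, v) # b))"
   
      by (simp add: 1 2 3 4 sg_add)
  qed
  show ?thesis
  proof (rule descends_induct[where X = ?X])
    fix \<Phi> assume "\<Phi> \<in> ?X"
    then show "descends_head N scale {0} \<Phi>"
      using head by (auto simp: descends_def dest: bspec[of _ _ "[]"])
  next
    fix \<Phi> and z :: "int \<times> 'c" assume "\<Phi> \<in> ?X" and z: "snd z \<in> cmp N (fst z)"
    then consider \<phi> where "descends V scale {0} \<phi>" "\<Phi> = ssum s e0 e1 \<phi>" | "descends N scale {0} \<Phi>" by auto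
    then show "\<exists>\<Phi>\<^sub>1\<in>?X. \<exists>\<Phi>\<^sub>2\<in>?X. \<forall>w. \<Phi> (z # w) = \<Phi>\<^sub>1 w + \<Phi>\<^sub>2 w"
    proof cases
      case (1 \<phi>)
      let ?h = "\<lambda>w. sg (s * deg w) (\<phi> ((fst z + s, e1 (fst z) (snd z)) # lmap e0 w))"
      have "descends N scale {0} (\<lambda>w. \<phi> ((fst z + s, e1 (fst z) (snd z)) # lmap e0 w))"
        using glinD(1)[OF e1 z] by (intro descends_lmap[OF e0] descends_Cons[OF 1(1)]) simp
      then have "descends N scale {0} ?h"
        by (rule descends_sg[OF subspace_single_0]) simp
      moreover have "descends V scale {0} (\<lambda>u. \<phi> ((fst z, e0 (fst z) (snd z)) # u))"
        using glinD(1)[OF e0 z] by (intro descends_Cons[OF 1(1)]) simp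
      ultimately show ?thesis
        unfolding 1(2) by (intro bexI[of _ ?h] bexI[of _ "ssum s e0 e1 (\<lambda>u. \<phi> ((fst z, e0 (fst z) (snd z)) # u))"]) auto
    next
      case 2
      moreover have "descends N scale {0} (\<lambda>w. 0)" by (rule descends0I) simp_all
      ultimately show ?thesis
        using z by (intro bexI[of _ "\<lambda>w. \<Phi> (z # w)"] bexI[of _ "\<lambda>w. 0"]) (auto intro: descends_Cons)
    qed
  qed (use \<phi> subspace_single_0 in auto)
qed

text \<open>Moving a letter to the front by an unshuffle and moving it back by symmetry of
  \<open>\<phi>\<close> cost the same sign. This brings the terms of the Jacobi expression that
  differentiate one argument into the form of the Leibniz rule.\<close>

lemma unsh_single:
  assumes e0: "glin N V e0" and e1: "glin N V e1" and \<phi>: "descends V scale {0} \<phi>" and w: "w \<in> words0 N"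
  shows "unsh (\<lambda>u v. if length u = 1 then \<phi> ((fst (hd u), e1 (fst (hd u)) (snd (hd u))) # lmap e0 v) else 0) w
    = ssum 0 e0 e1 \<phi> w"
  using \<phi> w
proof (induction w arbitrary: \<phi>)
  case (Cons z w)
  then have z: "snd z \<in> cmp N (fst z)" and w: "w \<in> words0 N" by auto
  let ?z0 = "(fst z, e0 (fst z) (snd z))" and ?z1 = "(fst z, e1 (fst z) (snd z))"
  have "unsh (\<lambda>u v. if length (z # u) = 1
        then \<phi> ((fst (hd (z # u)), e1 (fst (hd (z # u))) (snd (hd (z # u)))) # lmap e0 v) else 0) w
      = unsh (\<lambda>u v. if u = [] then \<phi> (?z1 # lmap e0 v) else 0) w"
    by (rule unsh_cong) auto
  moreover have "unsh (\<lambda>u v. sg (fst z * deg u) (if length u = 1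
        then \<phi> ((fst (hd u), e1 (fst (hd u)) (snd (hd u))) # lmap e0 (z # v)) else 0)) w
      = unsh (\<lambda>u v. if length u = 1
        then \<phi> (?z0 # (fst (hd u), e1 (fst (hd u)) (snd (hd u))) # lmap e0 v) else 0) w"
  proof (rule unsh_cong)
    fix u v assume s: "mset u + mset v = mset w"
    note uv = words0_split[OF s w]
    show "sg (fst z * deg u) (if length u = 1
        then \<phi> ((fst (hd u), e1 (fst (hd u)) (snd (hd u))) # lmap e0 (z # v)) else 0)
      = (if length u = 1 then \<phi> (?z0 # (fst (hd u), e1 (fst (hd u)) (snd (hd u))) # lmap e0 v) else 0)"
    proof (cases "length u = 1")
      case True
      then obtain y where y: "u = [y]" by (auto simp: length_Suc_conv)
      then show ?thesis
        using descends0D(3)[OF Cons.prems(1), of "[]" "lmap e0 v" "e1 (fst y) (snd y)" "fst y" "e0 (fst z) (snd z)" "fst z"]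
          uv glinD(1)[OF e0 z] glinD(1)[OF e1, of "snd y" "fst y"] lmap_words0[OF e0 uv(2)]
        by (simp add: sg_parity[of "2 * _" 0])
    qed auto
  qed
  moreover have "\<dots> = ssum 0 e0 e1 (\<lambda>u. \<phi> (?z0 # u)) w"
    using glinD(1)[OF e0 z] by (intro Cons.IH descends_Cons[OF Cons.prems(1)] w) simp
  ultimately show ?case by (simp add: unsh_left_Nil)
qed simp

end

section \<open>Brackets of polynomials under evaluation\<close>

locale graded0 = graded V for V :: "('k::field_char_0, 'b::ab_group_add) gvs"
begin

sublocale char0_space "scl V"
  by unfold_locales

lemma descends_first_sum:
  assumes g: "descends V (scl V) {0} g" and u: "u \<in> words0 V" and x: "\<And>n. x n \<in> cmp V i"
  shows "g ((i, \<Sum>n\<le>N. scl V (k n) (x n)) # u) = (\<Sum>n\<le>(N::nat). scl V (k n) (g ((i, x n) # u)))"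
proof (induction N)
  case 0
  show ?case using descends0D(2)[OF g, of "[]" u "x 0" i "k 0"] u x by simp
next
  case (Suc N)
  have "(\<Sum>n\<le>N. scl V (k n) (x n)) \<in> cmp V i"
    using x by (intro subspace_sum[OF subspace_cmp]) auto
  then show ?case
    using descends0D(1)[OF g, of "[]" u "\<Sum>n\<le>N. scl V (k n) (x n)" i "scl V (k (Suc N)) (x (Suc N))"]
      descends0D(2)[OF g, of "[]" u "x (Suc N)" i "k (Suc N)"] Suc u x by simp
qed

lemma pev_cmp: "(\<And>n. coeff p n \<in> cmp V i) \<Longrightarrow> ev c p \<in> cmp V i"
  by (rule pev_mem[OF subspace_cmp])

lemma glin_pev: "glin (poly_space V) V (\<lambda>_. ev c)"
  by (simp add: glin_def pev_cmp pev_add pev_pscl)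

lemma glin_pev_pder: "glin (poly_space V) V (\<lambda>_ p. ev c (dv p))"
  using coeffs_mem(1)[OF subspace_cmp]
  by (simp add: glin_def pev_cmp pev_add pev_pscl pder_add pder_pscl)

text \<open>Evaluation at a scalar is an algebra homomorphism on polynomials in \<open>t\<close>, so
  it commutes with the extended bracket; multilinearity of \<open>g\<close> reassembles the
  coefficients.\<close>

lemma pev_pext:
  assumes "descends V (scl V) {0} g" "w \<in> words0 (poly_space V)"
  shows "ev c (pext g w) = g (lmap (\<lambda>_. ev c) w)"
  using assms
proof (induction w arbitrary: g)
  case (Cons z w)
  let ?w = "lmap (\<lambda>_. ev c) w"
  have z: "coeff (snd z) n \<in> cmp V (fst z)" for n using Cons.prems by simp
  have w: "?w \<in> words0 V" using Cons.prems lmap_words0[OF glin_pev] by auto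
  have "ev c (pext g (z # w))
      = (\<Sum>n\<le>degree (snd z). scl V (c ^ n) (g ((fst z, coeff (snd z) n) # ?w)))"
    using Cons.prems z by (simp add: pev_sum pev_shift Cons.IH descends_Cons[OF Cons.prems(1)])
  also have "\<dots> = g ((fst z, ev c (snd z)) # ?w)"
    unfolding pev_def[of "scl V" c "snd z"] by (rule descends_first_sum[OF Cons.prems(1) w z, symmetric])
  finally show ?case by simp
qed simp

lemma coeff_pext_mem:
  assumes "subspace S" "w \<in> words0 (poly_space V)" "\<And>u. u \<in> words0 V \<Longrightarrow> map fst u = map fst w \<Longrightarrow> g u \<in> S"
  shows "coeff (pext g w) n \<in> S"
  using assms(2,3)
proof (induction w arbitrary: g n)
  case Nil
  then show ?case using subspace_0[OF assms(1)] by (auto simp: coeff_pCons split: nat.split)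
next
  case (Cons z w)
  have "coeff (pext (\<lambda>u. g ((fst z, coeff (snd z) m) # u)) w) k \<in> S" for m k
    using Cons.prems by (intro Cons.IH) auto
  then show ?case
    using subspace_0[OF assms(1)] by (auto simp: coeff_sum coeff_shift intro!: subspace_sum[OF assms(1)])
qed

text \<open>In \<open>t ^ n\<close> times the extension over the remaining letters, the derivative
  of the power yields the summand of the first letter, and the other term is left to the
  induction.\<close>

lemma pev_Leibniz:
  assumes "descends V (scl V) {0} g" "w \<in> words0 (poly_space V)"
  shows "ev c (dv (pext g w))
    = ssum 0 (\<lambda>_. ev c) (\<lambda>_ p. ev c (dv p)) g w"
  using assms
proof (induction w arbitrary: g)
  case (Cons z w)
  let ?e = "\<lambda>_. ev c" and ?d = "\<lambda>_ p. ev c (dv p)"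
  have z: "coeff (snd z) n \<in> cmp V (fst z)" for n using Cons.prems by simp
  have w0: "w \<in> words0 (poly_space V)" using Cons.prems by simp
  have w: "lmap ?e w \<in> words0 V" using lmap_words0[OF glin_pev w0] .
  let ?g = "\<lambda>n u. g ((fst z, coeff (snd z) n) # u)"
  have gn: "descends V (scl V) {0} (?g n)" for n
    using z by (intro descends_Cons[OF Cons.prems(1)]) simp
  have 1: "(\<Sum>n\<le>degree (snd z). scl V (of_nat n * c ^ (n - 1)) (?g n (lmap ?e w)))
      = g ((fst z, ?d (fst z) (snd z)) # lmap ?e w)"
    unfolding pev_pder by (rule descends_first_sum[OF Cons.prems(1) w z, symmetric])
  have "(\<Sum>n\<le>degree (snd z). scl V (c ^ n) (ssum 0 ?e ?d (?g n) w))
      = ssum 0 ?e ?d (\<lambda>u. \<Sum>n\<le>degree (snd z). scl V (c ^ n) (?g n u)) w"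
    unfolding ssum_sum by (intro sum.cong refl ssum_hom) (rule scale_right_distrib)
  also have "\<dots> = ssum 0 ?e ?d (\<lambda>u. g ((fst z, ev c (snd z)) # u)) w"
  proof (rule ssum_cong[where V = V])
    fix u assume "u \<in> words0 V"
    from descends_first_sum[OF Cons.prems(1) this z]
    show "(\<Sum>n\<le>degree (snd z). scl V (c ^ n) (?g n u)) = g ((fst z, ev c (snd z)) # u)"
      unfolding pev_def by simp
  next
    fix y assume "y \<in> set w"
    then have y: "snd y \<in> cmp (poly_space V) (fst y)" using w0 by (auto simp: words0_def)
    show "?e (fst y) (snd y) \<in> cmp V (fst y)" "?d (fst y) (snd y) \<in> cmp V (fst y + 0)"
      using glinD(1)[OF glin_pev y] glinD(1)[OF glin_pev_pder y] by simp_all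
  qed
  finally show ?case
    using 1 by (simp add: pder_sum pev_sum pev_pder_shift sum.distrib pev_pext[OF gn w0] Cons.IH[OF gn w0])
qed simp

lemma descends_pointwise:
  assumes "\<And>c. descends N (scl V) {0} (\<lambda>w. ev c (\<Phi> w))"
  shows "descends N (\<lambda>c. map_poly (scl V c)) {0} \<Phi>"
proof (rule descends0I)
  show "\<Phi> (a @ (i, v + v') # b) = \<Phi> (a @ (i, v) # b) + \<Phi> (a @ (i, v') # b)"
    if "a \<in> words0 N" "b \<in> words0 N" "v \<in> cmp N i" "v' \<in> cmp N i" for a b i v v'
    by (rule pev_ext) (use descends0D(1)[OF assms that] in \<open>simp add: pev_add\<close>)
  show "\<Phi> (a @ (i, scl N c v) # b) = map_poly (scl V c) (\<Phi> (a @ (i, v) # b))"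
    if "a \<in> words0 N" "b \<in> words0 N" "v \<in> cmp N i" for a b i c v
    by (rule pev_ext) (use descends0D(2)[OF assms that] in \<open>simp add: pev_pscl\<close>)
  show "\<Phi> (a @ (i, v) # (j, v') # b) = sg (i * j) (\<Phi> (a @ (j, v') # (i, v) # b))"
    if "a \<in> words0 N" "b \<in> words0 N" "v \<in> cmp N i" "v' \<in> cmp N j" for a b i j v v'
    by (rule pev_ext) (use descends0D(3)[OF assms that] in \<open>simp add: pev_sg\<close>)
qed

end

section \<open>The path construction\<close>

definition path_space :: "('k, 'a::ab_group_add) gvs \<Rightarrow> ('k, 'b::ab_group_add) gvs \<Rightarrow> ('k, 'a \<times> 'b poly \<times> 'b poly) gvs" where
  "path_space V W = \<lparr>scl = (\<lambda>c y. (scl V c (fst y), map_poly (scl W c) (fst (snd y)), map_poly (scl W c) (snd (snd y)))),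
     cmp = (\<lambda>i. {y. fst y \<in> cmp V i \<and> (\<forall>n. coeff (fst (snd y)) n \<in> cmp W i) \<and>
       (\<forall>n. coeff (snd (snd y)) n \<in> cmp W (i + 1))})\<rparr>"

lemma path_space_simps:
  "scl (path_space V W) c y = (scl V c (fst y), map_poly (scl W c) (fst (snd y)), map_poly (scl W c) (snd (snd y)))"
  "y \<in> cmp (path_space V W) i \<longleftrightarrow> fst y \<in> cmp V i \<and> (\<forall>n. coeff (fst (snd y)) n \<in> cmp W i) \<and>
       (\<forall>n. coeff (snd (snd y)) n \<in> cmp W (i + 1))"
  by (simp_all add: path_space_def)

abbreviation "fun_part \<equiv> (\<lambda>(_::int) y. fst (snd y))"
abbreviation "form_part \<equiv> (\<lambda>(_::int) y. snd (snd y))"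
abbreviation "base_part \<equiv> (\<lambda>(_::int) y. fst y)"

text \<open>
  A triple \<open>(x, p, r)\<close> stands for \<open>(x, p(t) + r(t) dt)\<close>. Brackets on the second component are
  extended multilinearly over the polynomial forms; since \<open>dt\<close> has degree \<open>-1\<close> and squares to zero,
  a product of forms has a \<open>dt\<close> part in which exactly one factor contributes its \<open>dt\<close> part, and
  moving that \<open>dt\<close> to the right end past the later vectors produces the sign in \<open>ssum\<close>.
\<close>

definition path_op ::
  "('k::field_char_0 \<Rightarrow> 'b \<Rightarrow> 'b) \<Rightarrow> ('a word \<Rightarrow> 'a) \<Rightarrow> ('b word \<Rightarrow> 'b::ab_group_add)
     \<Rightarrow> ('a \<times> 'b poly \<times> 'b poly) word \<Rightarrow> 'a \<times> 'b poly \<times> 'b poly" where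
  "path_op s q q' w = (q (lmap base_part w), pext q' (lmap fun_part w),
     ssum 1 fun_part form_part (pext q') w
       + (if length w = 1 then sg (deg w) (pder s (fst (snd (snd (hd w))))) else 0))"

locale path_construction = V: graded0 V + W: graded0 W
  for V :: "('k::field_char_0, 'a::ab_group_add) gvs" and W :: "('k, 'b::ab_group_add) gvs" +
  fixes q :: "'a word \<Rightarrow> 'a" and q' :: "'b word \<Rightarrow> 'b"
  assumes q: "symop (- 1) V V q" and q': "symop (- 1) W W q'"
begin

abbreviation "N \<equiv> path_space V W"
abbreviation "op \<equiv> path_op (scl W) q q'"
abbreviation "ev \<equiv> pev (scl W)"
abbreviation "dv \<equiv> pder (scl W)"
abbreviation "fun_at c \<equiv> (\<lambda>(_::int) (y :: 'a \<times> 'b poly \<times> 'b poly). ev c (fst (snd y)))"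
abbreviation "form_at c \<equiv> (\<lambda>(_::int) (y :: 'a \<times> 'b poly \<times> 'b poly). ev c (snd (snd y)))"
abbreviation "der_at c \<equiv> (\<lambda>(_::int) (y :: 'a \<times> 'b poly \<times> 'b poly). ev c (dv (fst (snd y))))"

lemma graded_path_space: "graded_space N"
proof -
  interpret vector_space "scl N"
    by unfold_locales
      (simp_all add: path_space_simps prod_eq_iff poly_eq_iff V.scale_right_distrib V.scale_left_distrib
        W.scale_right_distrib W.scale_left_distrib)
  have "subspace (cmp N i)" for i
    by (auto simp: subspace_def path_space_simps)
  then show ?thesis
    using vector_space_axioms by (simp add: graded_space_def)
qed

lemma glin_parts:
  "glin N V base_part" "glin N (poly_space W) fun_part" "glins 1 N (poly_space W) form_part"
  "glin N W (fun_at c)" "glins 1 N W (form_at c)" "glin N W (der_at c)"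
  using W.coeffs_mem(1)[OF W.subspace_cmp]
  by (auto simp: glin_def path_space_simps W.pev_add W.pev_pscl W.pder_add W.pder_pscl intro!: W.pev_cmp)

lemma letters:
  assumes "w \<in> words0 N" "z \<in> set w"
  shows "fun_part (fst z) (snd z) \<in> cmp (poly_space W) (fst z)"
    "form_part (fst z) (snd z) \<in> cmp (poly_space W) (fst z + 1)"
    "fun_at c (fst z) (snd z) \<in> cmp W (fst z)" "form_at c (fst z) (snd z) \<in> cmp W (fst z + 1)"
    "der_at c (fst z) (snd z) \<in> cmp W (fst z)"
proof -
  have z: "snd z \<in> cmp N (fst z)" using assms by (auto simp: words0_def)
  note glin_parts(2-6)[THEN glinD(1), OF z]
  then show "fun_part (fst z) (snd z) \<in> cmp (poly_space W) (fst z)"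
    "form_part (fst z) (snd z) \<in> cmp (poly_space W) (fst z + 1)"
    "fun_at c (fst z) (snd z) \<in> cmp W (fst z)" "form_at c (fst z) (snd z) \<in> cmp W (fst z + 1)"
    "der_at c (fst z) (snd z) \<in> cmp W (fst z)" by simp_all
qed

lemma ev_fun:
  assumes "w \<in> words0 N"
  shows "ev c (pext q' (lmap fun_part w)) = q' (lmap (fun_at c) w)"
  using W.pev_pext[OF symopD(2)[OF q'] lmap_words0[OF glin_parts(2) assms]] by (simp add: lmap_comp)

lemma ev_form:
  assumes w: "w \<in> words0 N"
  shows "ev c (ssum 1 fun_part form_part (pext q') w) = ssum 1 (fun_at c) (form_at c) q' w"
proof -
  have "ev c (ssum 1 fun_part form_part (pext q') w) = ssum 1 fun_part form_part (\<lambda>u. ev c (pext q' u)) w"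
    by (rule ssum_hom) (rule W.pev_add)
  also have "\<dots> = ssum 1 fun_part form_part (\<lambda>u. q' (lmap (\<lambda>_. ev c) u)) w"
    by (rule ssum_cong[where V = "poly_space W"]) (use W.pev_pext[OF symopD(2)[OF q']] letters[OF w] in auto)
  also have "\<dots> = ssum 1 (fun_at c) (form_at c) q' w"
    by (rule ssum_lmap)
  finally show ?thesis .
qed

lemma ev_der:
  assumes w: "w \<in> words0 N"
  shows "ev c (dv (pext q' (lmap fun_part w))) = ssum 0 (fun_at c) (der_at c) q' w"
proof -
  have "ssum 0 e0 e1 \<phi> (lmap h w) = ssum 0 (\<lambda>i x. e0 i (h i x)) (\<lambda>i x. e1 i (h i x)) \<phi> w"
    for e0 e1 :: "int \<Rightarrow> 'x \<Rightarrow> 'y" and h :: "int \<Rightarrow> 'z \<Rightarrow> 'x" and \<phi> :: "'y word \<Rightarrow> 'v::ab_group_add" and w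
    by (induction w arbitrary: \<phi>) (simp_all add: lmap_comp)
  then show ?thesis
    using W.pev_Leibniz[OF symopD(2)[OF q'] lmap_words0[OF glin_parts(2) w]] by simp
qed

lemma op_mem:
  assumes w: "w \<in> words0 N" "w \<noteq> []"
  shows "op w \<in> cmp N (deg w - 1)"
proof -
  have 1: "q (lmap base_part w) \<in> cmp V (deg w - 1)"
    using symopD(1)[OF q, of "lmap base_part w"] w lmap_words0[OF glin_parts(1) w(1)] by simp
  have pm: "coeff (pext q' u) n \<in> cmp W (deg u - 1)" if "u \<in> words0 (poly_space W)" "u \<noteq> []" for u n
  proof (rule W.coeff_pext_mem[OF W.subspace_cmp that(1)])
    fix x assume x: "x \<in> words0 W" "map fst x = map fst u"
    then have "x \<noteq> []" "deg x = deg u" using that(2) by (auto simp: deg_def)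
    then show "q' x \<in> cmp W (deg u - 1)" using symopD(1)[OF q' x(1)] by simp
  qed
  have 2: "coeff (pext q' (lmap fun_part w)) n \<in> cmp W (deg w - 1)" for n
    using pm[OF lmap_words0[OF glin_parts(2) w(1)]] w by simp
  have "subgroup_of {p. \<forall>n. coeff p n \<in> cmp W (deg w)}"
    by (auto simp: subgroup_of_def)
  then have "ssum 1 fun_part form_part (pext q') w \<in> {p. \<forall>n. coeff p n \<in> cmp W (deg w)}"
  proof (rule ssum_mem[where V = "poly_space W"])
    fix u :: "'b poly word" assume "deg u = deg w + 1" "u \<noteq> []" "u \<in> words0 (poly_space W)"
    then show "pext q' u \<in> {p. \<forall>n. coeff p n \<in> cmp W (deg w)}"
      using pm[of u] by simp
  qed (use letters[OF w(1)] in auto)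
  then have 3: "coeff (ssum 1 fun_part form_part (pext q') w) n \<in> cmp W (deg w)" for n by simp
  \<comment> \<open>The unary bracket contains in addition the differential of the forms; its sign
    comes from \<open>d\<close> passing the vector coefficient.\<close>
  have 4: "coeff (if length w = 1 then sg (deg w) (dv (fst (snd (snd (hd w))))) else 0) n \<in> cmp W (deg w)" for n
  proof (cases "length w = 1")
    case True
    then obtain z where "w = [z]" by (auto simp: length_Suc_conv)
    then show ?thesis
      using w by (auto simp: path_space_simps simp del: W.coeff_pder
          intro!: W.coeffs_mem(3)[OF W.subspace_cmp] W.coeffs_mem(1)[OF W.subspace_cmp])
  qed simp
  show ?thesis using 1 2 W.cmp_intros(4)[OF 3 4] by (simp add: path_op_def path_space_simps)
qed

lemma descends_op: "descends N (scl N) {0} op"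
proof -
  interpret N: graded N by unfold_locales (rule graded_path_space)
  have 1: "descends N (scl V) {0} (\<lambda>w. fst (op w))"
    using descends_lmap[OF glin_parts(1) symopD(2)[OF q]] by (simp add: path_op_def)
  have 2: "descends N (\<lambda>c. map_poly (scl W c)) {0} (\<lambda>w. fst (snd (op w)))"
  proof (rule W.descends_pointwise)
    fix c
    show "descends N (scl W) {0} (\<lambda>w. ev c (fst (snd (op w))))"
      by (rule descends_cong[OF _ graded_path_space descends_lmap[OF glin_parts(4) symopD(2)[OF q']]])
        (simp add: path_op_def ev_fun)
  qed
  have 3: "descends N (\<lambda>c. map_poly (scl W c)) {0} (\<lambda>w. snd (snd (op w)))"
  proof (rule W.descends_pointwise)
    fix c
    \<comment> \<open>The differential is seen only on one-letter words: linearity there is that of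
      the derivative, and graded symmetry compares zero with zero. The degree 0 passed to
      \<open>der_at\<close> is a dummy.\<close>
    have D: "descends N (scl W) {0} (\<lambda>w. if length w = 1 then sg (deg w) (der_at c 0 (snd (hd w))) else 0)"
    proof (rule descends0I, goal_cases)
      case (1 a b i v v')
      then show ?case using glinD(3)[OF glin_parts(6)[of c], of v i v'] by (auto simp: sg_add)
    next
      case (2 a b i k v)
      then show ?case using glinD(2)[OF glin_parts(6)[of c], of v i k] by (auto simp: W.scale_sg)
    qed auto
    show "descends N (scl W) {0} (\<lambda>w. ev c (snd (snd (op w))))"
      by (rule descends_cong[OF _ graded_path_space W.descends0_add[OF
            W.descends_ssum[OF glin_parts(4)[of c] glin_parts(5)[of c] symopD(2)[OF q']] D]])
        (simp add: path_op_def ev_form W.pev_add W.pev_sg)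
  qed
  show ?thesis
  proof (rule descends0I, goal_cases)
    case (1 a b i v v')
    then show ?case
      using descends0D(1)[OF \<open>descends N (scl V) {0} (\<lambda>w. fst (op w))\<close> 1] descends0D(1)[OF 2 1] descends0D(1)[OF 3 1]
      by (simp add: prod_eq_iff)
  next
    case (2 a b i k v)
    then show ?case
      using descends0D(2)[OF 1 2] descends0D(2)[OF \<open>descends N _ {0} (\<lambda>w. fst (snd (op w)))\<close> 2] descends0D(2)[OF 3 2]
      by (simp add: prod_eq_iff path_space_simps)
  next
    case (3 a b i j v v')
    then show ?case
      using descends0D(3)[OF 1 3] descends0D(3)[OF 2 3] descends0D(3)[OF \<open>descends N _ {0} (\<lambda>w. snd (snd (op w)))\<close> 3]
      by (simp add: prod_eq_iff sg_def)
  qed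
qed

text \<open>
  In the \<open>dt\<close> component, the terms without a derivative form the Jacobi expression of \<open>q'\<close>; those with
  the derivative of a single argument and the derivative of the bracket cancel by the Leibniz rule.
\<close>

lemma jacobi_op:
  assumes J: "\<And>w. w \<in> words V \<Longrightarrow> jacobi q w = 0" and J': "\<And>w. w \<in> words W \<Longrightarrow> jacobi q' w = 0"
    and w: "w \<in> words N"
  shows "jacobi op w = 0"
proof -
  have w0: "w \<in> words0 N" "w \<noteq> []" using w by (auto simp: words_eq)
  have words: "lmap base_part w \<in> words V" "lmap (fun_at c) w \<in> words W" for c
    using lmap_words0[OF glin_parts(1) w0(1)] lmap_words0[OF glin_parts(4) w0(1)] w0(2) by (auto simp: words_eq)
  have split: "u \<in> words0 N" "v \<in> words0 N" "u \<noteq> [] \<Longrightarrow> (deg u - 1, op u) # v \<in> words0 N"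
    if "mset u + mset v = mset w" for u v
    using words0_split[OF that w0(1)] op_mem[of u] by auto
  have "fst (jacobi op w) = jacobi q (lmap base_part w)"
    unfolding jacobi_def unsh_lmap by (subst unsh_hom[of fst]) (auto intro!: unsh_cong simp: path_op_def)
  then have 1: "fst (jacobi op w) = 0"
    using J[OF words(1)] by simp
  have "ev c (fst (snd (jacobi op w))) = 0" for c
  proof -
    have "ev c (fst (snd (jacobi op w))) = jacobi q' (lmap (fun_at c) w)"
      unfolding jacobi_def unsh_lmap
    proof (subst unsh_hom[of "\<lambda>y. ev c (fst (snd y))"], goal_cases)
      case 2
      show ?case
      proof (rule unsh_cong)
        fix u v assume s: "mset u + mset v = mset w"
        show "ev c (fst (snd (if u = [] then 0 else op ((deg u - 1, op u) # v))))
          = (if lmap (fun_at c) u = [] then 0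
             else q' ((deg (lmap (fun_at c) u) - 1, q' (lmap (fun_at c) u)) # lmap (fun_at c) v))"
          using ev_fun[OF split(3)[OF s]] ev_fun[OF split(1)[OF s]] by (simp add: path_op_def)
      qed
    qed (simp add: W.pev_add)
    then show ?thesis using J'[OF words(2)] by simp
  qed
  then have 2: "fst (snd (jacobi op w)) = 0" by (rule W.pev_eq_0)
  have "ev c (snd (snd (jacobi op w))) = 0" for c
  proof -
    let ?S1 = "ssum 1 (fun_at c) (form_at c)" and ?S0 = "ssum 0 (fun_at c) (der_at c)"
    define \<chi> where "\<chi> u v = (if u = [] then 0 else q' ((deg u - 1, q' u) # v))" for u v
    \<comment> \<open>Three groups of terms: \<open>dt\<close> contributed by an argument,
      differentiation of a single argument inside the outer bracket, and differentiation of the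
      inner bracket, which is possible only if that bracket uses all letters.\<close>
    let ?T = "\<lambda>u v. (sg (1 * deg v) (?S1 (\<lambda>u'. \<chi> u' (lmap (fun_at c) v)) u) + ?S1 (\<lambda>v'. \<chi> (lmap (fun_at c) u) v') v)
        + sg (deg w) (if length u = 1 then q' ((fst (hd u), der_at c (fst (hd u)) (snd (hd u))) # lmap (fun_at c) v) else 0)
        + (if v = [] then sg (deg u - 1) (?S0 q' u) else 0)"
    have summand: "ev c (snd (snd (if u = [] then 0 else op ((deg u - 1, op u) # v))))
        = ?T u v"
      if s: "mset u + mset v = mset w" for u v
    proof (cases "u = []")
      case True
      then show ?thesis by (simp add: \<chi>_def)
    next
      case False
      note u = split(1)[OF s] and v = split(2)[OF s] and uv = split(3)[OF s False]
      have dw: "deg w = deg u + deg v" by (rule mset_split(1)[OF s])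
      let ?v = "lmap (fun_at c) v"
      have v0: "?v \<in> words0 W" by (rule lmap_words0[OF glin_parts(4) v])
      have q0: "q' u' \<in> cmp W (deg u)" if "deg u' = deg u + 1" "u' \<noteq> []" "u' \<in> words0 W" for u'
        using symopD(1)[OF q' that(3,2)] that(1) by simp
      \<comment> \<open>The outer bracket with its first slot open; additivity there distributes it
        over the \<open>dt\<close> part of the inner bracket.\<close>
      let ?h = "\<lambda>x. q' ((deg u, x) # ?v)"
      have h: "?h (x + y) = ?h x + ?h y" if "x \<in> cmp W (deg u)" "y \<in> cmp W (deg u)" for x y
        using descends0D(1)[OF symopD(2)[OF q'], of "[]" ?v x "deg u" y] that v0 by simp
      have hS: "?S1 q' u \<in> cmp W (deg u) \<and> ?h (?S1 q' u) = ?S1 (\<lambda>u'. ?h (q' u')) u"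
        by (rule ssum_hom_on[where V = W, OF W.subgroup_cmp h q0 letters(3,4)[OF u]])
      have "?S1 (\<lambda>u'. ?h (q' u')) u = ?S1 (\<lambda>u'. \<chi> u' ?v) u"
        by (rule ssum_cong[where V = W]) (use letters[OF u] in \<open>auto simp: \<chi>_def\<close>)
      with hS have a: "?h (?S1 q' u) = ?S1 (\<lambda>u'. \<chi> u' ?v) u" by simp
      let ?d = "if length u = 1 then sg (deg u) (der_at c 0 (snd (hd u))) else 0"
      have d: "?d \<in> cmp W (deg u) \<and> ?h ?d = (if length u = 1
          then sg (deg u) (q' ((fst (hd u), der_at c (fst (hd u)) (snd (hd u))) # ?v)) else 0)"
      proof (cases "length u = 1")
        case True
        then obtain z where z: "u = [z]" by (auto simp: length_Suc_conv)
        have dz: "der_at c 0 (snd z) \<in> cmp W (fst z)" using letters(5)[OF u, of z c] z by simp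
        have "?h (sg d x) = sg d (?h x)" if "x \<in> cmp W (deg u)" for d x
          using descends0D(2)[OF symopD(2)[OF q'], of "[]" ?v x "deg u" "sgn_pow d"] that v0 by simp
        from this[of "der_at c 0 (snd z)" "fst z"] show ?thesis using z dz by auto
      next
        case False
        have "?h 0 = 0" using h[of 0 0] by simp
        with False show ?thesis by simp
      qed
      have "ev c (snd (snd (op u))) = ?S1 q' u + ?d"
        by (simp add: path_op_def ev_form[OF u] W.pev_add W.pev_sg)
      then have form: "?h (ev c (snd (snd (op u)))) = ?S1 (\<lambda>u'. \<chi> u' ?v) u + ?h ?d"
        using h[of "?S1 q' u" ?d] hS d a by simp
      have "ev c (snd (snd (op ((deg u - 1, op u) # v)))) = ?S1 q' ((deg u - 1, op u) # v)
          + (if v = [] then sg (deg u - 1) (ev c (dv (fst (snd (op u))))) else 0)"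
      proof -
        have "snd (snd (op w)) = ssum 1 fun_part form_part (pext q') w
            + (if length w = 1 then sg (deg w) (dv (fst (snd (snd (hd w))))) else 0)" for w
          by (simp add: path_op_def)
        from this[of "(deg u - 1, op u) # v"] show ?thesis
          by (simp only: W.pev_add ev_form[OF uv]) (simp add: W.pev_sg)
      qed
      also have "ev c (dv (fst (snd (op u)))) = ?S0 q' u"
        by (simp add: path_op_def ev_der[OF u])
      also have "?S1 q' ((deg u - 1, op u) # v) = sg (deg v) (?h (ev c (snd (snd (op u)))))
          + ?S1 (\<lambda>v'. \<chi> (lmap (fun_at c) u) v') v"
        using False ev_fun[OF u] by (simp add: \<chi>_def) (simp add: path_op_def)
      finally show ?thesis
        using False d unfolding form dw by (simp add: sg_add add.commute)
    qed
    have "ev c (snd (snd (jacobi op w)))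
        = unsh (\<lambda>u v. ev c (snd (snd (if u = [] then 0 else op ((deg u - 1, op u) # v))))) w"
      unfolding jacobi_def by (rule unsh_hom) (simp add: W.pev_add)
    also have "\<dots> = unsh (\<lambda>u v. ?T u v) w"
      by (rule unsh_cong) (rule summand)
    \<comment> \<open>The two derivative sums have become equal up to signs with exponents
      \<open>deg w\<close> and \<open>deg w - 1\<close>, which have opposite parity.\<close>
    also have "\<dots> = ?S1 (unsh \<chi>) w + sg (deg w) (?S0 q' w) + sg (deg w - 1) (?S0 q' w)"
      by (simp only: unsh_add unsh_sg unsh_right_Nil ssum_unsh
          W.unsh_single[OF glin_parts(4,6) symopD(2)[OF q'] w0(1)])
    also have "?S1 (unsh \<chi>) w = ?S1 (\<lambda>u. 0) w"
    proof (rule ssum_cong[where V = W])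
      fix u :: "'b word" assume "u \<noteq> []" "u \<in> words0 W"
      then show "unsh \<chi> u = 0" using J'[of u] by (simp add: words_eq jacobi_def \<chi>_def[abs_def])
    qed (use letters[OF w0(1)] in auto)
    finally show ?thesis by (simp add: sg_def)
  qed
  then have 3: "snd (snd (jacobi op w)) = 0" by (rule W.pev_eq_0)
  show ?thesis using 1 2 3 by (simp add: prod_eq_iff)
qed

end

lemma lmap_id [simp]: "lmap (\<lambda>i v. v) w = w"
  by (induction w) simp_all

lemma lmap_cong: "(\<And>z. z \<in> set w \<Longrightarrow> e (fst z) (snd z) = e' (fst z) (snd z)) \<Longrightarrow> lmap e w = lmap e' w"
  by (simp add: lmap_def case_prod_beta)

lemma (in graded) descends_zero_letter:
  assumes "descends V s {0} \<phi>" "vector_space s" "a \<in> words0 V" "b \<in> words0 V"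
  shows "\<phi> (a @ (i, 0) # b) = 0"
proof -
  interpret S: vector_space s by fact
  show ?thesis using descends0D(2)[OF assms(1,3,4), of 0 i 0] by simp
qed

lemma ssum_zero:
  assumes W: "graded_space W" and \<phi>: "descends W s {0} \<phi>" "vector_space s"
    and e: "\<And>z. z \<in> set w \<Longrightarrow> e0 (fst z) (snd z) \<in> cmp W (fst z)" "\<And>z. z \<in> set w \<Longrightarrow> e1 (fst z) (snd z) = 0"
  shows "ssum d e0 e1 \<phi> w = 0"
  using \<phi>(1) e
proof (induction w arbitrary: \<phi>)
  case (Cons z w)
  interpret graded W by unfold_locales (rule W)
  have "lmap e0 w \<in> words0 W"
    using Cons.prems(2) by (auto simp: words0_def lmap_def)
  then have "\<phi> ((fst z + d, 0) # lmap e0 w) = 0"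
    using descends_zero_letter[OF Cons.prems(1) \<phi>(2), of "[]"] by simp
  moreover have "ssum d e0 e1 (\<lambda>u. \<phi> ((fst z, e0 (fst z) (snd z)) # u)) w = 0"
    using Cons.prems(2,3) by (intro Cons.IH descends_Cons[OF Cons.prems(1)]) auto
  ultimately show ?case using Cons.prems(3)[of z] by simp
qed simp


section \<open>Homology\<close>

lemma differential_add:
  assumes L: "Linf_algebra L l" and x: "x \<in> cmp L i" "y \<in> cmp L i"
  shows "l 1 [(i, x + y)] = l 1 [(i, x)] + l 1 [(i, y)]"
proof -
  have "skew_map 1 (int 1 - 2) L L (l 1)"
    using L unfolding Linf_algebra_def by blast
  from skew_mapD(2)[OF this, of "[]" "[]" x i y] x show ?thesis by simp
qed

lemma equiv_homologous:
  assumes L: "Linf_algebra L l"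
  shows "equiv {x \<in> cmp L i. l 1 [(i, x)] = 0} (homologous L l i)"
proof (rule equivI)
  interpret graded L by unfold_locales (rule Linf_algebra_graded[OF L])
  have d: "l 1 [(k, x + y)] = l 1 [(k, x)] + l 1 [(k, y)]" if "x \<in> cmp L k" "y \<in> cmp L k" for k x y
    by (rule differential_add[OF L that])
  have d0: "l 1 [(k, 0)] = 0" for k using d[of 0 k 0] by simp
  show "homologous L l i \<subseteq> {x \<in> cmp L i. l 1 [(i, x)] = 0} \<times> {x \<in> cmp L i. l 1 [(i, x)] = 0}"
    by (auto simp: homologous_def)
  show "refl_on {x \<in> cmp L i. l 1 [(i, x)] = 0} (homologous L l i)"
    by (auto simp: refl_on_def homologous_def d0[unfolded One_nat_def] intro!: bexI[of _ 0])
  show "sym (homologous L l i)"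
  proof (rule symI)
    fix x y assume "(x, y) \<in> homologous L l i"
    then obtain z where "z \<in> cmp L (i + 1)" "x - y = l 1 [(i + 1, z)]"
      and xy: "x \<in> cmp L i" "l 1 [(i, x)] = 0" "y \<in> cmp L i" "l 1 [(i, y)] = 0"
      by (auto simp: homologous_def)
    then have "y - x = l 1 [(i + 1, - z)]" "- z \<in> cmp L (i + 1)"
      using d[of "- z" "i + 1" z] d0[of "i + 1"] by (simp_all add: add_eq_0_iff2 algebra_simps)
    with xy show "(y, x) \<in> homologous L l i" by (auto simp: homologous_def)
  qed
  show "trans (homologous L l i)"
  proof (rule transI)
    fix x y z assume "(x, y) \<in> homologous L l i" "(y, z) \<in> homologous L l i"
    then obtain a b where a: "a \<in> cmp L (i + 1)" "x - y = l 1 [(i + 1, a)]"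
      and b: "b \<in> cmp L (i + 1)" "y - z = l 1 [(i + 1, b)]"
      and xz: "x \<in> cmp L i" "l 1 [(i, x)] = 0" "z \<in> cmp L i" "l 1 [(i, z)] = 0"
      by (auto simp: homologous_def)
    have "x - z = l 1 [(i + 1, a + b)]"
      using a(2) b(2) unfolding d[OF a(1) b(1)] by (metis add_diff_eq diff_add_cancel)
    moreover have "a + b \<in> cmp L (i + 1)" using a b by simp
    ultimately show "(x, z) \<in> homologous L l i" using xz by (auto simp: homologous_def)
  qed
qed

text \<open>Criterion by a deformation retract: the retraction \<open>p\<close> makes
  \<open>j\<close> injective on homology, and for surjectivity each cycle \<open>y\<close> only has
  to be homologous to its image under \<open>p\<close> followed by \<open>j\<close>, so the homotopy
  is required on cycles alone.\<close>

lemma weak_equivalenceI: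
  assumes L: "Linf_algebra L l" and M: "Linf_algebra M m"
    and j: "\<And>i x. x \<in> cmp L i \<Longrightarrow> j 1 [(i, x)] \<in> cmp M i" "\<And>i. j 1 [(i, 0)] = 0"
      "\<And>i x y. x \<in> cmp L i \<Longrightarrow> y \<in> cmp L i \<Longrightarrow> j 1 [(i, x - y)] = j 1 [(i, x)] - j 1 [(i, y)]"
      "\<And>i x. x \<in> cmp L i \<Longrightarrow> m 1 [(i, j 1 [(i, x)])] = j 1 [(i - 1, l 1 [(i, x)])]"
    and p: "\<And>i y. y \<in> cmp M i \<Longrightarrow> p y \<in> cmp L i" "\<And>x y. p (x - y) = p x - p y" "\<And>i x. p (j 1 [(i, x)]) = x"
      "\<And>i y. y \<in> cmp M i \<Longrightarrow> p (m 1 [(i, y)]) = l 1 [(i, p y)]"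
    and h: "\<And>i y. y \<in> cmp M i \<Longrightarrow> m 1 [(i, y)] = 0 \<Longrightarrow> \<exists>z\<in>cmp M (i + 1). y - j 1 [(i, p y)] = m 1 [(i + 1, z)]"
  shows "weak_equivalence L l M m j"
  unfolding weak_equivalence_def
proof
  fix i
  let ?Z = "{x \<in> cmp L i. l 1 [(i, x)] = 0}" and ?Z' = "{x \<in> cmp M i. m 1 [(i, x)] = 0}"
  let ?R = "homologous L l i" and ?R' = "homologous M m i"
  note E = equiv_homologous[OF L, of i] and E' = equiv_homologous[OF M, of i]
  have p0: "p 0 = 0" using p(2)[of 0 0] by simp
  have jZ: "j 1 [(i, x)] \<in> ?Z'" if "x \<in> ?Z" for x
    using that j(1,2,4) by auto
  have jR: "(j 1 [(i, x)], j 1 [(i, y)]) \<in> ?R'" if xy: "(x, y) \<in> ?R" for x y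
  proof -
    obtain z where z: "z \<in> cmp L (i + 1)" "x - y = l 1 [(i + 1, z)]" using xy by (auto simp: homologous_def)
    have "x \<in> ?Z" "y \<in> ?Z" using xy by (auto simp: homologous_def)
    moreover have "j 1 [(i, x)] - j 1 [(i, y)] = m 1 [(i + 1, j 1 [(i + 1, z)])]"
      using j(3)[of x i y] j(4)[OF z(1)] z(2) \<open>x \<in> ?Z\<close> \<open>y \<in> ?Z\<close> by simp
    ultimately show ?thesis using jZ[of x] jZ[of y] j(1)[OF z(1)] by (auto simp: homologous_def)
  qed
  have map: "homology_map M m j i (?R `` {x}) = ?R' `` {j 1 [(i, x)]}" if x: "x \<in> ?Z" for x
  proof -
    have "?R' `` {j 1 [(i, y)]} = ?R' `` {j 1 [(i, x)]}" if "(x, y) \<in> ?R" for y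
      using equiv_class_eq[OF E' jR[OF that]] by simp
    moreover have "x \<in> ?R `` {x}" using equiv_class_self[OF E x] .
    ultimately show ?thesis unfolding homology_map_def by blast
  qed
  show "bij_betw (homology_map M m j i) (homology L l i) (homology M m i)"
    unfolding bij_betw_def homology_def
  proof
    show "inj_on (homology_map M m j i) (?Z // ?R)"
    proof (rule inj_onI)
      fix X Y assume "X \<in> ?Z // ?R" "Y \<in> ?Z // ?R" and eq: "homology_map M m j i X = homology_map M m j i Y"
      then obtain x y where x: "x \<in> ?Z" "X = ?R `` {x}" and y: "y \<in> ?Z" "Y = ?R `` {y}"
        by (auto elim!: quotientE)
      then have "(j 1 [(i, x)], j 1 [(i, y)]) \<in> ?R'"
        using eq map eq_equiv_class[OF _ E' jZ] by simp
      then obtain z where z: "z \<in> cmp M (i + 1)" "j 1 [(i, x)] - j 1 [(i, y)] = m 1 [(i + 1, z)]"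
        by (auto simp: homologous_def)
      have "x - y = l 1 [(i + 1, p z)]"
        using arg_cong[OF z(2), of p] p(2,3) p(4)[OF z(1)] by simp
      then have "(x, y) \<in> ?R" using x(1) y(1) p(1)[OF z(1)] by (auto simp: homologous_def)
      then show "X = Y" using equiv_class_eq[OF E] x y by simp
    qed
    show "homology_map M m j i ` (?Z // ?R) = ?Z' // ?R'"
    proof (intro equalityI subsetI)
      fix Y assume "Y \<in> homology_map M m j i ` (?Z // ?R)"
      then obtain x where "x \<in> ?Z" "Y = homology_map M m j i (?R `` {x})" by (auto elim!: quotientE)
      then show "Y \<in> ?Z' // ?R'" using map jZ by (auto intro: quotientI)
    next
      fix Y assume "Y \<in> ?Z' // ?R'"
      then obtain y where y: "y \<in> ?Z'" "Y = ?R' `` {y}" by (auto elim!: quotientE)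
      have py: "p y \<in> ?Z" using y(1) p(1)[of y i] p(4)[of y i] p0 by auto
      have "(y, j 1 [(i, p y)]) \<in> ?R'"
        using y(1) jZ[OF py] h[of y i] by (auto simp: homologous_def)
      then have "Y = homology_map M m j i (?R `` {p y})"
        using equiv_class_eq[OF E'] y(2) map[OF py] by simp
      then show "Y \<in> homology_map M m j i ` (?Z // ?R)" using py by (auto intro: quotientI)
    qed
  qed
qed

section \<open>The factorisation\<close>

locale strict_morphism =
  fixes n :: enat
    and L :: "('k::field_char_0, 'a::ab_group_add) gvs" and l :: "nat \<Rightarrow> 'a word \<Rightarrow> 'a"
    and L' :: "('k, 'b::ab_group_add) gvs" and l' :: "nat \<Rightarrow> 'b word \<Rightarrow> 'b"
    and f :: "nat \<Rightarrow> 'a word \<Rightarrow> 'b"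
  assumes lie: "Lie_algebra n L l" and lie': "Lie_algebra n L' l'"
    and morphism: "Linf_morphism L l L' l' f" and strict: "strict_on L f"
begin

lemma Linf: "Linf_algebra L l" "Linf_algebra L' l'"
  using lie lie' by (simp_all add: Lie_algebra_def)

abbreviation "V \<equiv> susp L"
abbreviation "W \<equiv> susp L'"
abbreviation "br \<equiv> suspended L l"
abbreviation "br' \<equiv> suspended L' l'"

sublocale path_construction V W br br'
  by unfold_locales (use Linf in \<open>auto intro: graded_susp Linf_algebra_graded Linf_algebra_symop\<close>)

sublocale A: graded L
  by unfold_locales (rule Linf_algebra_graded[OF Linf(1)])

sublocale B: graded L'
  by unfold_locales (rule Linf_algebra_graded[OF Linf(2)])

sublocale N: graded N
  by unfold_locales (rule graded_path_space)

declare cmp_susp(2) [simp del]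

lemma vanish: "\<not> (0 \<le> i \<and> enat (nat i) < n) \<Longrightarrow> cmp L i = {0} \<and> cmp L' i = {0}"
  using lie lie' by (auto simp: Lie_algebra_def)

definition g :: "int \<Rightarrow> 'a \<Rightarrow> 'b" where
  "g i v = f 1 [(i, v)]"

lemma g_eq: "(\<lambda>i v. f 1 [(i, v)]) = g"
  by (simp add: g_def fun_eq_iff)

lemma glin_g: "glin L L' g"
  unfolding g_eq[symmetric]
proof (rule glin_morphism)
  show "skew_map 1 0 L L' (f 1)"
    using morphism unfolding Linf_morphism_def by (metis diff_self le_refl of_nat_1)
qed

lemma g_0: "g i 0 = 0"
  using glinD(3)[OF glin_g, of 0 i 0] by simp

lemma bracket_g:
  "w \<in> words V \<Longrightarrow> br' (lmap (susp_map g) w) = g (deg w - 2) (br w)"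
  using strict_Linf_morphism[OF Linf morphism strict] unfolding g_eq by (simp add: g_def)

lemma op_unary:
  "op [(i, y)] = (br [(i, fst y)], pext (br') [(i, fst (snd y))],
     pext (br') [(i + 1, snd (snd y))] + sg i (dv (fst (snd y))))"
  by (simp add: path_op_def del: pext.simps(2))

lemma op_zero_letter: "a \<in> words0 N \<Longrightarrow> b \<in> words0 N \<Longrightarrow> op (a @ (i, 0) # b) = 0"
  by (rule N.descends_zero_letter[OF descends_op N.vector_space_axioms])

lemma op_square:
  assumes "y \<in> cmp N i"
  shows "op [(i - 1, op [(i, y)])] = 0"
  using jacobi_op[OF Linf_algebra_jacobi[OF Linf(1)] Linf_algebra_jacobi[OF Linf(2)], of "[(i, y)]"] assms
  by (simp add: jacobi_def words_eq)

text \<open>With closed arguments the two-argument Jacobi identity retains only the unary bracket of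
  the binary one: brackets of cycles are cycles, as the degree 0 part of the truncation
  requires.\<close>

lemma op_binary:
  assumes "x \<in> cmp N i" "y \<in> cmp N j" "op [(i, x)] = 0" "op [(j, y)] = 0"
  shows "op [(i + j - 1, op [(i, x), (j, y)])] = 0"
proof -
  have "op [(i - 1, 0), (j, y)] = 0" "op [(j - 1, 0), (i, x)] = 0"
    using op_zero_letter[of "[]" "[(j, y)]"] op_zero_letter[of "[]" "[(i, x)]"] assms by simp_all
  then show ?thesis
    using jacobi_op[OF Linf_algebra_jacobi[OF Linf(1)] Linf_algebra_jacobi[OF Linf(2)], of "[(i, x), (j, y)]"] assms
    by (simp add: jacobi_def words_eq)
qed

text \<open>The pullback of the path object along \<open>f\<close>, truncated to nonnegative degrees.\<close>

definition M :: "('k, 'a \<times> 'b poly \<times> 'b poly) gvs" where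
  "M = \<lparr>scl = scl N, cmp = (\<lambda>i. {y \<in> cmp N (i + 1). coeff (fst (snd y)) 0 = g i (fst y) \<and>
     (i < 0 \<longrightarrow> y = 0) \<and> (i = 0 \<longrightarrow> op [(i + 1, y)] = 0)})\<rparr>"

section \<open>The truncated pullback as a Lie n-algebra\<close>

lemma scl_M: "scl M = scl N"
  by (simp add: M_def)

lemma scl_susp_M: "scl (susp M) = scl N"
  by (simp add: cmp_susp(2) scl_M)

lemma cmp_M: "y \<in> cmp M i \<longleftrightarrow> y \<in> cmp N (i + 1) \<and> coeff (fst (snd y)) 0 = g i (fst y) \<and>
     (i < 0 \<longrightarrow> y = 0) \<and> (i = 0 \<longrightarrow> op [(i + 1, y)] = 0)"
  by (simp add: M_def)

lemma graded_M: "graded_space M"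
proof -
  have "N.subspace (cmp M i)" for i
    unfolding N.subspace_def
  proof (intro conjI ballI allI)
    show "0 \<in> cmp M i"
      using op_zero_letter[of "[]" "[]"] by (simp add: cmp_M g_0)
  next
    fix x y assume x: "x \<in> cmp M i" and y: "y \<in> cmp M i"
    then have "op [(i + 1, x + y)] = op [(i + 1, x)] + op [(i + 1, y)]"
      using descends0D(1)[OF descends_op, of "[]" "[]" x "i + 1" y] by (simp add: cmp_M)
    moreover have "g i (fst x + fst y) = g i (fst x) + g i (fst y)"
      using x y by (intro glinD(3)[OF glin_g]) (simp_all add: cmp_M path_space_simps(2))
    ultimately show "x + y \<in> cmp M i"
      using x y N.cmp_intros(4)[of x "i + 1" y] by (cases "i = 0") (simp_all add: cmp_M)
  next
    fix c x assume x: "x \<in> cmp M i"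
    then have "op [(i + 1, scl N c x)] = scl N c (op [(i + 1, x)])"
      using descends0D(2)[OF descends_op, of "[]" "[]" x "i + 1" c] by (simp add: cmp_M)
    moreover have "g i (scl V c (fst x)) = scl W c (g i (fst x))"
      unfolding cmp_susp(2) using x by (intro glinD(2)[OF glin_g]) (simp add: cmp_M path_space_simps(2))
    moreover have "fst (scl N c x) = scl V c (fst x)"
      "coeff (fst (snd (scl N c x))) 0 = scl W c (coeff (fst (snd x)) 0)"
      by (simp_all add: path_space_simps(1))
    ultimately show "scl N c x \<in> cmp M i"
      using x N.cmp_intros(2)[of x "i + 1" c] by (cases "i = 0") (simp_all add: cmp_M)
  qed
  then show ?thesis
    using N.vector_space_axioms by (simp add: graded_space_def scl_M)
qed

lemma words0_M: "w \<in> words0 (susp M) \<Longrightarrow> w \<in> words0 N"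
  by (auto simp: words0_def cmp_M)

text \<open>Nonzero letters have suspended degree at least 1, so an output in degree at most 0
  leaves three shapes of words: one letter of degree 1, closed by definition; one of degree 2,
  covered by \<open>op_square\<close>; two of degree 1, covered by \<open>op_binary\<close>.\<close>

lemma op_M:
  assumes w: "w \<in> words0 (susp M)" "w \<noteq> []"
  shows "op w \<in> cmp M (deg w - 2)"
\<comment> \<open>Zero lies in every component, also in negative degrees, so words with a zero
  letter escape the degree count.\<close>
proof (cases "\<exists>i. (i, 0) \<in> set w")
  case True
  then obtain a i b where "w = a @ (i, 0) # b" by (auto dest!: split_list)
  then have "op w = 0" using op_zero_letter[of a b i] words0_M[OF w(1)] by simp
  then show ?thesis using graded.cmp_intros(1)[OF graded.intro[OF graded_M]] by simp
next
  case False
  have wN: "w \<in> words0 N" by (rule words0_M[OF w(1)])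
  have letter: "y \<in> cmp M (i - 1) \<and> 1 \<le> i" if "(i, y) \<in> set w" for i y
  proof -
    have "y \<in> cmp M (i - 1)" using w(1) that by (auto simp: words0_def)
    then show ?thesis using False that by (auto simp: cmp_M)
  qed
  have 1: "op w \<in> cmp N (deg w - 2 + 1)"
    using op_mem[OF wN w(2)] by simp
  have "coeff (fst (snd (op w))) 0 = g (deg w - 2) (fst (op w))"
  proof -
    have "coeff (fst (snd (op w))) 0 = ev 0 (pext (br') (lmap fun_part w))"
      by (simp add: path_op_def W.pev_at_0)
    also have "\<dots> = br' (lmap (fun_at 0) w)"
      by (rule ev_fun[OF wN])
    \<comment> \<open>The pullback condition on each letter: the value at \<open>t = 0\<close> is
      the image of the base component.\<close>
    also have "lmap (fun_at 0) w = lmap (susp_map g) (lmap base_part w)"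
      unfolding lmap_comp
      by (rule lmap_cong) (use letter in \<open>auto simp: cmp_M susp_map_def W.pev_at_0\<close>)
    also have "br' \<dots> = g (deg w - 2) (br (lmap base_part w))"
      using bracket_g[of "lmap base_part w"] lmap_words0[OF glin_parts(1) wN] w(2) by (simp add: words_eq)
    finally show ?thesis by (simp add: path_op_def)
  qed
  moreover have "(deg w - 2 < 0 \<longrightarrow> op w = 0) \<and> (deg w - 2 = 0 \<longrightarrow> op [(deg w - 2 + 1, op w)] = 0)"
  proof -
    have "int (length v) \<le> deg v" if "set v \<subseteq> set w" for v
      using that letter by (induction v) fastforce+
    then have len: "int (length w) \<le> deg w" by blast
    consider x where "w = [(1, x)]" | x where "w = [(2, x)]" | x y where "w = [(1, x), (1, y)]" | "2 < deg w"
    proof (cases w)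
      case (Cons z v)
      have z: "1 \<le> fst z" using letter[of "fst z" "snd z"] Cons by simp
      show thesis
      proof (cases v)
        case Nil
        then show thesis using Cons z that(1)[of "snd z"] that(2)[of "snd z"] that(4) by (cases z) force
      next
        case (Cons y u)
        have y: "1 \<le> fst y" using letter[of "fst y" "snd y"] Cons \<open>w = z # v\<close> by simp
        show thesis
        proof (cases u)
          case Nil
          then show thesis using \<open>w = z # v\<close> Cons z y that(3)[of "snd z" "snd y"] that(4) by (cases z; cases y) force
        next
          case (Cons x t)
          then show thesis using \<open>w = z # v\<close> \<open>v = y # u\<close> len that(4) by simp
        qed
      qed
    qed (use w in simp)
    then show ?thesis
    proof cases
      case (1 x)
      then show ?thesis using letter[of 1 x] by (simp add: cmp_M)
    next
      case (2 x)
      then show ?thesis using op_square[of x 2] letter[of 2 x] by (simp add: cmp_M)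
    next
      case (3 x y)
      then show ?thesis using op_binary[of x 1 y 1] letter[of 1 x] letter[of 1 y] by (simp add: cmp_M)
    qed simp
  qed
  ultimately show ?thesis using 1 by (simp only: cmp_M)
qed

lemma symop_M: "symop (- 1) (susp M) (susp M) op"
  unfolding symop_def
proof (intro conjI ballI)
  fix w assume "w \<in> words (susp M)"
  then show "op w \<in> cmp (susp M) (deg w + - 1)" using op_M[of w] by (simp add: words_eq)
next
  have *: "x \<in> cmp N i" if "x \<in> cmp (susp M) i" for x i using that by (simp add: cmp_M)
  show "descends (susp M) (scl (susp M)) {0} op"
  proof (rule descends0I, goal_cases)
    case (1 a b i v v')
    then show ?case using words0_M * by (intro descends0D(1)[OF descends_op])
  next
    case (2 a b i c v)
    then show ?case using words0_M * unfolding scl_susp_M by (intro descends0D(2)[OF descends_op])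
  next
    case (3 a b i j v v')
    then show ?case using words0_M * by (intro descends0D(3)[OF descends_op])
  qed
qed

abbreviation "m \<equiv> desuspended op"

lemma suspended_m: "suspended M m = op"
  using suspended_desuspended[of M op] N.vector_space_axioms by (auto simp: scl_M)

lemma m_unary: "m 1 [(i, y)] = op [(i + 1, y)]"
  by (simp add: desuspended_def)

lemma l_unary: "l 1 [(i, x)] = br [(i + 1, x)]"
  using suspended_eq[of L l "[(i + 1, x)]"] V.vector_space_axioms by (simp add: cmp_susp(2))

lemma Linf_M: "Linf_algebra M m"
proof (rule Linf_algebraI[OF graded_M symop_M])
  fix w assume "w \<in> words (susp M)"
  then show "jacobi op w = 0"
    using jacobi_op[OF Linf_algebra_jacobi[OF Linf(1)] Linf_algebra_jacobi[OF Linf(2)]] words0_M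
    by (simp add: words_eq)
qed

lemma Lie_M: "Lie_algebra n M m"
  unfolding Lie_algebra_def
proof (intro conjI allI impI Linf_M)
  fix i assume i: "\<not> (0 \<le> i \<and> enat (nat i) < n)"
  interpret M: graded M by unfold_locales (rule graded_M)
  have "y = 0" if y: "y \<in> cmp M i" for y
  proof (cases "i < 0")
    case False
    \<comment> \<open>The coefficient of \<open>dt\<close> lives one degree higher, so vanishing is
      needed in degree \<open>i + 1\<close> as well.\<close>
    have "enat (nat i) \<le> enat (nat (i + 1))" by simp
    with i False have "\<not> (0 \<le> i + 1 \<and> enat (nat (i + 1)) < n)"
      by (auto simp: not_less intro: order_trans)
    then have "cmp L' (1 + i) = {0}" using vanish[of "i + 1"] by (simp add: add.commute)
    then show ?thesis
      using y vanish[OF i]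
      by (auto simp: cmp_M path_space_simps prod_eq_iff poly_eq_iff)
  qed (use y in \<open>simp add: cmp_M\<close>)
  then show "cmp M i = {0}" by auto
qed

section \<open>The two strict morphisms and their composite\<close>

definition incl :: "int \<Rightarrow> 'a \<Rightarrow> 'a \<times> 'b poly \<times> 'b poly" where
  "incl i x = (x, [:g i x:], 0)"

definition end1 :: "int \<Rightarrow> 'a \<times> 'b poly \<times> 'b poly \<Rightarrow> 'b" where
  "end1 i y = ev 1 (fst (snd y))"

lemma incl_N: "x \<in> cmp L i \<Longrightarrow> incl i x \<in> cmp N (i + 1)"
  using glinD(1)[OF glin_g, of x i] by (auto simp: incl_def path_space_simps coeff_pCons split: nat.split)

text \<open>Constant polynomials have zero derivative, and without \<open>dt\<close> parts every
  term of the \<open>dt\<close> component contains a zero letter. The polynomial component is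
  constant because \<open>f\<close> intertwines the brackets.\<close>

lemma op_incl:
  assumes w: "w \<in> words V"
  shows "op (lmap (susp_map incl) w) = incl (deg w - 2) (br w)"
proof -
  let ?w = "lmap (susp_map incl) w"
  have wN: "?w \<in> words0 N" "?w \<noteq> []"
  proof -
    have "susp_map incl (fst z) (snd z) \<in> cmp N (fst z)" if "z \<in> set w" for z
      using w that incl_N[of "snd z" "fst z - 1"] by (auto simp: words_def susp_map_def)
    then show "?w \<in> words0 N" by (auto simp: words0_def lmap_def)
    show "?w \<noteq> []" using w by (simp add: words_eq)
  qed
  have "fst (op ?w) = br w"
    by (simp add: path_op_def lmap_comp susp_map_def incl_def)
  moreover have "fst (snd (op ?w)) = [:g (deg w - 2) (br w):]"
  proof (rule W.pev_ext)
    fix c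
    have "lmap (fun_at c) ?w = lmap (susp_map g) w"
      unfolding lmap_comp by (rule lmap_cong) (simp add: susp_map_def incl_def)
    then show "ev c (fst (snd (op ?w))) = ev c [:g (deg w - 2) (br w):]"
      using ev_fun[OF wN(1), of c] bracket_g[OF w] by (simp add: path_op_def)
  qed
  moreover have "snd (snd (op ?w)) = 0"
  proof (rule W.pev_eq_0)
    fix c
    have "ssum 1 (fun_at c) (form_at c) (br') ?w = 0"
      by (rule ssum_zero[OF W.graded_space symopD(2)[OF q'] W.vector_space_axioms])
        (use letters(3)[OF wN(1)] in \<open>auto simp: lmap_def susp_map_def incl_def\<close>)
    moreover have "(if length ?w = 1 then sg (deg ?w) (dv (fst (snd (snd (hd ?w))))) else 0) = 0"
      by (cases w) (simp_all add: susp_map_def incl_def W.pder_const)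
    ultimately show "ev c (snd (snd (op ?w))) = 0"
      by (simp only: path_op_def snd_conv W.pev_add ev_form[OF wN(1)] W.pev_0 add_0)
  qed
  ultimately show ?thesis by (simp add: incl_def prod_eq_iff)
qed

lemma incl_M:
  assumes x: "x \<in> cmp L i"
  shows "incl i x \<in> cmp M i"
proof -
  have "incl i x = 0" if "i < 0"
    using vanish[of i] that x g_0 by (simp add: incl_def prod_eq_iff)
  moreover have "op [(i + 1, incl i x)] = 0" if "i = 0"
  proof -
    have *: "[(i + 1, x)] \<in> words V" using x by (simp add: words_eq)
    \<comment> \<open>\<open>L\<close> vanishes in degree -1, so each of its elements of degree 0 is
      a cycle and the truncation condition is automatic.\<close>
    have "br [(i + 1, x)] \<in> cmp L (- 1)"
      using symopD(1)[OF q, of "[(i + 1, x)]"] x that by simp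
    then have "br [(i + 1, x)] = 0" using vanish[of "- 1"] by simp
    with op_incl[OF *] show ?thesis using that g_0 by (simp add: susp_map_def incl_def prod_eq_iff)
  qed
  ultimately show ?thesis using incl_N[OF x] by (simp add: cmp_M) (simp add: incl_def)
qed

lemma glin_incl: "glin L M incl"
  unfolding glin_def
  using incl_M glinD(2,3)[OF glin_g]
  by (auto simp: incl_def scl_M path_space_simps map_poly_pCons cmp_susp(2))

lemma Linf_morphism_incl: "Linf_morphism L l M m (strict_map incl)"
  by (rule Linf_morphism_strict_map[OF Linf(1) Linf_M glin_incl]) (simp only: suspended_m op_incl)

lemma susp_end1: "susp_map end1 = fun_at 1"
  by (simp add: fun_eq_iff susp_map_def end1_def)

lemma glin_end1: "glin M L' end1"
  unfolding glin_def
proof (intro allI ballI conjI)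
  fix i y assume "y \<in> cmp M i"
  then have y: "y \<in> cmp N (i + 1)" by (simp add: cmp_M)
  note d = glinD[OF glin_parts(4)[of 1] y]
  show "end1 i y \<in> cmp L' i" "end1 i (scl M c y) = scl L' c (end1 i y)" for c
    using d(1) d(2)[of c] by (simp_all add: end1_def scl_M cmp_susp(2))
  fix y' assume "y' \<in> cmp M i"
  then show "end1 i (y + y') = end1 i y + end1 i y'"
    using d(3)[of y'] by (simp add: end1_def cmp_M)
qed

lemma Linf_morphism_end1: "Linf_morphism M m L' l' (strict_map end1)"
proof (rule Linf_morphism_strict_map[OF Linf_M Linf(2) glin_end1])
  fix w assume "w \<in> words (susp M)"
  then have "w \<in> words0 N" using words0_M by (simp add: words_eq)
  then show "br' (lmap (susp_map end1) w) = end1 (deg w - 2) (suspended M m w)"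
    unfolding suspended_m susp_end1 by (simp add: end1_def path_op_def ev_fun)
qed

lemma composite: "Linf_composite L M L' (strict_map end1) (strict_map incl) f"
  unfolding Linf_composite_def
proof (intro exI conjI ballI)
  have vs: "vector_space (scl M)" "vector_space (scl L')"
    using N.vector_space_axioms W.vector_space_axioms by (simp_all add: scl_M cmp_susp(2))
  show "comorph L M (strict_map incl) (\<lambda>w. mon (lmap (susp_map incl) w))"
    by (intro comorph_strict graded_M glin_incl suspended_strict_map vs)
  show "comorph M L' (strict_map end1) (\<lambda>w. mon (lmap (susp_map end1) w))"
    by (intro comorph_strict Linf_algebra_graded[OF Linf(2)] glin_end1 suspended_strict_map vs)
  show "comorph L L' f (\<lambda>w. mon (lmap (susp_map g) w))"
    by (intro comorph_strict Linf_algebra_graded[OF Linf(2)] glin_g strict_on_suspended[OF vs(2) strict, unfolded g_eq])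
  fix w
  have "lmap (susp_map end1) (lmap (susp_map incl) w) = lmap (susp_map g) w"
    unfolding lmap_comp by (rule lmap_cong) (simp add: susp_map_def end1_def incl_def)
  then show "sym_eq (susp L') (mon (lmap (susp_map g) w))
      (lin (\<lambda>w. mon (lmap (susp_map end1) w)) (mon (lmap (susp_map incl) w)))"
    by (simp add: sym_eq_def zero_sym_rel)
qed

section \<open>Fibration and weak equivalence\<close>

lemma fibration_end1: "fibration M L' (strict_map end1)"
  unfolding fibration_def
proof (intro allI impI equalityI subsetI)
  fix i x assume "x \<in> (\<lambda>x. strict_map end1 1 [(i, x)]) ` cmp M i"
  then show "x \<in> cmp L' i" using glinD(1)[OF glin_end1] by (auto simp: strict_map_def)
next
  fix i :: int and x assume i: "0 < i" and x: "x \<in> cmp L' i"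
  \<comment> \<open>The path \<open>x t\<close> runs from 0 to \<open>x\<close> and so lies over the
    base element 0. It is admissible because the cycle condition concerns degree 0 only.\<close>
  let ?y = "(0, [:0, x:], 0) :: 'a \<times> 'b poly \<times> 'b poly"
  have "?y \<in> cmp M i"
    using i x g_0
    by (auto simp: cmp_M path_space_simps coeff_pCons split: nat.split)
  moreover have "x = strict_map end1 1 [(i, ?y)]"
    by (simp add: strict_map_def end1_def W.pev_shift1)
  ultimately show "x \<in> (\<lambda>x. strict_map end1 1 [(i, x)]) ` cmp M i"
    by (rule rev_image_eqI)
qed

text \<open>The homotopy is integration \<open>p(t) + r(t) dt \<mapsto> \<integral>\<^sub>0\<^sup>t r\<close>, up to sign.\<close>

lemma contraction:
  assumes y: "y \<in> cmp M i" and dy: "op [(i + 1, y)] = 0"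
  shows "\<exists>z\<in>cmp M (i + 1). y - incl i (fst y) = op [(i + 2, z)]"
proof (cases "i < 0")
  case True
  interpret M: graded M by unfold_locales (rule graded_M)
  have "y = 0" using y True by (simp add: cmp_M)
  moreover have "op [(i + 2, 0)] = 0" using op_zero_letter[of "[]" "[]"] by simp
  ultimately show ?thesis using g_0 by (intro bexI[of _ 0]) (simp_all add: incl_def prod_eq_iff)
next
  case False
  obtain x p r where xpr: "y = (x, p, r)" by (cases y)
  \<comment> \<open>The sign cancels the one with which the derivative enters the unary bracket in
    suspended degree \<open>i + 2\<close>.\<close>
  define P where "P = sg i (pint (scl W) r)"
  have coeffs: "coeff r k \<in> cmp W (i + 2)" "coeff p k \<in> cmp W (i + 1)" "x \<in> cmp V (i + 1)" for k
    using y by (auto simp: cmp_M xpr path_space_simps add.assoc)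
  have P: "coeff P k \<in> cmp W (i + 2)" for k
    unfolding P_def by (intro W.coeffs_mem[OF W.subspace_cmp] coeffs)
  \<comment> \<open>Closedness of \<open>y\<close>, read in its \<open>dt\<close> component.\<close>
  have dr: "pext br' [(i + 2, r)] = - sg (i + 1) (dv p)"
    using dy unfolding xpr op_unary by (simp add: prod_eq_iff add_eq_0_iff2 add.assoc del: pext.simps(2))
  \<comment> \<open>The derivatives agree by closedness of \<open>y\<close>; at 0 the pullback
    condition gives the value \<open>g i x\<close> of \<open>p\<close>, while \<open>P\<close>
    vanishes there.\<close>
  have "pext br' [(i + 2, P)] - (p - [:g i x:]) = 0"
  proof (rule W.pder_eq_0)
    have "dv (pext br' [(i + 2, P)]) = dv p"
    proof (rule W.pev_ext)
      fix c
      have "ev c (dv (pext br' [(i + 2, P)])) = br' [(i + 2, ev c (dv P))]"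
        using W.pev_Leibniz[OF symopD(2)[OF q'], of "[(i + 2, P)]" c] P by simp
      also have "ev c (dv P) = scl W (sgn_pow i) (ev c r)"
        by (simp add: P_def W.pder_sg W.pder_pint W.pev_sg)
      also have "br' [(i + 2, \<dots>)] = scl W (sgn_pow i) (br' [(i + 2, ev c r)])"
        using descends0D(2)[OF symopD(2)[OF q'], of "[]" "[]" "ev c r" "i + 2" "sgn_pow i"] W.pev_cmp[OF coeffs(1)]
        by simp
      also have "br' [(i + 2, ev c r)] = ev c (pext br' [(i + 2, r)])"
        using W.pev_pext[OF symopD(2)[OF q'], of "[(i + 2, r)]" c] coeffs by simp
      also have "scl W (sgn_pow i) \<dots> = ev c (dv p)"
        unfolding dr by (simp add: W.pev_sg W.pev_uminus sg_def)
      finally show "ev c (dv (pext br' [(i + 2, P)])) = ev c (dv p)" .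
    qed
    then show "dv (pext br' [(i + 2, P)] - (p - [:g i x:])) = 0"
      by (simp add: W.pder_diff W.pder_const del: pext.simps(2))
    have "ev 0 (pext br' [(i + 2, P)]) = br' [(i + 2, ev 0 P)]"
      using W.pev_pext[OF symopD(2)[OF q'], of "[(i + 2, P)]" 0] P by simp
    also have "ev 0 P = 0" by (simp add: P_def W.pev_sg W.pev_0_pint)
    also have "br' [(i + 2, 0)] = 0"
      using W.descends_zero_letter[OF symopD(2)[OF q'] W.vector_space_axioms, of "[]" "[]"] by simp
    finally show "ev 0 (pext br' [(i + 2, P)] - (p - [:g i x:])) = 0"
      using y by (simp add: W.pev_diff W.pev_at_0 cmp_M xpr del: pext.simps(2))
  qed
  then have dP: "pext br' [(i + 2, P)] = p - [:g i x:]" by simp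
  have "br [(i + 2, 0)] = 0"
    using V.descends_zero_letter[OF symopD(2)[OF q] V.vector_space_axioms, of "[]" "[]"] by simp
  moreover have "pext br' [(i + 3, 0)] = 0"
    using W.descends_zero_letter[OF symopD(2)[OF q'] W.vector_space_axioms, of "[]" "[]"] by simp
  moreover have "sg (i + 2) (dv P) = r"
    by (simp add: P_def W.pder_sg W.pder_pint) (simp add: sg_def)
  ultimately have "op [(i + 2, (0, P, 0))] = (0, p - [:g i x:], r)"
    unfolding op_unary by (simp add: dP add.assoc del: pext.simps(2))
  then have "y - incl i (fst y) = op [(i + 2, (0, P, 0))]"
    by (simp add: xpr incl_def)
  \<comment> \<open>\<open>P\<close> vanishes at 0 and therefore lies over the base element 0; since
    \<open>i + 1\<close> is positive, no cycle condition arises.\<close>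
  moreover have "(0, P, 0) \<in> cmp M (i + 1)"
    using False P g_0
    by (simp add: cmp_M path_space_simps add.assoc P_def W.pev_sg W.pev_0_pint flip: W.pev_at_0)
  ultimately show ?thesis by blast
qed

lemma weak_equivalence_incl: "weak_equivalence L l M m (strict_map incl)"
proof (rule weak_equivalenceI[where p = fst, OF Linf(1) Linf_M])
  have si: "strict_map incl 1 [(i, x)] = incl i x" for i x by (simp add: strict_map_def)
  show "strict_map incl 1 [(i, x)] \<in> cmp M i" if "x \<in> cmp L i" for i x
    using that by (simp only: si incl_M)
  show "strict_map incl 1 [(i, 0)] = 0" for i
    unfolding si by (simp add: incl_def g_0 prod_eq_iff)
  show "strict_map incl 1 [(i, x - y)] = strict_map incl 1 [(i, x)] - strict_map incl 1 [(i, y)]"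
    if "x \<in> cmp L i" "y \<in> cmp L i" for i x y
  proof -
    have "g i (x - y) + g i y = g i x"
      using glinD(3)[OF glin_g, of "x - y" i y] V.cmp_intros(5)[of x "i + 1" y] that by simp
    then show ?thesis unfolding si by (simp add: incl_def algebra_simps flip: eq_diff_eq)
  qed
  show "m 1 [(i, strict_map incl 1 [(i, x)])] = strict_map incl 1 [(i - 1, l 1 [(i, x)])]"
    if "x \<in> cmp L i" for i x
    unfolding si m_unary l_unary
    using op_incl[of "[(i + 1, x)]"] that by (simp add: words_eq susp_map_def)
  show "fst y \<in> cmp L i" if "y \<in> cmp M i" for i y
    using that by (simp add: cmp_M path_space_simps)
  show "fst (strict_map incl 1 [(i, x)]) = x" for i x
    unfolding si by (simp add: incl_def)
  show "fst (m 1 [(i, y)]) = l 1 [(i, fst y)]" for i y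
    unfolding m_unary l_unary op_unary by simp
  show "\<exists>z\<in>cmp M (i + 1). y - strict_map incl 1 [(i, fst y)] = m 1 [(i + 1, z)]"
    if "y \<in> cmp M i" "m 1 [(i, y)] = 0" for i y
    using contraction[OF that(1)] that(2) unfolding si m_unary by (simp add: add.assoc)
qed simp

end

theorem proposition3p8:
  fixes n :: enat
    and L :: "('k::field_char_0, 'a::ab_group_add) gvs" and l :: "nat \<Rightarrow> 'a word \<Rightarrow> 'a"
    and L' :: "('k, 'b::ab_group_add) gvs" and l' :: "nat \<Rightarrow> 'b word \<Rightarrow> 'b"
    and f :: "nat \<Rightarrow> 'a word \<Rightarrow> 'b"
  assumes "Lie_algebra n L l" and "Lie_algebra n L' l'"
    and "Linf_morphism L l L' l' f" and "strict_on L f"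
  shows "\<exists>(M :: ('k, 'a \<times> 'b poly \<times> 'b poly) gvs) m j \<phi>.
           Lie_algebra n M m \<and>
           Linf_morphism L l M m j \<and> Linf_morphism M m L' l' \<phi> \<and>
           Linf_composite L M L' \<phi> j f \<and>
           weak_equivalence L l M m j \<and> fibration M L' \<phi>"
proof -
  interpret strict_morphism n L l L' l' f
    by unfold_locales (fact assms)+
  show ?thesis
    using Lie_M Linf_morphism_incl Linf_morphism_end1 composite weak_equivalence_incl fibration_end1 by blast
qed

end
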